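(* There exists a constant $c_0>0$ such that for every $V>0$, $$c_0\min\{V,\,V^{4/5}\}\le F_s(V)\le c_0^{-1}\min\{V,\,V^{4/5}\}.$$ Moreover, there exists $C>0$ with the following property: if $V$ is large enough and $(u,h)\in\mathcal{A}_V$ satisfies $E_V(u,h)+S_V(h)\le \frac{1}{c_0}V^{4/5}$, then $\max h\ge C V^{3/5}$.
   Context: For a nonnegative $h\in H^1(\mathbb{R})$ (identified with its continuous representative), let $\Omega_h:=\{(x,y)\in\mathbb{R}^2: 0<y<h(x)\}$. For $V>0$, let $\mathcal{A}_V$ be the set of pairs $(u,h)$ with $h\in H^1(\mathbb{R})$, $h\ge 0$, $u\in H^1(\Omega_h)$ real-valued, $\int_{\mathbb{R}}h\,dx=V$, and $u(x,0)=x$ (in the sense of traces) for $x\in\operatorname{supp}h$. Set $$E_V(u,h):=\int_{\Omega_h}|\nabla u|^2\,dx\,dy,\qquad S_V(h):=\int_{\mathbb{R}}h'^2\,dx,\qquad F_s(V):=\inf\{E_V(u,h)+S_V(h): (u,h)\in\mathcal{A}_V\}.$$ *)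

theory Defs
  imports "HOL-Analysis.Analysis"
begin

fun C_diff :: "nat \<Rightarrow> ('a::euclidean_space \<Rightarrow> real) \<Rightarrow> bool" where
  "C_diff 0 f \<longleftrightarrow> continuous_on UNIV f"
| "C_diff (Suc k) f \<longleftrightarrow>
     (\<forall>x. f differentiable (at x)) \<and> (\<forall>b\<in>Basis. C_diff k (\<lambda>x. frechet_derivative f (at x) b))"

definition smooth :: "('a::euclidean_space \<Rightarrow> real) \<Rightarrow> bool" where
  "smooth f \<longleftrightarrow> (\<forall>k. C_diff k f)"

definition test_functions :: "'a::euclidean_space set \<Rightarrow> ('a \<Rightarrow> real) set" where
  "test_functions \<Omega> =
     {\<phi>. smooth \<phi> \<and> compact (closure {x. \<phi> x \<noteq> 0}) \<and> closure {x. \<phi> x \<noteq> 0} \<subseteq> \<Omega>}"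

definition in_L2 :: "'a::euclidean_space set \<Rightarrow> ('a \<Rightarrow> 'b::euclidean_space) \<Rightarrow> bool" where
  "in_L2 \<Omega> f \<longleftrightarrow> f \<in> borel_measurable (lebesgue_on \<Omega>) \<and>
     integrable (lebesgue_on \<Omega>) (\<lambda>x. (norm (f x))\<^sup>2)"

text \<open>Elements of Sobolev spaces on an open set \<open>\<Omega>\<close> are represented by functions on the whole
  space of which only the values on \<open>\<Omega>\<close> matter. The weak gradient takes values in the
  space itself, so on the real line it is the weak derivative.\<close>

definition is_weak_gradient ::
    "'a::euclidean_space set \<Rightarrow> ('a \<Rightarrow> real) \<Rightarrow> ('a \<Rightarrow> 'a) \<Rightarrow> bool" where
  "is_weak_gradient \<Omega> u G \<longleftrightarrow>
     (\<forall>\<phi>\<in>test_functions \<Omega>. \<forall>b\<in>Basis.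
        integral\<^sup>L (lebesgue_on \<Omega>) (\<lambda>x. u x * frechet_derivative \<phi> (at x) b)
          = - integral\<^sup>L (lebesgue_on \<Omega>) (\<lambda>x. (G x \<bullet> b) * \<phi> x))"

definition in_H1 :: "'a::euclidean_space set \<Rightarrow> ('a \<Rightarrow> real) \<Rightarrow> bool" where
  "in_H1 \<Omega> u \<longleftrightarrow> in_L2 \<Omega> u \<and> (\<exists>G. in_L2 \<Omega> G \<and> is_weak_gradient \<Omega> u G)"

text \<open>For \<open>u\<close> in \<open>H\<^sup>1\<close> the weak gradient is unique up to null sets; the choice of
  representative does not affect the integrals below.\<close>

definition weak_gradient :: "'a::euclidean_space set \<Rightarrow> ('a \<Rightarrow> real) \<Rightarrow> 'a \<Rightarrow> 'a" where
  "weak_gradient \<Omega> u = (SOME G. in_L2 \<Omega> G \<and> is_weak_gradient \<Omega> u G)"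

definition dirichlet :: "'a::euclidean_space set \<Rightarrow> ('a \<Rightarrow> real) \<Rightarrow> real" where
  "dirichlet \<Omega> u = integral\<^sup>L (lebesgue_on \<Omega>) (\<lambda>x. (norm (weak_gradient \<Omega> u x))\<^sup>2)"

definition H1_norm :: "'a::euclidean_space set \<Rightarrow> ('a \<Rightarrow> real) \<Rightarrow> real" where
  "H1_norm \<Omega> u = sqrt (integral\<^sup>L (lebesgue_on \<Omega>) (\<lambda>x. (u x)\<^sup>2) + dirichlet \<Omega> u)"

text \<open>The trace operator from \<open>H\<^sup>1\<close> of a rectangle to \<open>L\<^sup>2\<close> of its bottom side is the
  continuous extension of the restriction map from the functions smooth up to the boundary,
  which are dense; \<open>g\<close> is the trace of \<open>u\<close> iff it is the limit of the restrictions along some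
  approximating sequence.\<close>

definition has_bottom_trace ::
    "real \<Rightarrow> real \<Rightarrow> real \<Rightarrow> (real \<times> real \<Rightarrow> real) \<Rightarrow> (real \<Rightarrow> real) \<Rightarrow> bool" where
  "has_bottom_trace a b d u g \<longleftrightarrow>
     in_H1 ({a<..<b} \<times> {0<..<d}) u \<and> in_L2 {a<..<b} g \<and>
     (\<exists>v. (\<forall>n. smooth (v n)) \<and>
        (\<lambda>n. H1_norm ({a<..<b} \<times> {0<..<d}) (\<lambda>p. v n p - u p)) \<longlonglongrightarrow> 0 \<and>
        (\<lambda>n. integral\<^sup>L (lebesgue_on {a<..<b}) (\<lambda>x. (v n (x, 0) - g x)\<^sup>2)) \<longlonglongrightarrow> 0)"

definition Omega :: "(real \<Rightarrow> real) \<Rightarrow> (real \<times> real) set" where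
  "Omega h = {(x, y). 0 < y \<and> y < h x}"

text \<open>The trace on \<open>y = 0\<close> is meaningful only over points with \<open>h x > 0\<close>, where \<open>Omega h\<close> is
  locally a half disc; over points with \<open>h x = 0\<close> there is no part of \<open>Omega h\<close>. The
  rectangles contained in \<open>Omega h\<close> with bottom side on \<open>y = 0\<close> cover precisely
  those points.\<close>

definition has_trace_on_supp ::
    "(real \<Rightarrow> real) \<Rightarrow> (real \<times> real \<Rightarrow> real) \<Rightarrow> (real \<Rightarrow> real) \<Rightarrow> bool" where
  "has_trace_on_supp h u g \<longleftrightarrow>
     (\<forall>a b d. a < b \<longrightarrow> 0 < d \<longrightarrow> {a<..<b} \<times> {0<..<d} \<subseteq> Omega h \<longrightarrow> has_bottom_trace a b d u g)"

definition admissible :: "real \<Rightarrow> ((real \<times> real \<Rightarrow> real) \<times> (real \<Rightarrow> real)) set" where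
  "admissible V = {(u, h).
     in_H1 UNIV h \<and> continuous_on UNIV h \<and> (\<forall>x. 0 \<le> h x) \<and>
     in_H1 (Omega h) u \<and>
     has_bochner_integral lebesgue h V \<and>
     has_trace_on_supp h u (\<lambda>x. x)}"

definition E_energy :: "(real \<times> real \<Rightarrow> real) \<Rightarrow> (real \<Rightarrow> real) \<Rightarrow> real" where
  "E_energy u h = dirichlet (Omega h) u"

definition S_energy :: "(real \<Rightarrow> real) \<Rightarrow> real" where
  "S_energy h = integral\<^sup>L lebesgue (\<lambda>x. (weak_gradient UNIV h x)\<^sup>2)"

text \<open>The infimum is taken in the extended reals, so that it carries no junk value in case the
  admissible set is empty.\<close>

definition F_s :: "real \<Rightarrow> ereal" where
  "F_s V = (INF (u, h)\<in>admissible V. ereal (E_energy u h + S_energy h))"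

end

theory Submission
  imports Defs
begin

text \<open>
  Write \<open>A = E + S\<close> for the energy of an admissible pair of volume \<open>V\<close>.

  Lower bound. The boundary value \<open>x\<close> oscillates by \<open>r\<close> over an interval of length \<open>r\<close>, so a
  square of side \<open>r\<close> that stands on the axis inside \<open>Omega h\<close> carries Dirichlet energy at least
  \<open>r\<^sup>2 / 72\<close> (\<open>square_energy_lower_bound\<close>, by testing with an explicit divergence-free field). Around
  a point with \<open>h x = t > 0\<close> take the largest \<open>r \<le> t / 2\<close> for which \<open>h\<close> stays within \<open>t / 2\<close> of \<open>t\<close>
  on \<open>]x - r, x + r[\<close> (\<open>local_scale\<close>). Either \<open>r = t / 2\<close>, and then the square pays for the local
  volume \<open>r t\<close>; or \<open>h\<close> changes by \<open>t / 2\<close> within distance \<open>r\<close>, which costs \<open>t\<^sup>2 / (4 r)\<close> of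
  \<open>S\<close> by Cauchy-Schwarz. In both cases \<open>r t \<lesssim> k (r\<^sup>2 + t\<^sup>2 / r)\<close> as soon as \<open>k \<ge> 1\<close> and
  \<open>h \<le> k\<^sup>3\<close>. A compact part of \<open>{h > 0}\<close> is covered by finitely many such intervals, and on
  the line one can discard intervals until no point lies in more than two of them, so the local
  estimates add up to \<open>V \<le> 864 k A\<close> (\<open>volume_bound\<close>). The same local alternative at the maximum point
  gives \<open>H\<^sup>4\<close> bounded by a multiple of \<open>A\<^sup>3\<close> when \<open>H = max h \<ge> 1\<close> (\<open>height_bound\<close>).
  With \<open>k = H\<close> to the power \<open>1/3\<close> the two bounds combine to \<open>V\<^sup>4 \<lesssim> A\<^sup>5\<close>; with \<open>H \<le> 1\<close>
  one simply takes \<open>k = 1\<close> and gets \<open>V \<lesssim> A\<close>. The bound on the height for large \<open>V\<close> is the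
  inequality \<open>V \<le> 864 k A\<close> read with the upper bound on \<open>A\<close> inserted.

  Upper bound. For a tent of half-width \<open>L\<close> and height \<open>a = V / L\<close> and the potential
  \<open>x exp (- y / L)\<close> one has \<open>S \<le> 2 V\<^sup>2 / L\<^sup>3\<close> and \<open>E \<le> min (4 V) (2 L\<^sup>2)\<close>; the choices
  \<open>L\<^sup>3 = V\<close> for \<open>V \<le> 1\<close> and \<open>L\<^sup>5 = V\<^sup>2\<close> for \<open>V > 1\<close> balance the two terms.

  The rest is the Sobolev calculus that these arguments use: mollified indicators of boxes as test
  functions, uniqueness of weak gradients, agreement of weak and classical gradients for locally
  Lipschitz functions, and the fundamental theorem of calculus for continuous functions on the line
  with square-integrable weak derivative.
\<close>


section \<open>Calculus of smooth functions\<close>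

lemma C_diff_imp_continuous: "C_diff k f \<Longrightarrow> continuous_on UNIV f"
  by (cases k) (simp_all add: differentiable_imp_continuous_within continuous_at_imp_continuous_on)

lemma C_diff_Suc_imp: "C_diff (Suc k) f \<Longrightarrow> C_diff k f"
proof (induction k arbitrary: f)
  case 0
  then show ?case using C_diff_imp_continuous[of "Suc 0" f] by simp
next
  case (Suc k)
  then show ?case by (metis C_diff.simps(2))
qed

lemma C_diff_SucI:
  assumes "\<And>x. (f has_derivative f' x) (at x)" "\<And>b. b \<in> Basis \<Longrightarrow> C_diff k (\<lambda>x. f' x b)"
  shows "C_diff (Suc k) f"
proof -
  have "frechet_derivative f (at x) = f' x" for x
    using assms(1) frechet_derivative_at by metis
  then show ?thesis using assms by (auto simp: differentiable_def)
qed

lemma C_diff_SucD: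
  assumes "C_diff (Suc k) f"
  shows "(f has_derivative frechet_derivative f (at x)) (at x)"
    "b \<in> Basis \<Longrightarrow> C_diff k (\<lambda>x. frechet_derivative f (at x) b)"
  using assms by (auto simp: frechet_derivative_works)

lemma C_diff_const: "C_diff k (\<lambda>x. c)"
proof (induction k arbitrary: c)
  case (Suc k)
  show ?case by (rule C_diff_SucI[OF has_derivative_const]) (rule Suc)
qed simp

lemma C_diff_add: "C_diff k f \<Longrightarrow> C_diff k g \<Longrightarrow> C_diff k (\<lambda>x. f x + g x)"
proof (induction k arbitrary: f g)
  case 0
  then show ?case by (simp add: continuous_on_add)
next
  case (Suc k)
  show ?case
  proof (rule C_diff_SucI)
    show "((\<lambda>x. f x + g x) has_derivative
        (\<lambda>h. frechet_derivative f (at x) h + frechet_derivative g (at x) h)) (at x)" for x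
      by (intro has_derivative_add C_diff_SucD[OF Suc.prems(1)] C_diff_SucD[OF Suc.prems(2)])
    show "C_diff k (\<lambda>x. frechet_derivative f (at x) b + frechet_derivative g (at x) b)"
      if "b \<in> Basis" for b
      by (intro Suc.IH C_diff_SucD(2)[OF Suc.prems(1)] C_diff_SucD(2)[OF Suc.prems(2)] that)
  qed
qed

lemma C_diff_mult: "C_diff k f \<Longrightarrow> C_diff k g \<Longrightarrow> C_diff k (\<lambda>x. f x * g x)"
proof (induction k arbitrary: f g)
  case 0
  then show ?case by (simp add: continuous_on_mult)
next
  case (Suc k)
  note prems = Suc.prems
  show ?case
  proof (rule C_diff_SucI)
    show "((\<lambda>x. f x * g x) has_derivative
        (\<lambda>h. f x * frechet_derivative g (at x) h + frechet_derivative f (at x) h * g x)) (at x)" for x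
      by (intro has_derivative_mult C_diff_SucD[OF prems(1)] C_diff_SucD[OF prems(2)])
    show "C_diff k (\<lambda>x. f x * frechet_derivative g (at x) b + frechet_derivative f (at x) b * g x)"
      if "b \<in> Basis" for b
      by (intro C_diff_add Suc.IH C_diff_SucD(2)[OF prems(1)] C_diff_SucD(2)[OF prems(2)] that
          C_diff_Suc_imp[OF prems(1)] C_diff_Suc_imp[OF prems(2)])
  qed
qed

text \<open>This lifts smooth functions of one variable to functions of one coordinate, from which the
  test functions on the whole space are multiplied together.\<close>

lemma C_diff_affine_compose:
  fixes g :: "real \<Rightarrow> real" and v :: "'a::euclidean_space"
  shows "C_diff k g \<Longrightarrow> C_diff k (\<lambda>x. g (x \<bullet> v + d))"
proof (induction k arbitrary: g)
  case 0
  have "continuous_on UNIV (\<lambda>x. x \<bullet> v + d)" by (intro continuous_intros)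
  then show ?case using 0 continuous_on_compose2[of UNIV g UNIV "\<lambda>x. x \<bullet> v + d"] by simp
next
  case (Suc k)
  let ?g' = "\<lambda>t. frechet_derivative g (at t) 1"
  show ?case
  proof (rule C_diff_SucI)
    show "((\<lambda>x. g (x \<bullet> v + d)) has_derivative (\<lambda>h. (h \<bullet> v) * ?g' (x \<bullet> v + d))) (at x)" for x
    proof -
      have "((\<lambda>x. g (x \<bullet> v + d)) has_derivative
          (\<lambda>h. frechet_derivative g (at (x \<bullet> v + d)) (h \<bullet> v))) (at x)"
        by (intro has_derivative_compose[OF _ C_diff_SucD(1)[OF Suc.prems]] has_derivative_add_const
            bounded_linear_imp_has_derivative bounded_linear_inner_left)
      moreover have "frechet_derivative g (at (x \<bullet> v + d)) (h \<bullet> v) = (h \<bullet> v) * ?g' (x \<bullet> v + d)" for h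
        using linear_scale[OF linear_frechet_derivative, of g "at (x \<bullet> v + d)" "h \<bullet> v" 1] Suc.prems by simp
      ultimately show ?thesis
        by (rule has_derivative_eq_rhs[OF _ ext])
    qed
    show "C_diff k (\<lambda>x. (b \<bullet> v) * ?g' (x \<bullet> v + d))" if "b \<in> Basis" for b
      by (intro C_diff_mult C_diff_const Suc.IH C_diff_SucD(2)[OF Suc.prems]) simp
  qed
qed

lemma C_diff_prod:
  "(\<And>i. i \<in> I \<Longrightarrow> C_diff k (f i)) \<Longrightarrow> C_diff k (\<lambda>x. \<Prod>i\<in>I. f i x)"
  by (induction I rule: infinite_finite_induct) (auto intro!: C_diff_const C_diff_mult)

section \<open>Smooth approximations of box indicators\<close>

text \<open>The classical flat function \<open>exp (- 1 / t)\<close>, with powers of \<open>1 / t\<close> as prefactors: the derivative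
  of each member is a linear combination of members, so one induction gives the smoothness of all.\<close>

definition flat_germ :: "nat \<Rightarrow> real \<Rightarrow> real" where
  "flat_germ n t = (if t \<le> 0 then 0 else inverse t ^ n * exp (- inverse t))"

lemma flat_germ_tendsto_0: "flat_germ n \<midarrow>0\<rightarrow> 0"
proof -
  have "((\<lambda>t::real. inverse t ^ n * exp (- inverse t)) \<longlongrightarrow> 0) (at_right 0)"
    using filterlim_compose[OF tendsto_power_div_exp_0[of n] filterlim_inverse_at_top_right]
    by (simp add: exp_minus divide_inverse)
  then have "(flat_germ n \<longlongrightarrow> 0) (at_right 0)"
    by (rule Lim_transform_eventually) (auto simp: flat_germ_def eventually_at_right_field intro!: exI[of _ 1])
  moreover have "(flat_germ n \<longlongrightarrow> 0) (at_left 0)"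
    by (rule Lim_transform_eventually[of "\<lambda>_. 0"])
       (auto simp: flat_germ_def eventually_at_left_field intro!: exI[of _ "-1"])
  ultimately show ?thesis by (simp add: filterlim_split_at)
qed

lemma flat_germ_has_derivative:
  "(flat_germ n has_real_derivative flat_germ (n+2) t - real n * flat_germ (n+1) t) (at t)"
proof -
  consider "t < 0" | "t = 0" | "t > 0" by linarith
  then show ?thesis
  proof cases
    case 1
    have "((\<lambda>_. 0) has_real_derivative flat_germ (n+2) t - real n * flat_germ (n+1) t) (at t)"
      using 1 by (auto simp: flat_germ_def)
    then show ?thesis
      by (rule DERIV_cong_ev[THEN iffD1, rotated 3, OF _ refl _ refl])
         (use 1 in \<open>auto simp: flat_germ_def eventually_nhds intro!: exI[of _ "{..<0}"]\<close>)
  next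
    case 2
    have "(flat_germ (n+1) \<longlongrightarrow> 0) (at 0)" by (rule flat_germ_tendsto_0)
    then have "((\<lambda>h. (flat_germ n (0 + h) - flat_germ n 0) / h) \<longlongrightarrow> 0) (at 0)"
      by (rule Lim_transform_eventually)
         (auto simp: flat_germ_def eventually_at_filter field_simps)
    then show ?thesis using 2 by (simp add: DERIV_def flat_germ_def)
  next
    case 3
    have "((\<lambda>t. inverse t ^ n * exp (- inverse t)) has_real_derivative
        inverse t ^ n * (exp (- inverse t) * inverse t ^ 2)
        + real n * inverse t ^ (n - 1) * (- (inverse t ^ 2)) * exp (- inverse t)) (at t)"
    proof -
      have i: "(inverse has_real_derivative - (inverse t ^ 2)) (at t)"
        using 3 DERIV_inverse[of t] by (simp add: numeral_2_eq_2)
      have e: "((\<lambda>t. exp (- inverse t)) has_real_derivative exp (- inverse t) * inverse t ^ 2) (at t)"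
        using DERIV_fun_exp[OF DERIV_minus[OF i]] by simp
      show ?thesis
        using DERIV_mult[OF DERIV_power[OF i, of n] e] by (simp add: algebra_simps)
    qed
    also have "inverse t ^ n * (exp (- inverse t) * inverse t ^ 2)
        + real n * inverse t ^ (n - 1) * (- (inverse t ^ 2)) * exp (- inverse t)
       = flat_germ (n+2) t - real n * flat_germ (n+1) t"
      using 3 by (cases n) (auto simp: flat_germ_def power_add power2_eq_square algebra_simps)
    finally show ?thesis
      by (rule DERIV_cong_ev[THEN iffD1, rotated 3, OF _ refl _ refl])
         (use 3 in \<open>auto simp: flat_germ_def eventually_nhds intro!: exI[of _ "{0<..}"]\<close>)
  qed
qed

lemma C_diff_flat_germ: "C_diff k (flat_germ n)"
proof (induction k arbitrary: n)
  case 0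
  show ?case using flat_germ_has_derivative DERIV_isCont
    by (simp add: continuous_on_eq_continuous_at) blast
next
  case (Suc k)
  show ?case
  proof (rule C_diff_SucI)
    show "(flat_germ n has_derivative (\<lambda>h. (flat_germ (n+2) t - real n * flat_germ (n+1) t) * h)) (at t)" for t
      using flat_germ_has_derivative by (simp add: has_field_derivative_def)
    show "C_diff k (\<lambda>t. (flat_germ (n+2) t - real n * flat_germ (n+1) t) * b)" if "b \<in> Basis" for b
      using C_diff_mult[OF C_diff_add[OF Suc[of "n+2"] C_diff_mult[OF C_diff_const[of _ "- real n"] Suc[of "n+1"]]] C_diff_const[of _ b]]
      by (simp add: algebra_simps)
  qed
qed

lemma flat_germ_nonneg: "0 \<le> flat_germ n t"
  by (simp add: flat_germ_def)

lemma flat_germ_0_le_1: "flat_germ 0 t \<le> 1"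
  by (simp add: flat_germ_def)

lemma flat_germ_0_tendsto_1: "(flat_germ 0 \<longlongrightarrow> 1) at_top"
proof -
  have "((\<lambda>t::real. exp (- inverse t)) \<longlongrightarrow> exp (- 0)) at_top"
    by (intro tendsto_intros tendsto_inverse_0_at_top filterlim_ident)
  moreover have "\<forall>\<^sub>F t::real in at_top. exp (- inverse t) = flat_germ 0 t"
    using eventually_gt_at_top[of 0] by eventually_elim (simp add: flat_germ_def)
  ultimately show ?thesis using Lim_transform_eventually by force
qed

text \<open>The derivative of \<open>flat_germ 0\<close> has total mass one, hence its rescalings concentrate to a point
  mass.\<close>

lemma integral_flat_germ_2: "has_bochner_integral lborel (flat_germ 2) 1"
proof -
  have d: "(flat_germ 0 has_real_derivative flat_germ 2 t) (at t)" for t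
    using flat_germ_has_derivative[of 0 t] by (simp add: numeral_2_eq_2)
  have m: "flat_germ 2 \<in> borel_measurable borel"
    using C_diff_imp_continuous[OF C_diff_flat_germ[of 0 2]] borel_measurable_continuous_onI by blast
  have "(\<integral>\<^sup>+t. ennreal (flat_germ 2 t) * indicator {0..} t \<partial>lborel) = ennreal (1 - flat_germ 0 0)"
    by (rule nn_integral_FTC_atLeast[OF m d flat_germ_nonneg flat_germ_0_tendsto_1])
  moreover have "ennreal (flat_germ 2 t) * indicator {0..} t = ennreal (flat_germ 2 t)" for t
    by (auto simp: flat_germ_def indicator_def)
  ultimately have "(\<integral>\<^sup>+t. ennreal (flat_germ 2 t) \<partial>lborel) = ennreal 1"
    by (simp add: flat_germ_def)
  then show ?thesis
    by (intro has_bochner_integral_nn_integral) (use m flat_germ_nonneg in auto)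
qed

text \<open>In each coordinate the two factors vanish to infinite order at the ends of the side and tend to
  \<open>1\<close> inside it as \<open>n\<close> grows. The support thus stays in the fixed closed box while the functions
  increase to its indicator, so no mollification is needed.\<close>

definition bump :: "nat \<Rightarrow> 'a::euclidean_space \<Rightarrow> 'a \<Rightarrow> 'a \<Rightarrow> real" where
  "bump n a b x = (\<Prod>i\<in>Basis. flat_germ 0 (real n * (x \<bullet> i - a \<bullet> i)) * flat_germ 0 (real n * (b \<bullet> i - x \<bullet> i)))"

lemma smooth_bump: "smooth (bump n a b)"
  unfolding smooth_def bump_def
proof (intro allI C_diff_prod C_diff_mult)
  fix k and i :: 'a
  show "C_diff k (\<lambda>x. flat_germ 0 (real n * (x \<bullet> i - a \<bullet> i)))"
    using C_diff_affine_compose[OF C_diff_flat_germ[of k 0], of "real n *\<^sub>R i" "- real n * (a \<bullet> i)"]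
    by (simp add: algebra_simps)
  show "C_diff k (\<lambda>x. flat_germ 0 (real n * (b \<bullet> i - x \<bullet> i)))"
    using C_diff_affine_compose[OF C_diff_flat_germ[of k 0], of "- real n *\<^sub>R i" "real n * (b \<bullet> i)"]
    by (simp add: algebra_simps)
qed

lemma bump_nonneg: "0 \<le> bump n a b x"
  unfolding bump_def by (rule prod_nonneg) (simp add: flat_germ_nonneg)

lemma bump_le_1: "bump n a b x \<le> 1"
  unfolding bump_def
proof (rule prod_le_1)
  fix i :: 'a
  show "0 \<le> flat_germ 0 (real n * (x \<bullet> i - a \<bullet> i)) * flat_germ 0 (real n * (b \<bullet> i - x \<bullet> i)) \<and>
    flat_germ 0 (real n * (x \<bullet> i - a \<bullet> i)) * flat_germ 0 (real n * (b \<bullet> i - x \<bullet> i)) \<le> 1"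
    using mult_le_one[OF flat_germ_0_le_1 flat_germ_nonneg flat_germ_0_le_1]
    by (simp add: flat_germ_nonneg)
qed

lemma bump_eq_0: "x \<notin> box a b \<Longrightarrow> bump n a b x = 0"
proof -
  assume "x \<notin> box a b"
  then obtain i where i: "i \<in> Basis" "x \<bullet> i \<le> a \<bullet> i \<or> b \<bullet> i \<le> x \<bullet> i"
    by (auto simp: mem_box not_less)
  have "flat_germ 0 (real n * (x \<bullet> i - a \<bullet> i)) * flat_germ 0 (real n * (b \<bullet> i - x \<bullet> i)) = 0"
    using i(2) by (auto simp: flat_germ_def mult_nonneg_nonpos)
  then show ?thesis
    unfolding bump_def using i(1) by (intro prod_zero) auto
qed

lemma bump_in_test_functions:
  assumes "cbox a b \<subseteq> \<Omega>"
  shows "bump n a b \<in> test_functions \<Omega>"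
proof -
  have "closure {x. bump n a b x \<noteq> 0} \<subseteq> cbox a b"
    by (rule closure_minimal) (use bump_eq_0 box_subset_cbox in blast)+
  then show ?thesis
    using assms smooth_bump by (auto simp: test_functions_def compact_eq_bounded_closed
        intro: bounded_subset[OF bounded_cbox])
qed

lemma bump_tendsto: "(\<lambda>n. bump n a b x) \<longlonglongrightarrow> indicator (box a b) x"
proof (cases "x \<in> box a b")
  case True
  have *: "(\<lambda>n. flat_germ 0 (real n * c)) \<longlonglongrightarrow> 1" if "c > 0" for c
  proof (rule filterlim_compose[OF flat_germ_0_tendsto_1])
    show "filterlim (\<lambda>n. real n * c) at_top sequentially"
      using filterlim_tendsto_pos_mult_at_top[OF tendsto_const that filterlim_real_sequentially]
      by (simp add: mult.commute)
  qed
  have "(\<lambda>n. bump n a b x) \<longlonglongrightarrow> (\<Prod>i\<in>(Basis::'a set). 1 * 1)"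
    unfolding bump_def by (intro tendsto_prod tendsto_mult *) (use True in \<open>auto simp: mem_box\<close>)
  then show ?thesis using True by simp
next
  case False
  then show ?thesis by (simp add: bump_eq_0)
qed


section \<open>Square-integrable functions\<close>

lemma square_integrable_inner:
  fixes f g :: "'a \<Rightarrow> 'b::euclidean_space"
  assumes [measurable]: "f \<in> borel_measurable M" "g \<in> borel_measurable M"
    and f: "integrable M (\<lambda>x. (norm (f x))\<^sup>2)" and g: "integrable M (\<lambda>x. (norm (g x))\<^sup>2)"
  shows "integrable M (\<lambda>x. f x \<bullet> g x)"
proof (rule Bochner_Integration.integrable_bound[OF Bochner_Integration.integrable_add[OF f g]])
  show "AE x in M. norm (f x \<bullet> g x) \<le> norm ((norm (f x))\<^sup>2 + (norm (g x))\<^sup>2)"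
  proof (rule AE_I2)
    fix x
    have "\<bar>f x \<bullet> g x\<bar> \<le> norm (f x) * norm (g x)" by (rule Cauchy_Schwarz_ineq2)
    also have "\<dots> \<le> (norm (f x))\<^sup>2 + (norm (g x))\<^sup>2"
    proof -
      have "0 \<le> norm (f x) * norm (g x)" by simp
      then show ?thesis using sum_squares_bound[of "norm (f x)" "norm (g x)"] by linarith
    qed
    finally show "norm (f x \<bullet> g x) \<le> norm ((norm (f x))\<^sup>2 + (norm (g x))\<^sup>2)"
      unfolding real_norm_def by linarith
  qed
qed measurable

lemma power2_norm_add:
  fixes a b :: "'b::real_inner"
  shows "(norm (a + b))\<^sup>2 = (norm a)\<^sup>2 + 2 * (a \<bullet> b) + (norm b)\<^sup>2"
  by (simp add: power2_norm_eq_inner inner_add_left inner_add_right inner_commute)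

lemma square_integrable_add:
  fixes f g :: "'a \<Rightarrow> 'b::euclidean_space"
  assumes [measurable]: "f \<in> borel_measurable M" "g \<in> borel_measurable M"
    and f: "integrable M (\<lambda>x. (norm (f x))\<^sup>2)" and g: "integrable M (\<lambda>x. (norm (g x))\<^sup>2)"
  shows "integrable M (\<lambda>x. (norm (f x + g x))\<^sup>2)"
proof -
  have "integrable M (\<lambda>x. (norm (f x))\<^sup>2 + 2 * (f x \<bullet> g x) + (norm (g x))\<^sup>2)"
    using f g square_integrable_inner[OF assms] by simp
  then show ?thesis unfolding power2_norm_add .
qed

text \<open>The usual discriminant argument, applied to the norm of \<open>f + t g\<close>.\<close>

lemma integral_Cauchy_Schwarz:
  fixes f g :: "'a \<Rightarrow> 'b::euclidean_space"
  assumes meas: "f \<in> borel_measurable M" "g \<in> borel_measurable M"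
    and f: "integrable M (\<lambda>x. (norm (f x))\<^sup>2)" and g: "integrable M (\<lambda>x. (norm (g x))\<^sup>2)"
  shows "(\<integral>x. f x \<bullet> g x \<partial>M)\<^sup>2 \<le> (\<integral>x. (norm (f x))\<^sup>2 \<partial>M) * (\<integral>x. (norm (g x))\<^sup>2 \<partial>M)"
proof -
  define A B C where "A = (\<integral>x. (norm (f x))\<^sup>2 \<partial>M)" and "B = (\<integral>x. f x \<bullet> g x \<partial>M)"
    and "C = (\<integral>x. (norm (g x))\<^sup>2 \<partial>M)"
  have ineq: "0 \<le> A + 2 * t * B + t\<^sup>2 * C" for t
  proof -
    have "0 \<le> (\<integral>x. (norm (f x + t *\<^sub>R g x))\<^sup>2 \<partial>M)" by simp
    also have "\<dots> = (\<integral>x. (norm (f x))\<^sup>2 + (2 * t) * (f x \<bullet> g x) + t\<^sup>2 * (norm (g x))\<^sup>2 \<partial>M)"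
      by (simp add: power2_norm_add power_mult_distrib mult.assoc)
    also have "\<dots> = A + 2 * t * B + t\<^sup>2 * C"
      unfolding A_def B_def C_def using f g square_integrable_inner[OF meas f g] by simp
    finally show ?thesis .
  qed
  have "C \<ge> 0" unfolding C_def by simp
  have "B\<^sup>2 \<le> A * C"
  proof (cases "C = 0")
    case True
    have "B = 0"
    proof (rule ccontr)
      assume "B \<noteq> 0"
      then show False using ineq[of "- (A + 1) / (2 * B)"] True by (simp add: field_simps)
    qed
    then show ?thesis using True by simp
  next
    case False
    then have "C > 0" using \<open>C \<ge> 0\<close> by simp
    have "0 \<le> (A + 2 * (- B / C) * B + (- B / C)\<^sup>2 * C) * C"
      using ineq[of "- B / C"] \<open>C > 0\<close> by (intro mult_nonneg_nonneg) auto
    also have "\<dots> = A * C - B\<^sup>2" using \<open>C > 0\<close> by (simp add: field_simps power2_eq_square)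
    finally show ?thesis by simp
  qed
  then show ?thesis unfolding A_def B_def C_def .
qed

lemma integral_lebesgue_on:
  fixes f :: "'a::euclidean_space \<Rightarrow> 'b::euclidean_space"
  assumes "S \<in> sets lebesgue"
  shows "integral\<^sup>L (lebesgue_on S) f = (\<integral>x. indicator S x *\<^sub>R f x \<partial>lebesgue)"
  using assms by (simp add: integral_restrict_space)

lemma integrable_lebesgue_on:
  fixes f :: "'a::euclidean_space \<Rightarrow> 'b::euclidean_space"
  assumes "S \<in> sets lebesgue"
  shows "integrable (lebesgue_on S) f \<longleftrightarrow> integrable lebesgue (\<lambda>x. indicator S x *\<^sub>R f x)"
  using assms by (simp add: integrable_restrict_space)

lemma AE_lebesgue_on:
  assumes "S \<in> sets lebesgue"
  shows "(AE x in lebesgue_on S. P x) \<longleftrightarrow> (AE x in lebesgue. x \<in> S \<longrightarrow> P x)"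
  using assms by (simp add: AE_restrict_space_iff)

text \<open>Extension by zero trades the measure on \<open>S\<close> for the one on the whole space, where different
  domains can be compared.\<close>

lemma in_L2_iff_extension:
  fixes f :: "'a::euclidean_space \<Rightarrow> 'b::euclidean_space"
  assumes "S \<in> sets lebesgue"
  shows "in_L2 S f \<longleftrightarrow> (\<lambda>x. indicator S x *\<^sub>R f x) \<in> borel_measurable lebesgue \<and>
    integrable lebesgue (\<lambda>x. (norm (indicator S x *\<^sub>R f x))\<^sup>2)"
proof -
  have "indicator S x *\<^sub>R (norm (f x))\<^sup>2 = (norm (indicator S x *\<^sub>R f x))\<^sup>2" for x
    by (simp add: indicator_def)
  then show ?thesis
    using assms by (simp add: in_L2_def integrable_lebesgue_on borel_measurable_restrict_space_iff)
qed

lemma in_L2_subset: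
  assumes "in_L2 S f" "T \<subseteq> S" "S \<in> sets lebesgue" "T \<in> sets lebesgue"
  shows "in_L2 T f"
proof -
  have *: "indicator T x *\<^sub>R f x = indicator T x *\<^sub>R (indicator S x *\<^sub>R f x)" for x
    using assms(2) by (auto simp: indicator_def)
  note f = assms(1)[unfolded in_L2_iff_extension[OF assms(3)]]
  have 1: "(\<lambda>x. indicator T x *\<^sub>R f x) \<in> borel_measurable lebesgue"
  proof -
    have "(\<lambda>x. indicator T x *\<^sub>R (indicator S x *\<^sub>R f x)) \<in> borel_measurable lebesgue"
      by (rule borel_measurable_scaleR[OF borel_measurable_indicator[OF assms(4)] conjunct1[OF f]])
    then show ?thesis unfolding *[symmetric] .
  qed
  have "integrable lebesgue (\<lambda>x. (norm (indicator T x *\<^sub>R f x))\<^sup>2)"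
    by (rule Bochner_Integration.integrable_bound[OF conjunct2[OF f]])
       (use 1 assms(2) in \<open>auto intro!: borel_measurable_power borel_measurable_norm AE_I2
         simp del: norm_scaleR, auto simp: indicator_def\<close>)
  then show ?thesis using 1 in_L2_iff_extension[OF assms(4)] by blast
qed

lemma in_L2_add: "in_L2 S f \<Longrightarrow> in_L2 S g \<Longrightarrow> in_L2 S (\<lambda>x. f x + g x)"
  unfolding in_L2_def by (intro conjI borel_measurable_add square_integrable_add) auto

lemma in_L2_minus: "in_L2 S f \<Longrightarrow> in_L2 S (\<lambda>x. - f x)"
  by (simp add: in_L2_def)

lemma in_L2_diff: "in_L2 S f \<Longrightarrow> in_L2 S g \<Longrightarrow> in_L2 S (\<lambda>x. f x - g x)"
  using in_L2_add[of S f "\<lambda>x. - g x"] in_L2_minus[of S g] by simp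

lemma in_L2_inner_const:
  assumes "in_L2 S f" shows "in_L2 S (\<lambda>x. f x \<bullet> b)"
  unfolding in_L2_def
proof
  have [measurable]: "f \<in> borel_measurable (lebesgue_on S)"
    and f: "integrable (lebesgue_on S) (\<lambda>x. (norm (f x))\<^sup>2)"
    using assms by (auto simp: in_L2_def)
  show "(\<lambda>x. f x \<bullet> b) \<in> borel_measurable (lebesgue_on S)" by simp
  show "integrable (lebesgue_on S) (\<lambda>x. (norm (f x \<bullet> b))\<^sup>2)"
  proof (rule Bochner_Integration.integrable_bound[OF integrable_mult_left[OF f, of "(norm b)\<^sup>2"]])
    show "AE x in lebesgue_on S. norm ((norm (f x \<bullet> b))\<^sup>2) \<le> norm ((norm (f x))\<^sup>2 * (norm b)\<^sup>2)"
      using power_mono[OF Cauchy_Schwarz_ineq2, of _ _ 2]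
      by (intro AE_I2) (simp add: power_mult_distrib)
  qed simp
qed

lemma in_L2_bounded:
  fixes f :: "'a::euclidean_space \<Rightarrow> 'b::euclidean_space"
  assumes "S \<in> lmeasurable" "f \<in> borel_measurable (lebesgue_on S)" "\<And>x. x \<in> S \<Longrightarrow> norm (f x) \<le> B"
  shows "in_L2 S f"
proof -
  have "finite_measure (lebesgue_on S)"
    using assms(1) by (simp add: finite_measure_lebesgue_on)
  then have "integrable (lebesgue_on S) (\<lambda>x. (norm (f x))\<^sup>2)"
    by (rule finite_measure.integrable_const_bound[where B="B\<^sup>2"])
       (use assms(2,3) in \<open>auto intro!: power_mono\<close>)
  then show ?thesis using assms(2) by (simp add: in_L2_def)
qed

lemma in_L2_AE_cong:
  fixes f g :: "'a::euclidean_space \<Rightarrow> 'b::euclidean_space"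
  assumes "AE x in lebesgue_on S. f x = g x" "in_L2 S f" "in_L2 S g"
  shows "integral\<^sup>L (lebesgue_on S) (\<lambda>x. (norm (f x))\<^sup>2) = integral\<^sup>L (lebesgue_on S) (\<lambda>x. (norm (g x))\<^sup>2)"
  by (rule integral_cong_AE) (use assms in \<open>auto simp: in_L2_def\<close>)

section \<open>The fundamental lemma and uniqueness of weak gradients\<close>

text \<open>Boxes form an intersection-stable generator of the Borel sets, so the vanishing of the integral
  extends from boxes to all Borel sets.\<close>

lemma AE_zero_of_box_integrals_lborel:
  fixes f :: "'a::euclidean_space \<Rightarrow> real"
  assumes f: "integrable lborel f" and box: "\<And>a b. (\<integral>x\<in>box a b. f x \<partial>lborel) = 0"
  shows "AE x in lborel. f x = 0"
proof -
  have si: "set_integrable lborel A f" if "A \<in> sets borel" for A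
    using f that unfolding set_integrable_def by (intro integrable_mult_indicator) auto
  have UNIV: "(\<integral>x\<in>UNIV. f x \<partial>lborel) = 0"
  proof -
    let ?A = "\<lambda>i::nat. box (- (real i *\<^sub>R One)) (real i *\<^sub>R One) :: 'a set"
    have "incseq ?A"
      by (auto simp: incseq_def subset_box intro!: mult_right_mono)
    then have "(\<lambda>i. \<integral>x\<in>?A i. f x \<partial>lborel) \<longlonglongrightarrow> (\<integral>x\<in>(\<Union>i. ?A i). f x \<partial>lborel)"
      using si by (intro set_integral_cont_up) auto
    then show ?thesis unfolding box UN_box_eq_UNIV by (simp add: LIMSEQ_const_iff)
  qed
  have "(\<integral>x\<in>A. f x \<partial>lborel) = 0" if "A \<in> sets borel" for A
  proof -
    have "Int_stable (range (\<lambda>(a, b). box a b :: 'a set))"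
      by (auto simp: Int_stable_def box_Int_box)
    moreover have "range (\<lambda>(a, b). box a b :: 'a set) \<subseteq> Pow UNIV" by simp
    moreover have "A \<in> sigma_sets UNIV (range (\<lambda>(a, b). box a b))"
      using that unfolding borel_eq_box by simp
    ultimately show ?thesis
    proof (induction rule: sigma_sets_induct_disjoint[consumes 3, case_names basic empty compl union])
      case (compl A)
      then have [measurable]: "A \<in> sets borel" unfolding borel_eq_box by simp
      have "(\<integral>x\<in>UNIV. f x \<partial>lborel) = (\<integral>x\<in>A. f x \<partial>lborel) + (\<integral>x\<in>UNIV - A. f x \<partial>lborel)"
        using set_integral_Un[of A "UNIV - A" lborel f] si by simp
      then show ?case using compl UNIV by simp
    next
      case (union A)
      then have "A i \<in> sets borel" for i unfolding borel_eq_box by auto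
      then show ?case
        using union si by (subst lebesgue_integral_countable_add) (auto simp: disjoint_family_on_def)
    qed (use box in \<open>auto simp: set_lebesgue_integral_def\<close>)
  qed
  then show ?thesis
    by (intro density_unique_real[OF f, of "\<lambda>_. 0"]) (auto simp: set_lebesgue_integral_def)
qed

lemma AE_zero_of_box_integrals:
  fixes f :: "'a::euclidean_space \<Rightarrow> real"
  assumes f: "integrable lebesgue f" and box: "\<And>a b. (\<integral>x. indicator (box a b) x * f x \<partial>lebesgue) = 0"
  shows "AE x in lebesgue. f x = 0"
proof -
  obtain g where g[measurable]: "g \<in> borel_measurable lborel" and fg: "AE x in lborel. f x = g x"
    using completion_ex_borel_measurable_real[of f lborel] f by (auto dest: borel_measurable_integrable)
  have fg': "AE x in lebesgue. f x = g x" using fg by (rule AE_completion)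
  have mf: "f \<in> borel_measurable lebesgue" using f by (rule borel_measurable_integrable)
  have mg: "g \<in> borel_measurable lebesgue" using g by (simp add: measurable_completion)
  have "integrable lebesgue g"
    using integrable_cong_AE[OF mf mg fg'] f by simp
  then have "integrable lborel g" by (simp add: integrable_completion)
  moreover have "(\<integral>x\<in>box a b. g x \<partial>lborel) = 0" for a b
  proof -
    have "(\<integral>x\<in>box a b. g x \<partial>lborel) = (\<integral>x. indicator (box a b) x * g x \<partial>lebesgue)"
      unfolding set_lebesgue_integral_def by (subst integral_completion) simp_all
    also have "\<dots> = (\<integral>x. indicator (box a b) x * f x \<partial>lebesgue)"
    proof (rule integral_cong_AE)
      show "AE x in lebesgue. indicator (box a b) x * g x = indicator (box a b) x * f x"
        using fg' by eventually_elim simp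
    qed (use mf mg in \<open>auto intro!: borel_measurable_times borel_measurable_indicator\<close>)
    finally show ?thesis using box by simp
  qed
  ultimately have "AE x in lborel. g x = 0" by (rule AE_zero_of_box_integrals_lborel)
  then have "AE x in lebesgue. g x = 0" by (rule AE_completion)
  with fg' show ?thesis by eventually_elim simp
qed

lemma smooth_mult: "smooth f \<Longrightarrow> smooth g \<Longrightarrow> smooth (\<lambda>x. f x * g x)"
  by (simp add: smooth_def C_diff_mult)

lemma smooth_imp_continuous: "smooth f \<Longrightarrow> continuous_on UNIV f"
  by (auto simp: smooth_def dest: spec[of _ 0])

lemma continuous_measurable_lebesgue:
  fixes f :: "'a::euclidean_space \<Rightarrow> 'b::euclidean_space"
  shows "continuous_on UNIV f \<Longrightarrow> f \<in> borel_measurable lebesgue"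
  by (intro measurable_completion) (simp add: borel_measurable_continuous_onI)


text \<open>For a closed box inside \<open>\<Omega>\<close>, products of two bumps approximate the indicator of the
  intersection of that box with an arbitrary one; hence \<open>g\<close>, cut off to the box, has vanishing
  integrals over all boxes. Countably many such boxes exhaust \<open>\<Omega>\<close>.\<close>

lemma fundamental_lemma_variations:
  fixes g :: "'a::euclidean_space \<Rightarrow> real"
  assumes "open \<Omega>" "in_L2 \<Omega> g"
    and orth: "\<And>\<phi>. \<phi> \<in> test_functions \<Omega> \<Longrightarrow> integral\<^sup>L (lebesgue_on \<Omega>) (\<lambda>x. g x * \<phi> x) = 0"
  shows "AE x in lebesgue_on \<Omega>. g x = 0"
proof -
  have \<Omega>: "\<Omega> \<in> sets lebesgue" using assms(1) by simp
  define g0 where "g0 x = indicator \<Omega> x * g x" for x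
  have mg0: "g0 \<in> borel_measurable lebesgue" and sg0: "integrable lebesgue (\<lambda>x. (norm (g0 x))\<^sup>2)"
    using assms(2) unfolding in_L2_iff_extension[OF \<Omega>] g0_def by simp_all
  have box_zero: "AE x in lebesgue. x \<in> cbox a b \<longrightarrow> g0 x = 0" if sub: "cbox a b \<subseteq> \<Omega>" for a b
  proof -
    define f where "f x = indicator (box a b) x * g0 x" for x
    have ind: "integrable lebesgue (\<lambda>x. (norm (indicator (box a b) x :: real))\<^sup>2)"
    proof -
      have "(norm (indicator (box a b) x :: real))\<^sup>2 = indicator (box a b) x" for x
        by (simp add: indicator_def)
      then show ?thesis by (simp add: lmeasurable_iff_integrable[symmetric])
    qed
    have f: "integrable lebesgue f"
      using square_integrable_inner[OF _ mg0 ind sg0] unfolding f_def inner_real_def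
      by (simp add: borel_measurable_indicator)
    have "(\<integral>x. indicator (box c d) x * f x \<partial>lebesgue) = 0" for c d
    proof -
      let ?\<phi> = "\<lambda>n x. bump n a b x * bump n c d x"
      have test: "?\<phi> n \<in> test_functions \<Omega>" for n
      proof -
        have "closure {x. ?\<phi> n x \<noteq> 0} \<subseteq> cbox a b"
        proof (rule closure_minimal[OF subsetI closed_cbox])
          fix x assume "x \<in> {x. ?\<phi> n x \<noteq> 0}"
          then show "x \<in> cbox a b" using bump_eq_0[of x a b n] box_subset_cbox[of a b] by auto
        qed
        then show ?thesis
          using sub smooth_mult[OF smooth_bump smooth_bump]
          by (auto simp: test_functions_def compact_eq_bounded_closed
              intro: bounded_subset[OF bounded_cbox])
      qed
      have z: "(\<integral>x. ?\<phi> n x * f x \<partial>lebesgue) = 0" for n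
      proof -
        have eq: "(\<lambda>x. ?\<phi> n x * f x) = (\<lambda>x. indicator \<Omega> x *\<^sub>R (g x * ?\<phi> n x))"
        proof
          show "?\<phi> n x * f x = indicator \<Omega> x *\<^sub>R (g x * ?\<phi> n x)" for x
            by (cases "x \<in> box a b") (auto simp: f_def g0_def bump_eq_0)
        qed
        show ?thesis
          unfolding eq using orth[OF test, of n] unfolding integral_lebesgue_on[OF \<Omega>] .
      qed
      have "(\<lambda>n. \<integral>x. ?\<phi> n x * f x \<partial>lebesgue) \<longlonglongrightarrow>
          (\<integral>x. (indicator (box a b) x * indicator (box c d) x) * f x \<partial>lebesgue)"
      proof (rule integral_dominated_convergence[where w="\<lambda>x. \<bar>f x\<bar>"])
        have m: "?\<phi> n \<in> borel_measurable lebesgue" for n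
          by (rule continuous_measurable_lebesgue[OF smooth_imp_continuous[OF smooth_mult[OF smooth_bump smooth_bump]]])
        show "(\<lambda>x. ?\<phi> n x * f x) \<in> borel_measurable lebesgue" for n
          by (rule borel_measurable_times[OF m borel_measurable_integrable[OF f]])
        show "AE x in lebesgue. norm (?\<phi> n x * f x) \<le> \<bar>f x\<bar>" for n
        proof (rule AE_I2)
          fix x
          have "0 \<le> ?\<phi> n x" "?\<phi> n x \<le> 1"
            by (rule mult_nonneg_nonneg[OF bump_nonneg bump_nonneg],
                rule mult_le_one[OF bump_le_1 bump_nonneg bump_le_1])
          then have "\<bar>?\<phi> n x\<bar> * \<bar>f x\<bar> \<le> 1 * \<bar>f x\<bar>" by (intro mult_right_mono) auto
          then show "norm (?\<phi> n x * f x) \<le> \<bar>f x\<bar>" by (simp only: abs_mult real_norm_def mult_1)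
        qed
        show "AE x in lebesgue. (\<lambda>n. ?\<phi> n x * f x)
            \<longlonglongrightarrow> indicator (box a b) x * indicator (box c d) x * f x"
          by (rule AE_I2[OF tendsto_mult[OF tendsto_mult[OF bump_tendsto bump_tendsto] tendsto_const]])
        show "(\<lambda>x. indicator (box a b) x * indicator (box c d) x * f x) \<in> borel_measurable lebesgue"
          by (rule borel_measurable_times[OF borel_measurable_times[OF borel_measurable_indicator borel_measurable_indicator]
              borel_measurable_integrable[OF f]]) auto
      qed (use f in auto)
      then have "(\<integral>x. (indicator (box a b) x * indicator (box c d) x) * f x \<partial>lebesgue) = 0"
        unfolding z by (simp add: LIMSEQ_const_iff)
      moreover have "(indicator (box a b) x * indicator (box c d) x) * f x = indicator (box c d) x * f x" for x
        by (simp add: f_def indicator_def)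
      ultimately show ?thesis by (simp only:)
    qed
    then have "AE x in lebesgue. f x = 0" by (rule AE_zero_of_box_integrals[OF f])
    moreover have "AE x in lebesgue. x \<notin> cbox a b - box a b"
      using negligible_frontier_interval[of a b] by (intro AE_not_in) (simp add: negligible_iff_null_sets)
    ultimately show ?thesis by eventually_elim (auto simp: f_def)
  qed
  obtain D where D: "countable D" "D \<subseteq> Pow \<Omega>" "\<And>X. X \<in> D \<Longrightarrow> \<exists>a b. X = cbox a b" "\<Union>D = \<Omega>"
    by (rule open_countable_Union_open_cbox[OF assms(1)]) (rule that; assumption)
  have "AE x in lebesgue. \<forall>X\<in>D. x \<in> X \<longrightarrow> g0 x = 0"
  proof (rule AE_ball_countable'[OF _ D(1)])
    fix X assume X: "X \<in> D"
    then obtain a b where "X = cbox a b" using D(3) by blast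
    moreover have "X \<subseteq> \<Omega>" using X D(4) by auto
    ultimately show "AE x in lebesgue. x \<in> X \<longrightarrow> g0 x = 0" using box_zero by simp
  qed
  then show ?thesis
    unfolding AE_lebesgue_on[OF \<Omega>]
  proof eventually_elim
    case (elim x)
    show ?case
    proof
      assume x: "x \<in> \<Omega>"
      then have "g0 x = 0" using elim D(4) by blast
      then show "g x = 0" using x by (simp add: g0_def)
    qed
  qed
qed


lemma test_functionD:
  assumes "\<phi> \<in> test_functions \<Omega>"
  shows test_function_smooth: "smooth \<phi>"
    and test_function_zero: "x \<notin> \<Omega> \<Longrightarrow> \<phi> x = 0"
    and test_function_deriv_zero: "x \<notin> \<Omega> \<Longrightarrow> frechet_derivative \<phi> (at x) = (\<lambda>_. 0)"
    and test_function_bounded_support: "\<exists>R\<ge>0. \<forall>x. R < norm x \<longrightarrow> \<phi> x = 0 \<and> frechet_derivative \<phi> (at x) = (\<lambda>_. 0)"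
proof -
  define K where "K = closure {x. \<phi> x \<noteq> 0}"
  have K: "compact K" "K \<subseteq> \<Omega>" and s: "smooth \<phi>"
    using assms by (auto simp: test_functions_def K_def)
  have z: "\<phi> x = 0" if "x \<notin> K" for x
    using that closure_subset[of "{x. \<phi> x \<noteq> 0}"] unfolding K_def by auto
  have dz: "frechet_derivative \<phi> (at x) = (\<lambda>_. 0)" if "x \<notin> K" for x
  proof -
    have "((\<lambda>_. 0) has_derivative (\<lambda>_. 0)) (at x)" by simp
    then have "(\<phi> has_derivative (\<lambda>_. 0)) (at x)"
      by (rule has_derivative_transform_within_open[where s="- K"]) (use that z K(1) in \<open>auto simp: compact_imp_closed open_Compl\<close>)
    then show ?thesis using frechet_derivative_at by metis
  qed
  show "smooth \<phi>" by (fact s)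
  show "\<phi> x = 0" if "x \<notin> \<Omega>" using that z K by blast
  show "frechet_derivative \<phi> (at x) = (\<lambda>_. 0)" if "x \<notin> \<Omega>" using that dz K by blast
  obtain R where "\<forall>x\<in>K. norm x \<le> R"
    using compact_imp_bounded[OF K(1)] bounded_iff by blast
  then show "\<exists>R\<ge>0. \<forall>x. R < norm x \<longrightarrow> \<phi> x = 0 \<and> frechet_derivative \<phi> (at x) = (\<lambda>_. 0)"
  proof (intro exI[of _ "max R 0"] conjI allI impI)
    fix x :: 'a assume "max R 0 < norm x"
    then have "x \<notin> K" using \<open>\<forall>x\<in>K. norm x \<le> R\<close> by auto
    then show "\<phi> x = 0" "frechet_derivative \<phi> (at x) = (\<lambda>_. 0)" by (rule z, rule dz)
  qed simp
qed

lemma smooth_has_derivative: "smooth f \<Longrightarrow> (f has_derivative frechet_derivative f (at x)) (at x)"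
  using C_diff_SucD(1)[of 0 f] unfolding smooth_def by blast

lemma smooth_continuous_partial:
  assumes "smooth f" "b \<in> Basis"
  shows "continuous_on UNIV (\<lambda>x. frechet_derivative f (at x) b)"
  using assms C_diff_SucD(2)[of 0 f b] unfolding smooth_def by simp

lemma integrable_continuous_bounded_support:
  fixes f :: "'a::euclidean_space \<Rightarrow> real"
  assumes "continuous_on UNIV f" "\<And>x. R < norm x \<Longrightarrow> f x = 0"
  shows "integrable lborel f" "integrable lebesgue f"
proof -
  have "integrable lborel (\<lambda>x. indicator (cball 0 R) x *\<^sub>R f x)"
    by (intro borel_integrable_compact continuous_on_subset[OF assms(1)]) auto
  moreover have "(\<lambda>x. indicator (cball 0 R) x *\<^sub>R f x) = f"
    using assms(2) by (auto simp: indicator_def fun_eq_iff not_le)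
  ultimately show i: "integrable lborel f" by simp
  then show "integrable lebesgue f"
    by (simp add: integrable_completion borel_measurable_integrable)
qed

lemma test_function_in_L2:
  assumes "\<phi> \<in> test_functions \<Omega>" "open \<Omega>"
  shows "in_L2 \<Omega> \<phi>"
proof -
  have \<Omega>: "\<Omega> \<in> sets lebesgue" using assms(2) by simp
  have eq: "(\<lambda>x. indicator \<Omega> x *\<^sub>R \<phi> x) = \<phi>"
    using test_function_zero[OF assms(1)] by (auto simp: fun_eq_iff indicator_def)
  have c: "continuous_on UNIV \<phi>" using test_function_smooth[OF assms(1)] by (rule smooth_imp_continuous)
  obtain R where "\<forall>x. R < norm x \<longrightarrow> \<phi> x = 0" using test_function_bounded_support[OF assms(1)] by blast
  then have "integrable lebesgue (\<lambda>x. (norm (\<phi> x))\<^sup>2)"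
    by (intro integrable_continuous_bounded_support[where R=R] continuous_intros c) auto
  moreover have "integrable lebesgue (\<lambda>x. (norm (indicator \<Omega> x *\<^sub>R \<phi> x))\<^sup>2)"
  proof -
    have "indicator \<Omega> x *\<^sub>R \<phi> x = \<phi> x" for x using fun_cong[OF eq] .
    then show ?thesis using calculation by (simp only:)
  qed
  ultimately show ?thesis
    unfolding in_L2_iff_extension[OF \<Omega>] eq using c continuous_measurable_lebesgue by blast
qed

lemma in_L2_times_integrable:
  fixes f g :: "'a::euclidean_space \<Rightarrow> real"
  assumes "in_L2 S f" "in_L2 S g"
  shows "integrable (lebesgue_on S) (\<lambda>x. f x * g x)"
  using square_integrable_inner[of f "lebesgue_on S" g] assms by (simp add: in_L2_def)

text \<open>The weak gradient picked by Hilbert choice may therefore be replaced by any other one in every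
  integral below.\<close>

lemma weak_gradient_unique:
  assumes "open \<Omega>" "in_L2 \<Omega> G" "in_L2 \<Omega> H" "is_weak_gradient \<Omega> u G" "is_weak_gradient \<Omega> u H"
  shows "AE x in lebesgue_on \<Omega>. G x = H x"
proof -
  have "AE x in lebesgue_on \<Omega>. (G x - H x) \<bullet> b = 0" if b: "b \<in> Basis" for b
  proof (rule fundamental_lemma_variations[OF assms(1)])
    show "in_L2 \<Omega> (\<lambda>x. (G x - H x) \<bullet> b)"
      by (intro in_L2_inner_const in_L2_diff assms)
    fix \<phi> assume \<phi>: "\<phi> \<in> test_functions \<Omega>"
    have i: "integrable (lebesgue_on \<Omega>) (\<lambda>x. (G x \<bullet> b) * \<phi> x)" "integrable (lebesgue_on \<Omega>) (\<lambda>x. (H x \<bullet> b) * \<phi> x)"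
      by (intro in_L2_times_integrable in_L2_inner_const assms test_function_in_L2[OF \<phi>])+
    have "integral\<^sup>L (lebesgue_on \<Omega>) (\<lambda>x. (G x \<bullet> b) * \<phi> x) = integral\<^sup>L (lebesgue_on \<Omega>) (\<lambda>x. (H x \<bullet> b) * \<phi> x)"
      using assms(4,5)[unfolded is_weak_gradient_def, rule_format, OF \<phi> b] by simp
    then show "integral\<^sup>L (lebesgue_on \<Omega>) (\<lambda>x. ((G x - H x) \<bullet> b) * \<phi> x) = 0"
      using i by (simp add: inner_diff_left left_diff_distrib)
  qed
  then have "AE x in lebesgue_on \<Omega>. \<forall>b\<in>Basis. (G x - H x) \<bullet> b = 0"
    by (intro AE_finite_allI) auto
  then show ?thesis
    by eventually_elim (rule euclidean_eqI, simp add: inner_diff_left)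
qed

lemma weak_gradient_spec:
  assumes "in_H1 \<Omega> u"
  shows "in_L2 \<Omega> (weak_gradient \<Omega> u)" "is_weak_gradient \<Omega> u (weak_gradient \<Omega> u)"
  using assms someI_ex[of "\<lambda>G. in_L2 \<Omega> G \<and> is_weak_gradient \<Omega> u G"]
  unfolding in_H1_def weak_gradient_def by auto

lemma integral_weak_gradient_eq:
  assumes "open \<Omega>" "in_L2 \<Omega> G" "is_weak_gradient \<Omega> u G"
  shows "integral\<^sup>L (lebesgue_on \<Omega>) (\<lambda>x. (norm (weak_gradient \<Omega> u x))\<^sup>2) = integral\<^sup>L (lebesgue_on \<Omega>) (\<lambda>x. (norm (G x))\<^sup>2)"
proof -
  have w: "in_L2 \<Omega> (weak_gradient \<Omega> u)" "is_weak_gradient \<Omega> u (weak_gradient \<Omega> u)"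
    using assms someI_ex[of "\<lambda>G. in_L2 \<Omega> G \<and> is_weak_gradient \<Omega> u G"]
    unfolding weak_gradient_def by auto
  show ?thesis
    by (rule in_L2_AE_cong[OF weak_gradient_unique[OF assms(1) w(1) assms(2) w(2) assms(3)] w(1) assms(2)])
qed

section \<open>Classical gradients are weak gradients\<close>

lemma has_derivative_difference_quotients:
  fixes w :: "'a::euclidean_space \<Rightarrow> real"
  assumes "(w has_derivative D) (at x)"
  shows "(\<lambda>n. real (Suc n) * (w (x + inverse (real (Suc n)) *\<^sub>R b) - w x)) \<longlonglongrightarrow> D b"
proof -
  have "((\<lambda>t. x + t *\<^sub>R b) has_derivative (\<lambda>t. t *\<^sub>R b)) (at 0)"
    by (auto intro!: derivative_eq_intros)
  moreover have "(w has_derivative D) (at (x + 0 *\<^sub>R b))" using assms by simp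
  ultimately have "((\<lambda>t. w (x + t *\<^sub>R b)) has_derivative (\<lambda>t. D (t *\<^sub>R b))) (at 0)"
    by (rule has_derivative_compose)
  moreover have "(\<lambda>t. D (t *\<^sub>R b)) = (*) (D b)"
    using has_derivative_linear[OF assms] by (auto simp: fun_eq_iff linear_scale)
  ultimately have "((\<lambda>t. w (x + t *\<^sub>R b)) has_real_derivative D b) (at 0)"
    by (simp add: has_field_derivative_def)
  then have "((\<lambda>t. (w (x + t *\<^sub>R b) - w x) / t) \<longlongrightarrow> D b) (at 0)"
    by (simp add: DERIV_def)
  moreover have "filterlim (\<lambda>n. inverse (real (Suc n))) (at 0) sequentially"
    using LIMSEQ_inverse_real_of_nat by (simp add: filterlim_at)
  ultimately have "(\<lambda>n. (w (x + inverse (real (Suc n)) *\<^sub>R b) - w x) / inverse (real (Suc n))) \<longlonglongrightarrow> D b"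
    by (rule filterlim_compose)
  then show ?thesis by (simp add: divide_inverse mult.commute)
qed

text \<open>Integration by parts in its simplest form. The difference quotients have integral zero by
  translation invariance, and the Lipschitz bound on a slightly larger ball dominates them. Only the
  almost everywhere limit enters, which admits functions with kinks.\<close>

lemma integral_directional_derivative_zero:
  fixes w :: "'a::euclidean_space \<Rightarrow> real"
  assumes cont: "continuous_on UNIV w"
    and lip: "\<And>x y. x \<in> cball 0 (R+2) \<Longrightarrow> y \<in> cball 0 (R+2) \<Longrightarrow> \<bar>w x - w y\<bar> \<le> M * norm (x - y)"
    and supp: "\<And>x. R < norm x \<Longrightarrow> w x = 0" and b: "norm b = 1"
    and d[measurable]: "d \<in> borel_measurable lebesgue"
    and lim: "AE x in lebesgue. (\<lambda>n. real (Suc n) * (w (x + inverse (real (Suc n)) *\<^sub>R b) - w x)) \<longlonglongrightarrow> d x"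
  shows "integrable lebesgue d \<and> (\<integral>x. d x \<partial>lebesgue) = 0"
proof -
  define q where "q n x = real (Suc n) * (w (x + inverse (real (Suc n)) *\<^sub>R b) - w x)" for n x
  have w_int: "integrable lborel w" by (rule integrable_continuous_bounded_support[OF cont supp])
  have wm: "w \<in> borel_measurable borel" using cont by (rule borel_measurable_continuous_onI)
  have shift: "integrable lborel (\<lambda>x. w (x + c))" "(\<integral>x. w (x + c) \<partial>lborel) = (\<integral>x. w x \<partial>lborel)" for c
  proof -
    have e: "distr lborel borel ((+) c) = lborel" by (rule lborel_distr_plus)
    have "integrable (distr lborel borel ((+) c)) w" unfolding e by (fact w_int)
    then show "integrable lborel (\<lambda>x. w (x + c))"
      using wm by (subst (asm) integrable_distr_eq) (auto simp: add.commute)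
    have "(\<integral>x. w x \<partial>distr lborel borel ((+) c)) = (\<integral>x. w (c + x) \<partial>lborel)"
      using wm by (subst integral_distr) auto
    then show "(\<integral>x. w (x + c) \<partial>lborel) = (\<integral>x. w x \<partial>lborel)" unfolding e by (simp add: add.commute)
  qed
  have qc: "continuous_on UNIV (q n)" for n
    unfolding q_def by (intro continuous_intros continuous_on_compose2[OF cont]) auto
  have q0: "(\<integral>x. q n x \<partial>lebesgue) = 0" for n
  proof -
    have "(\<integral>x. q n x \<partial>lebesgue) = (\<integral>x. q n x \<partial>lborel)"
      using qc[of n] by (intro integral_completion) (simp add: borel_measurable_continuous_onI)
    also have "\<dots> = 0" unfolding q_def using shift w_int by simp
    finally show ?thesis .
  qed
  have bound: "\<bar>q n x\<bar> \<le> M * indicator (cball 0 (R+1)) x" for n x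
  proof -
    let ?y = "x + inverse (real (Suc n)) *\<^sub>R b"
    have ny: "norm (inverse (real (Suc n)) *\<^sub>R b) = inverse (real (Suc n))" using b by simp
    have i1: "inverse (real (Suc n)) \<le> 1" by (simp add: inverse_le_1_iff)
    show ?thesis
    proof (cases "x \<in> cball 0 (R+1)")
      case True
      have "norm ?y \<le> R + 2" using norm_triangle_ineq[of x "inverse (real (Suc n)) *\<^sub>R b"] True ny i1 by simp
      then have "\<bar>w ?y - w x\<bar> \<le> M * norm (?y - x)" using True by (intro lip) auto
      also have "norm (?y - x) = inverse (real (Suc n))" using ny by simp
      finally have "real (Suc n) * \<bar>w ?y - w x\<bar> \<le> real (Suc n) * (M * inverse (real (Suc n)))"
        by (intro mult_left_mono) auto
      also have "\<dots> = M" by (simp del: of_nat_Suc)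
      finally show ?thesis using True by (simp add: q_def abs_mult del: of_nat_Suc)
    next
      case False
      then have "norm x > R + 1" by simp
      moreover have "norm x \<le> norm ?y + inverse (real (Suc n))"
        using norm_triangle_ineq4[of ?y "inverse (real (Suc n)) *\<^sub>R b"] ny by simp
      ultimately have "w x = 0" "w ?y = 0" using i1 by (auto intro!: supp)
      then show ?thesis using False by (simp add: q_def)
    qed
  qed
  have dom: "integrable lebesgue (\<lambda>x. M * indicator (cball 0 (R+1)) x :: real)"
    by (intro integrable_mult_right) (simp add: lmeasurable_iff_integrable[symmetric])
  have m: "q n \<in> borel_measurable lebesgue" for n
    by (intro continuous_measurable_lebesgue qc)
  have bnd: "AE x in lebesgue. norm (q n x) \<le> M * indicator (cball 0 (R+1)) x" for n
    using bound by (intro AE_I2) simp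
  note lim' = lim[folded q_def]
  have "integrable lebesgue d"
    by (rule integrable_dominated_convergence[OF d m dom lim' bnd])
  moreover have "(\<lambda>n. \<integral>x. q n x \<partial>lebesgue) \<longlonglongrightarrow> (\<integral>x. d x \<partial>lebesgue)"
    by (rule integral_dominated_convergence[OF d m dom lim' bnd])
  ultimately show ?thesis unfolding q0 by (simp add: LIMSEQ_const_iff)
qed


definition grad :: "('a::euclidean_space \<Rightarrow> real) \<Rightarrow> 'a \<Rightarrow> 'a" where
  "grad f x = (\<Sum>b\<in>Basis. frechet_derivative f (at x) b *\<^sub>R b)"

lemma grad_inner_Basis: "b \<in> Basis \<Longrightarrow> grad f x \<bullet> b = frechet_derivative f (at x) b"
  unfolding grad_def by (rule inner_sum_left_Basis)

lemma smooth_has_derivative_grad: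
  assumes "smooth f" shows "(f has_derivative (\<lambda>h. grad f x \<bullet> h)) (at x)"
proof -
  let ?D = "frechet_derivative f (at x)"
  have lin: "linear ?D" using smooth_has_derivative[OF assms] has_derivative_linear by blast
  have "?D h = grad f x \<bullet> h" for h
  proof -
    have "?D h = ?D (\<Sum>b\<in>Basis. (h \<bullet> b) *\<^sub>R b)" by (simp only: euclidean_representation)
    also have "\<dots> = (\<Sum>b\<in>Basis. (h \<bullet> b) * ?D b)"
      by (simp add: linear_sum[OF lin] linear_scale[OF lin])
    also have "\<dots> = grad f x \<bullet> h"
      unfolding grad_def inner_sum_left inner_scaleR_left
      by (intro sum.cong refl) (simp add: inner_commute)
    finally show ?thesis .
  qed
  then have "?D = (\<lambda>h. grad f x \<bullet> h)" by (rule ext)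
  then show ?thesis using smooth_has_derivative[OF assms, of x] by simp
qed

lemma continuous_grad: "smooth f \<Longrightarrow> continuous_on UNIV (grad f)"
  unfolding grad_def by (intro continuous_on_sum continuous_on_scaleR smooth_continuous_partial continuous_on_const)

lemma smooth_locally_Lipschitz:
  assumes "smooth f"
  shows "\<exists>M. \<forall>x\<in>cball 0 R. \<forall>y\<in>cball 0 R. \<bar>f x - f y\<bar> \<le> M * norm (x - y)"
proof -
  have "bounded (grad f ` cball 0 R)"
    by (intro compact_imp_bounded compact_continuous_image compact_cball
        continuous_on_subset[OF continuous_grad[OF assms]]) simp
  then obtain M where M: "\<And>x. x \<in> cball 0 R \<Longrightarrow> norm (grad f x) \<le> M"
    unfolding bounded_iff by blast
  have "norm (f x - f y) \<le> M * norm (x - y)" if "x \<in> cball 0 R" "y \<in> cball 0 R" for x y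
  proof (rule differentiable_bound[OF convex_cball _ _ that])
    show "(f has_derivative (\<lambda>h. grad f z \<bullet> h)) (at z within cball 0 R)" for z
      by (rule has_derivative_at_withinI[OF smooth_has_derivative_grad[OF assms]])
    show "onorm (\<lambda>h. grad f z \<bullet> h) \<le> M" if "z \<in> cball 0 R" for z
    proof (rule onorm_le)
      fix h
      have "\<bar>grad f z \<bullet> h\<bar> \<le> norm (grad f z) * norm h" by (rule Cauchy_Schwarz_ineq2)
      also have "\<dots> \<le> M * norm h" using M[OF that] by (intro mult_right_mono) auto
      finally show "norm (grad f z \<bullet> h) \<le> M * norm h" by simp
    qed
  qed
  then show ?thesis by (intro exI[of _ M]) auto
qed

text \<open>The product of \<open>f\<close> with a test function is Lipschitz with bounded support, so its directional
  derivatives, given almost everywhere by the product rule, integrate to zero.\<close>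

lemma is_weak_gradient_if_locally_Lipschitz:
  fixes f :: "'a::euclidean_space \<Rightarrow> real"
  assumes "open \<Omega>" and cont: "continuous_on UNIV f"
    and lip: "\<And>R. \<exists>M. \<forall>x\<in>cball 0 R. \<forall>y\<in>cball 0 R. \<bar>f x - f y\<bar> \<le> M * norm (x - y)"
    and der: "AE x in lebesgue. (f has_derivative (\<lambda>h. G x \<bullet> h)) (at x)"
    and meas: "G \<in> borel_measurable lebesgue"
  shows "is_weak_gradient \<Omega> f G"
  unfolding is_weak_gradient_def
proof (intro ballI)
  fix \<phi> and b :: 'a assume \<phi>: "\<phi> \<in> test_functions \<Omega>" and b: "b \<in> Basis"
  have \<Omega>: "\<Omega> \<in> sets lebesgue" using assms(1) by simp
  let ?\<phi>' = "\<lambda>x. frechet_derivative \<phi> (at x) b"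
  define w where "w x = f x * \<phi> x" for x
  define d where "d x = f x * ?\<phi>' x + (G x \<bullet> b) * \<phi> x" for x
  have s: "smooth \<phi>" using \<phi> by (rule test_function_smooth)
  have c\<phi>: "continuous_on UNIV \<phi>" and c\<phi>': "continuous_on UNIV ?\<phi>'"
    using smooth_imp_continuous[OF s] smooth_continuous_partial[OF s b] by auto
  obtain R where "\<forall>x. R < norm x \<longrightarrow> \<phi> x = 0 \<and> frechet_derivative \<phi> (at x) = (\<lambda>_. 0)"
    using test_function_bounded_support[OF \<phi>] by blast
  then have R: "\<And>x. R < norm x \<Longrightarrow> \<phi> x = 0" "\<And>x. R < norm x \<Longrightarrow> ?\<phi>' x = 0" by auto
  obtain Lf where Lf: "\<And>x y. x \<in> cball 0 (R+2) \<Longrightarrow> y \<in> cball 0 (R+2) \<Longrightarrow> \<bar>f x - f y\<bar> \<le> Lf * norm (x - y)"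
    using lip[of "R+2"] by blast
  obtain Lp where Lp: "\<And>x y. x \<in> cball 0 (R+2) \<Longrightarrow> y \<in> cball 0 (R+2) \<Longrightarrow> \<bar>\<phi> x - \<phi> y\<bar> \<le> Lp * norm (x - y)"
    using smooth_locally_Lipschitz[OF s, of "R+2"] by blast
  have "bounded (f ` cball 0 (R+2))" "bounded (\<phi> ` cball 0 (R+2))"
    by (intro compact_imp_bounded compact_continuous_image compact_cball continuous_on_subset[OF cont]
        continuous_on_subset[OF c\<phi>] subset_UNIV)+
  then obtain Bf Bp where B: "\<And>x. x \<in> cball 0 (R+2) \<Longrightarrow> \<bar>f x\<bar> \<le> Bf" "\<And>x. x \<in> cball 0 (R+2) \<Longrightarrow> \<bar>\<phi> x\<bar> \<le> Bp"
    unfolding bounded_iff by (metis imageI real_norm_def)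
  have "integrable lebesgue d \<and> (\<integral>x. d x \<partial>lebesgue) = 0"
  proof (rule integral_directional_derivative_zero)
    show "continuous_on UNIV w" unfolding w_def by (intro continuous_on_mult cont c\<phi>)
    show "w x = 0" if "R < norm x" for x using R(1)[OF that] by (simp add: w_def)
    show "norm b = 1" using b by simp
    show "\<bar>w x - w y\<bar> \<le> (Bf * Lp + Bp * Lf) * norm (x - y)"
      if x: "x \<in> cball 0 (R+2)" and y: "y \<in> cball 0 (R+2)" for x y
    proof -
      have "w x - w y = f x * (\<phi> x - \<phi> y) + \<phi> y * (f x - f y)" by (simp add: w_def algebra_simps)
      then have "\<bar>w x - w y\<bar> \<le> \<bar>f x\<bar> * \<bar>\<phi> x - \<phi> y\<bar> + \<bar>\<phi> y\<bar> * \<bar>f x - f y\<bar>"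
        using abs_triangle_ineq[of "f x * (\<phi> x - \<phi> y)" "\<phi> y * (f x - f y)"] by (simp only: abs_mult)
      also have "\<dots> \<le> Bf * (Lp * norm (x - y)) + Bp * (Lf * norm (x - y))"
        using B(1)[OF x] B(2)[OF y] Lp[OF x y] Lf[OF x y]
        by (intro add_mono mult_mono) (auto intro: order_trans[OF abs_ge_zero])
      finally show ?thesis by (simp add: algebra_simps)
    qed
    show "d \<in> borel_measurable lebesgue"
      unfolding d_def by (intro borel_measurable_add borel_measurable_times borel_measurable_inner
          meas borel_measurable_const continuous_measurable_lebesgue cont c\<phi> c\<phi>')
    show "AE x in lebesgue. (\<lambda>n. real (Suc n) * (w (x + inverse (real (Suc n)) *\<^sub>R b) - w x)) \<longlonglongrightarrow> d x"
      using der
    proof eventually_elim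
      case (elim x)
      have "(w has_derivative (\<lambda>h. f x * frechet_derivative \<phi> (at x) h + (G x \<bullet> h) * \<phi> x)) (at x)"
        unfolding w_def by (rule has_derivative_mult[OF elim smooth_has_derivative[OF s]])
      then show ?case unfolding d_def by (rule has_derivative_difference_quotients)
    qed
  qed
  then have "integrable lebesgue d" "(\<integral>x. d x \<partial>lebesgue) = 0" by auto
  moreover have i1: "integrable lebesgue (\<lambda>x. f x * ?\<phi>' x)"
    by (rule integrable_continuous_bounded_support[where R=R]) (use R continuous_on_mult[OF cont c\<phi>'] in auto)
  moreover have i2: "integrable lebesgue (\<lambda>x. (G x \<bullet> b) * \<phi> x)"
    using Bochner_Integration.integrable_diff[OF calculation(1) i1] by (simp add: d_def)
  ultimately have "(\<integral>x. f x * ?\<phi>' x \<partial>lebesgue) = - (\<integral>x. (G x \<bullet> b) * \<phi> x \<partial>lebesgue)"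
    unfolding d_def by simp
  moreover have "(\<lambda>x. indicator \<Omega> x *\<^sub>R (f x * ?\<phi>' x)) = (\<lambda>x. f x * ?\<phi>' x)"
    using test_function_deriv_zero[OF \<phi>] by (auto simp: fun_eq_iff indicator_def)
  moreover have "(\<lambda>x. indicator \<Omega> x *\<^sub>R ((G x \<bullet> b) * \<phi> x)) = (\<lambda>x. (G x \<bullet> b) * \<phi> x)"
    using test_function_zero[OF \<phi>] by (auto simp: fun_eq_iff indicator_def)
  ultimately show "integral\<^sup>L (lebesgue_on \<Omega>) (\<lambda>x. f x * ?\<phi>' x) = - integral\<^sup>L (lebesgue_on \<Omega>) (\<lambda>x. (G x \<bullet> b) * \<phi> x)"
    unfolding integral_lebesgue_on[OF \<Omega>] by presburger
qed

lemma is_weak_gradient_smooth: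
  assumes "open \<Omega>" "smooth f"
  shows "is_weak_gradient \<Omega> f (grad f)"
  using assms smooth_imp_continuous smooth_locally_Lipschitz smooth_has_derivative_grad
  by (intro is_weak_gradient_if_locally_Lipschitz continuous_measurable_lebesgue continuous_grad AE_I2) auto


section \<open>Weak derivatives on the line\<close>

lemma bump_real: "bump n a b (t::real) = flat_germ 0 (real n * (t - a)) * flat_germ 0 (real n * (b - t))"
  by (simp add: bump_def)

lemma continuous_flat_germ: "continuous_on A (flat_germ n)"
  using C_diff_imp_continuous[OF C_diff_flat_germ[of 0 n]] continuous_on_subset by blast

lemma bump_real_frechet_derivative:
  "frechet_derivative (bump n a b) (at (t::real)) 1 =
     real n * flat_germ 2 (real n * (t - a)) * flat_germ 0 (real n * (b - t))
     - real n * flat_germ 2 (real n * (b - t)) * flat_germ 0 (real n * (t - a))"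
proof -
  have d: "(flat_germ 0 has_real_derivative flat_germ 2 s) (at s)" for s
    using flat_germ_has_derivative[of 0 s] by (simp add: numeral_2_eq_2)
  have 1: "((\<lambda>t. flat_germ 0 (real n * (t - a))) has_real_derivative flat_germ 2 (real n * (t - a)) * real n) (at t)"
    by (rule DERIV_chain2[OF d]) (auto intro!: derivative_eq_intros)
  have 2: "((\<lambda>t. flat_germ 0 (real n * (b - t))) has_real_derivative flat_germ 2 (real n * (b - t)) * (- real n)) (at t)"
    by (rule DERIV_chain2[OF d]) (auto intro!: derivative_eq_intros)
  have "(bump n a b has_real_derivative
      flat_germ 2 (real n * (t - a)) * real n * flat_germ 0 (real n * (b - t))
      + flat_germ 2 (real n * (b - t)) * (- real n) * flat_germ 0 (real n * (t - a))) (at t)"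
    unfolding bump_real[abs_def] by (rule DERIV_mult[OF 1 2])
  then have "frechet_derivative (bump n a b) (at t) = (*)
     (flat_germ 2 (real n * (t - a)) * real n * flat_germ 0 (real n * (b - t))
      + flat_germ 2 (real n * (b - t)) * (- real n) * flat_germ 0 (real n * (t - a)))"
    unfolding has_field_derivative_def using frechet_derivative_at by metis
  then show ?thesis by (simp add: algebra_simps)
qed

text \<open>Substituting \<open>t = a + s / (n + 1)\<close> turns the integrand into
  \<open>k (a + s / (n + 1))\<close> times a function dominated by \<open>flat_germ 2 s\<close>, whose integral is one.\<close>

lemma flat_germ_approximates_point_mass:
  fixes k :: "real \<Rightarrow> real"
  assumes k: "continuous_on UNIV k" and ab: "a < b"
  shows "(\<lambda>n. \<integral>t. k t * (real (Suc n) * flat_germ 2 (real (Suc n) * (t - a)) * flat_germ 0 (real (Suc n) * (b - t))) \<partial>lborel)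
    \<longlonglongrightarrow> k a"
proof -
  define q where "q n s = k (a + s / real (Suc n)) * (flat_germ 2 s * flat_germ 0 (real (Suc n) * (b - a) - s))" for n s
  have eq: "(\<integral>t. k t * (real (Suc n) * flat_germ 2 (real (Suc n) * (t - a)) * flat_germ 0 (real (Suc n) * (b - t))) \<partial>lborel)
    = (\<integral>s. q n s \<partial>lborel)" for n
  proof -
    define N where "N = real (Suc n)"
    have N: "N > 0" by (simp add: N_def)
    have pt: "k (a + 1 / N * s) * (N * flat_germ 2 (N * (a + 1 / N * s - a)) * flat_germ 0 (N * (b - (a + 1 / N * s))))
        = N * q n s" for s
    proof -
      have "N * (a + 1 / N * s - a) = s" "N * (b - (a + 1 / N * s)) = N * (b - a) - s"
        using N by (simp_all add: field_simps)
      then show ?thesis unfolding q_def N_def[symmetric] by simp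
    qed
    have "(\<integral>t. k t * (N * flat_germ 2 (N * (t - a)) * flat_germ 0 (N * (b - t))) \<partial>lborel)
       = \<bar>1 / N\<bar> *\<^sub>R (\<integral>s. N * q n s \<partial>lborel)"
      using N by (subst lborel_integral_real_affine[of "1/N" _ a]) (simp_all only: pt, simp_all)
    also have "\<dots> = (\<integral>s. q n s \<partial>lborel)" using N by simp
    finally show ?thesis unfolding N_def .
  qed
  have "bounded (k ` {a..b})"
    by (intro compact_imp_bounded compact_continuous_image continuous_on_subset[OF k]) auto
  then obtain M where M: "\<And>t. t \<in> {a..b} \<Longrightarrow> \<bar>k t\<bar> \<le> M"
    unfolding bounded_iff by (metis imageI real_norm_def)
  have fg: "integrable lborel (flat_germ 2)" "(\<integral>s. flat_germ 2 s \<partial>lborel) = 1"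
    using integral_flat_germ_2 by (auto simp: has_bochner_integral_iff)
  have "(\<lambda>n. \<integral>s. q n s \<partial>lborel) \<longlonglongrightarrow> (\<integral>s. k a * flat_germ 2 s \<partial>lborel)"
  proof (rule integral_dominated_convergence[where w="\<lambda>s. M * flat_germ 2 s"])
    show "(\<lambda>s. k a * flat_germ 2 s) \<in> borel_measurable lborel"
      using fg(1) by (intro borel_measurable_times) auto
    show "q n \<in> borel_measurable lborel" for n
    proof -
      have "continuous_on UNIV (q n)" unfolding q_def
        by (intro continuous_on_mult continuous_on_compose2[OF k] continuous_on_compose2[OF continuous_flat_germ[of UNIV]]
          continuous_on_add continuous_on_diff continuous_on_divide continuous_on_const continuous_on_id) auto
      then show ?thesis by (simp add: borel_measurable_continuous_onI)
    qed
    show "integrable lborel (\<lambda>s. M * flat_germ 2 s)" using fg(1) by simp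
    show "AE s in lborel. (\<lambda>n. q n s) \<longlonglongrightarrow> k a * flat_germ 2 s"
    proof (rule AE_I2)
      fix s
      have "(\<lambda>n. s * inverse (real (Suc n))) \<longlonglongrightarrow> s * 0"
        by (intro tendsto_intros LIMSEQ_inverse_real_of_nat)
      then have "(\<lambda>n. a + s / real (Suc n)) \<longlonglongrightarrow> a"
        using tendsto_add[OF tendsto_const[of a]] by (fastforce simp: divide_inverse)
      then have 1: "(\<lambda>n. k (a + s / real (Suc n))) \<longlonglongrightarrow> k a"
        using k by (intro isCont_tendsto_compose[of a k]) (auto simp: continuous_on_eq_continuous_at)
      have "filterlim (\<lambda>n. (b - a) * real (Suc n)) at_top sequentially"
        by (rule filterlim_tendsto_pos_mult_at_top[OF tendsto_const _
              filterlim_compose[OF filterlim_real_sequentially filterlim_Suc]]) (use ab in simp)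
      then have "filterlim (\<lambda>n. - s + (b - a) * real (Suc n)) at_top sequentially"
        by (rule filterlim_tendsto_add_at_top[OF tendsto_const])
      then have 2: "(\<lambda>n. flat_germ 0 (real (Suc n) * (b - a) - s)) \<longlonglongrightarrow> 1"
        using filterlim_compose[OF flat_germ_0_tendsto_1] by (fastforce simp: algebra_simps)
      show "(\<lambda>n. q n s) \<longlonglongrightarrow> k a * flat_germ 2 s"
        using tendsto_mult[OF 1 tendsto_mult[OF tendsto_const[of "flat_germ 2 s"] 2]] unfolding q_def by simp
    qed
    show "AE s in lborel. norm (q n s) \<le> M * flat_germ 2 s" for n
    proof (rule AE_I2)
      fix s
      show "norm (q n s) \<le> M * flat_germ 2 s"
      proof (cases "0 < s \<and> s < real (Suc n) * (b - a)")
        case True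
        then have "a + s / real (Suc n) \<in> {a..b}"
          by (auto simp: field_simps simp del: of_nat_Suc)
        then have 1: "\<bar>k (a + s / real (Suc n))\<bar> \<le> M" by (rule M)
        have 2: "\<bar>flat_germ 2 s * flat_germ 0 (real (Suc n) * (b - a) - s)\<bar> \<le> flat_germ 2 s"
          using flat_germ_nonneg flat_germ_0_le_1 by (simp add: abs_mult mult_left_le)
        show ?thesis
          unfolding q_def real_norm_def abs_mult[of "k _"]
          by (rule mult_mono[OF 1 2 order_trans[OF abs_ge_zero 1] abs_ge_zero])
      next
        case False
        then have "q n s = 0" "flat_germ 2 s \<ge> 0" unfolding q_def using flat_germ_nonneg by (auto simp: flat_germ_def)
        moreover have "M \<ge> 0" using M[of a] ab by auto
        ultimately show ?thesis by simp
      qed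
    qed
  qed
  then show ?thesis unfolding eq using fg by simp
qed

text \<open>Test with the bumps for \<open>]a, b[\<close>: their derivatives converge to the point mass at \<open>a\<close> minus
  the one at \<open>b\<close>, and the bumps themselves to the indicator.\<close>

lemma continuous_weak_derivative_FTC:
  fixes h g :: "real \<Rightarrow> real"
  assumes h: "continuous_on UNIV h" and g: "in_L2 UNIV g" "is_weak_gradient UNIV h g" and ab: "a < b"
  shows "h b - h a = (\<integral>x. indicator {a<..<b} x * g x \<partial>lebesgue)"
proof -
  define N where "N n = real (Suc n)" for n
  define A where "A n t = N n * flat_germ 2 (N n * (t - a)) * flat_germ 0 (N n * (b - t))" for n t
  define B where "B n t = N n * flat_germ 2 (N n * (b - t)) * flat_germ 0 (N n * (t - a))" for n t
  have Npos: "N n > 0" for n by (simp add: N_def)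
  have cA: "continuous_on UNIV (A n)" and cB: "continuous_on UNIV (B n)" for n
    unfolding A_def B_def
    by (intro continuous_intros continuous_on_compose2[OF continuous_flat_germ[of UNIV]]; simp)+
  have supp: "A n t = 0" "B n t = 0" if "t \<notin> {a<..<b}" for n t
    using that Npos[of n] by (auto simp: A_def B_def flat_germ_def zero_less_mult_iff not_less mult_le_0_iff)
  have iA: "integrable lborel (\<lambda>t. h t * A n t)" and iB: "integrable lborel (\<lambda>t. h t * B n t)" for n
  proof -
    have "t \<notin> {a<..<b}" if "max \<bar>a\<bar> \<bar>b\<bar> < norm t" for t using that by auto
    then show "integrable lborel (\<lambda>t. h t * A n t)" "integrable lborel (\<lambda>t. h t * B n t)"
      using supp by (auto intro!: integrable_continuous_bounded_support[where R="max \<bar>a\<bar> \<bar>b\<bar>"] continuous_on_mult h cA cB)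
  qed
  have limA: "(\<lambda>n. \<integral>t. h t * A n t \<partial>lborel) \<longlonglongrightarrow> h a"
    unfolding A_def N_def by (rule flat_germ_approximates_point_mass[OF h ab])
  \<comment> \<open>the right end point is the left end point after the reflection t to -t\<close>
  have limB: "(\<lambda>n. \<integral>t. h t * B n t \<partial>lborel) \<longlonglongrightarrow> h b"
  proof -
    have "(\<integral>t. h t * B n t \<partial>lborel) = (\<integral>t. h (- t) * (N n * flat_germ 2 (N n * (t - (- b))) * flat_germ 0 (N n * (- a - t))) \<partial>lborel)" for n
      by (subst lborel_integral_real_affine[of "-1" _ 0]) (simp_all add: B_def add.commute)
    moreover have "(\<lambda>n. \<integral>t. h (- t) * (N n * flat_germ 2 (N n * (t - (- b))) * flat_germ 0 (N n * (- a - t))) \<partial>lborel) \<longlonglongrightarrow> h (- (- b))"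
      unfolding N_def
      by (rule flat_germ_approximates_point_mass) (use ab in \<open>auto intro!: continuous_on_compose2[OF h] continuous_intros\<close>)
    ultimately show ?thesis by simp
  qed
  have mg: "g \<in> borel_measurable lebesgue" and sg: "integrable lebesgue (\<lambda>x. (norm (g x))\<^sup>2)"
    using g(1) by (auto simp: in_L2_iff_extension)
  have weak: "(\<integral>t. h t * A n t \<partial>lborel) - (\<integral>t. h t * B n t \<partial>lborel) = - (\<integral>t. bump (Suc n) a b t * g t \<partial>lebesgue)" for n
  proof -
    have "bump (Suc n) a b \<in> test_functions UNIV" by (rule bump_in_test_functions) simp
    then have "integral\<^sup>L (lebesgue_on UNIV) (\<lambda>x. h x * frechet_derivative (bump (Suc n) a b) (at x) 1)
        = - integral\<^sup>L (lebesgue_on UNIV) (\<lambda>x. (g x \<bullet> 1) * bump (Suc n) a b x)"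
      using g(2) unfolding is_weak_gradient_def by simp
    moreover have "frechet_derivative (bump (Suc n) a b) (at x) 1 = A n x - B n x" for x
      unfolding bump_real_frechet_derivative A_def B_def N_def ..
    ultimately have "(\<integral>t. h t * (A n t - B n t) \<partial>lebesgue) = - (\<integral>t. bump (Suc n) a b t * g t \<partial>lebesgue)"
      by (simp add: integral_lebesgue_on mult.commute)
    moreover have "(\<integral>t. h t * (A n t - B n t) \<partial>lebesgue) = (\<integral>t. h t * (A n t - B n t) \<partial>lborel)"
    proof (rule integral_completion)
      have "continuous_on UNIV (\<lambda>t. h t * (A n t - B n t))" by (intro continuous_intros h cA cB)
      then show "(\<lambda>t. h t * (A n t - B n t)) \<in> borel_measurable lborel" by (simp add: borel_measurable_continuous_onI)
    qed
    moreover have "(\<integral>t. h t * (A n t - B n t) \<partial>lborel) = (\<integral>t. h t * A n t \<partial>lborel) - (\<integral>t. h t * B n t \<partial>lborel)"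
      unfolding right_diff_distrib by (rule Bochner_Integration.integral_diff[OF iA iB])
    ultimately show ?thesis by simp
  qed
  have ind: "integrable lebesgue (\<lambda>x. (norm (indicator {a<..<b} x :: real))\<^sup>2)"
  proof -
    have "(norm (indicator {a<..<b} x :: real))\<^sup>2 = indicator {a<..<b} x" for x by (simp add: indicator_def)
    then show ?thesis by (simp add: lmeasurable_iff_integrable[symmetric])
  qed
  have ig: "integrable lebesgue (\<lambda>x. indicator {a<..<b} x * g x)"
    using square_integrable_inner[OF _ mg ind sg] by (simp add: borel_measurable_indicator)
  have "(\<lambda>n. \<integral>t. bump (Suc n) a b t * g t \<partial>lebesgue) \<longlonglongrightarrow> (\<integral>x. indicator {a<..<b} x * g x \<partial>lebesgue)"
  proof (rule integral_dominated_convergence[where w="\<lambda>x. \<bar>indicator {a<..<b} x * g x\<bar>"])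
    show "(\<lambda>x. bump (Suc n) a b x * g x) \<in> borel_measurable lebesgue" for n
      by (rule borel_measurable_times[OF continuous_measurable_lebesgue[OF smooth_imp_continuous[OF smooth_bump]] mg])
    show "AE x in lebesgue. norm (bump (Suc n) a b x * g x) \<le> \<bar>indicator {a<..<b} x * g x\<bar>" for n
    proof (rule AE_I2)
      fix x
      show "norm (bump (Suc n) a b x * g x) \<le> \<bar>indicator {a<..<b} x * g x\<bar>"
        using bump_eq_0[of x a b "Suc n"] bump_nonneg[of "Suc n" a b x] bump_le_1[of "Suc n" a b x]
        by (cases "x \<in> {a<..<b}") (auto simp: abs_mult mult_left_le_one_le)
    qed
    show "AE x in lebesgue. (\<lambda>n. bump (Suc n) a b x * g x) \<longlonglongrightarrow> indicator {a<..<b} x * g x"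
    proof (rule AE_I2)
      fix x
      have "(\<lambda>n. bump (Suc n) a b x) \<longlonglongrightarrow> indicator {a<..<b} x"
        using LIMSEQ_Suc[OF bump_tendsto[of a b x]] by simp
      then show "(\<lambda>n. bump (Suc n) a b x * g x) \<longlonglongrightarrow> indicator {a<..<b} x * g x"
        by (rule tendsto_mult_right)
    qed
  qed (use ig in auto)
  then have "(\<lambda>n. (\<integral>t. h t * A n t \<partial>lborel) - (\<integral>t. h t * B n t \<partial>lborel)) \<longlonglongrightarrow> - (\<integral>x. indicator {a<..<b} x * g x \<partial>lebesgue)"
    unfolding weak by (rule tendsto_minus)
  with tendsto_diff[OF limA limB] have "h a - h b = - (\<integral>x. indicator {a<..<b} x * g x \<partial>lebesgue)"
    by (rule LIMSEQ_unique)
  then show ?thesis by simp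
qed

lemma weak_derivative_Hoelder:
  fixes h g :: "real \<Rightarrow> real"
  assumes h: "continuous_on UNIV h" and g: "in_L2 UNIV g" "is_weak_gradient UNIV h g" and ab: "a < b"
  shows "(h b - h a)\<^sup>2 \<le> (b - a) * (\<integral>x. indicator {a<..<b} x * (g x)\<^sup>2 \<partial>lebesgue)"
proof -
  let ?I = "indicator {a<..<b} :: real \<Rightarrow> real"
  have mg: "g \<in> borel_measurable lebesgue" and sg: "integrable lebesgue (\<lambda>x. (g x)\<^sup>2)"
    using g(1) by (auto simp: in_L2_iff_extension)
  have I2: "(norm (?I x))\<^sup>2 = ?I x" for x by (simp add: indicator_def)
  have mIg: "(\<lambda>x. ?I x * g x) \<in> borel_measurable lebesgue"
    by (rule borel_measurable_times[OF borel_measurable_indicator mg]) simp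
  have ind: "integrable lebesgue (\<lambda>x. (norm (?I x))\<^sup>2)"
    unfolding I2 by (simp add: lmeasurable_iff_integrable[symmetric])
  have Ig2: "(norm (?I x * g x))\<^sup>2 = ?I x * (g x)\<^sup>2" for x by (simp add: indicator_def)
  have "integrable lebesgue (\<lambda>x. ?I x * (g x)\<^sup>2)"
    using integrable_mult_indicator[OF _ sg, of "{a<..<b}"] by simp
  then have sIg: "integrable lebesgue (\<lambda>x. (norm (?I x * g x))\<^sup>2)" unfolding Ig2 .
  have eq: "?I x \<bullet> (?I x * g x) = ?I x * g x" for x by (simp add: indicator_def)
  have "(\<integral>x. ?I x \<bullet> (?I x * g x) \<partial>lebesgue)\<^sup>2
      \<le> (\<integral>x. (norm (?I x))\<^sup>2 \<partial>lebesgue) * (\<integral>x. (norm (?I x * g x))\<^sup>2 \<partial>lebesgue)"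
    by (rule integral_Cauchy_Schwarz[OF borel_measurable_indicator mIg ind sIg]) simp
  then have "(h b - h a)\<^sup>2 \<le> (\<integral>x. ?I x \<partial>lebesgue) * (\<integral>x. ?I x * (g x)\<^sup>2 \<partial>lebesgue)"
    unfolding eq I2 Ig2 continuous_weak_derivative_FTC[OF h g ab, symmetric] .
  then show ?thesis using ab by simp
qed


section \<open>The Dirichlet energy of a square standing on the axis\<close>

lemma test_function_partial_in_L2:
  assumes "\<phi> \<in> test_functions \<Omega>" "open \<Omega>" "b \<in> Basis"
  shows "in_L2 \<Omega> (\<lambda>x. frechet_derivative \<phi> (at x) b)"
proof -
  let ?d = "\<lambda>x. frechet_derivative \<phi> (at x) b"
  have \<Omega>: "\<Omega> \<in> sets lebesgue" using assms(2) by simp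
  have eq: "indicator \<Omega> x *\<^sub>R ?d x = ?d x" for x
    using test_function_deriv_zero[OF assms(1)] by (auto simp: indicator_def)
  have c: "continuous_on UNIV ?d"
    using test_function_smooth[OF assms(1)] assms(3) by (rule smooth_continuous_partial)
  obtain R where "\<forall>x. R < norm x \<longrightarrow> \<phi> x = 0 \<and> frechet_derivative \<phi> (at x) = (\<lambda>_. 0)"
    using test_function_bounded_support[OF assms(1)] by blast
  then have "integrable lebesgue (\<lambda>x. (norm (?d x))\<^sup>2)"
    by (intro integrable_continuous_bounded_support[where R=R] continuous_intros c) auto
  then show ?thesis
    unfolding in_L2_iff_extension[OF \<Omega>] eq using continuous_measurable_lebesgue[OF c] by blast
qed

lemma is_weak_gradient_diff:
  assumes "open \<Omega>" "in_L2 \<Omega> u" "in_L2 \<Omega> v" "in_L2 \<Omega> G" "in_L2 \<Omega> H"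
    and "is_weak_gradient \<Omega> u G" "is_weak_gradient \<Omega> v H"
  shows "is_weak_gradient \<Omega> (\<lambda>x. u x - v x) (\<lambda>x. G x - H x)"
  unfolding is_weak_gradient_def
proof (intro ballI)
  fix \<phi> and b :: 'a assume \<phi>: "\<phi> \<in> test_functions \<Omega>" and b: "b \<in> Basis"
  note d = test_function_partial_in_L2[OF \<phi> assms(1) b] and t = test_function_in_L2[OF \<phi> assms(1)]
  note i = in_L2_times_integrable[OF assms(2) d] in_L2_times_integrable[OF assms(3) d]
    in_L2_times_integrable[OF in_L2_inner_const[OF assms(4), of b] t]
    in_L2_times_integrable[OF in_L2_inner_const[OF assms(5), of b] t]
  have "integral\<^sup>L (lebesgue_on \<Omega>) (\<lambda>x. u x * frechet_derivative \<phi> (at x) b)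
          = - integral\<^sup>L (lebesgue_on \<Omega>) (\<lambda>x. (G x \<bullet> b) * \<phi> x)"
       "integral\<^sup>L (lebesgue_on \<Omega>) (\<lambda>x. v x * frechet_derivative \<phi> (at x) b)
          = - integral\<^sup>L (lebesgue_on \<Omega>) (\<lambda>x. (H x \<bullet> b) * \<phi> x)"
    using assms(6,7)[unfolded is_weak_gradient_def, rule_format, OF \<phi> b] by simp_all
  then show "integral\<^sup>L (lebesgue_on \<Omega>) (\<lambda>x. (u x - v x) * frechet_derivative \<phi> (at x) b)
          = - integral\<^sup>L (lebesgue_on \<Omega>) (\<lambda>x. ((G x - H x) \<bullet> b) * \<phi> x)"
    using i by (simp add: left_diff_distrib inner_diff_left)
qed

lemma test_functions_mono: "T \<subseteq> S \<Longrightarrow> test_functions T \<subseteq> test_functions S"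
  by (auto simp: test_functions_def)

lemma is_weak_gradient_subset:
  assumes "is_weak_gradient S u G" "T \<subseteq> S" "open S" "open T"
  shows "is_weak_gradient T u G"
  unfolding is_weak_gradient_def
proof (intro ballI)
  fix \<phi> and b :: 'a assume \<phi>: "\<phi> \<in> test_functions T" and b: "b \<in> Basis"
  have \<phi>S: "\<phi> \<in> test_functions S" using \<phi> test_functions_mono[OF assms(2)] by blast
  have sets: "S \<in> sets lebesgue" "T \<in> sets lebesgue" using assms(3,4) by auto
  have 1: "indicator S x *\<^sub>R (u x * frechet_derivative \<phi> (at x) b) = indicator T x *\<^sub>R (u x * frechet_derivative \<phi> (at x) b)" for x
    using test_function_deriv_zero[OF \<phi>, of x] assms(2) by (auto simp: indicator_def)
  have 2: "indicator S x *\<^sub>R ((G x \<bullet> b) * \<phi> x) = indicator T x *\<^sub>R ((G x \<bullet> b) * \<phi> x)" for x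
    using test_function_zero[OF \<phi>, of x] assms(2) by (auto simp: indicator_def)
  show "integral\<^sup>L (lebesgue_on T) (\<lambda>x. u x * frechet_derivative \<phi> (at x) b)
          = - integral\<^sup>L (lebesgue_on T) (\<lambda>x. (G x \<bullet> b) * \<phi> x)"
    using assms(1)[unfolded is_weak_gradient_def, rule_format, OF \<phi>S b]
    unfolding integral_lebesgue_on[OF sets(1)] integral_lebesgue_on[OF sets(2)] 1 2 .
qed

lemma continuous_in_L2:
  fixes f :: "'a::euclidean_space \<Rightarrow> 'b::euclidean_space"
  assumes "continuous_on UNIV f" "bounded S" "S \<in> sets lebesgue"
  shows "in_L2 S f"
proof -
  have "bounded (f ` closure S)"
    by (intro compact_imp_bounded compact_continuous_image continuous_on_subset[OF assms(1)])
       (use assms(2) in auto)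
  then obtain B where "\<And>x. x \<in> closure S \<Longrightarrow> norm (f x) \<le> B" unfolding bounded_iff by blast
  moreover have "S \<in> lmeasurable" using assms by (simp add: bounded_set_imp_lmeasurable)
  moreover have "f \<in> borel_measurable (lebesgue_on S)"
    using continuous_measurable_lebesgue[OF assms(1)] by (rule measurable_restrict_space1)
  ultimately show ?thesis using closure_subset[of S] by (intro in_L2_bounded) auto
qed

lemma continuous_integrable_on_bounded:
  fixes f :: "'a::euclidean_space \<Rightarrow> real"
  assumes "continuous_on UNIV f" "bounded S" "S \<in> sets lebesgue"
  shows "integrable (lebesgue_on S) f"
  using in_L2_times_integrable[OF continuous_in_L2[OF assms] continuous_in_L2[OF continuous_on_const[of UNIV 1] assms(2,3)]]
  by simp

lemma integral_box_continuous:
  fixes f :: "'a::euclidean_space \<Rightarrow> real"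
  assumes "continuous_on UNIV f"
  shows "integral\<^sup>L (lebesgue_on (box a b)) f = integral (cbox a b) f"
proof -
  have "integral\<^sup>L (lebesgue_on (box a b)) f = integral (box a b) f"
    by (intro lebesgue_integral_eq_integral continuous_integrable_on_bounded assms) auto
  then show ?thesis by (simp add: integral_open_interval)
qed

text \<open>For \<open>\<alpha> x = (x - a) (a + r - x)\<close> and \<open>\<beta> y = r - y\<close> this is the rotated gradient
  \<open>(\<alpha> \<beta>', - \<alpha>' \<beta>)\<close> of the stream function \<open>\<alpha> \<beta>\<close>. It is divergence-free, and its normal
  component vanishes on all sides but the bottom one because \<open>\<alpha> \<beta>\<close> does.\<close>

definition square_field :: "real \<Rightarrow> real \<Rightarrow> real \<times> real \<Rightarrow> real \<times> real" where
  "square_field a r = (\<lambda>(x, y). (- (x - a) * (a + r - x), - (2 * a + r - 2 * x) * (r - y)))"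

lemma continuous_square_field: "continuous_on A (square_field a r)"
  unfolding square_field_def case_prod_beta by (intro continuous_intros)

lemma square_field_bound:
  assumes "p \<in> {a<..<a+r} \<times> {0<..<r}"
  shows "(norm (square_field a r p))\<^sup>2 \<le> 2 * r ^ 4"
proof -
  obtain x y where p: "p = (x, y)" "a < x" "x < a + r" "0 < y" "y < r" using assms by auto
  have bound: "(s * t)\<^sup>2 \<le> r ^ 4" if "\<bar>s\<bar> \<le> r" "\<bar>t\<bar> \<le> r" for s t
  proof -
    have "\<bar>s * t\<bar> \<le> r * r" unfolding abs_mult using that by (intro mult_mono) auto
    then have "\<bar>s * t\<bar>\<^sup>2 \<le> (r * r)\<^sup>2" by (intro power_mono) auto
    then show ?thesis by (simp add: power4_eq_xxxx power2_eq_square mult.assoc)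
  qed
  have "(- (x - a) * (a + r - x))\<^sup>2 \<le> r ^ 4" "(- (2 * a + r - 2 * x) * (r - y))\<^sup>2 \<le> r ^ 4"
    using p by (intro bound; simp)+
  then show ?thesis by (simp add: p(1) square_field_def norm_Pair)
qed

text \<open>The divergence theorem for the field above, so that only the bottom side contributes. The
  integrand is split into two parts, \<open>P\<close> and \<open>Q\<close>, each of which is a pure derivative in one variable
  and can be integrated by the fundamental theorem of calculus along that variable; in this way no
  second derivatives of \<open>v\<close> are needed.\<close>

lemma square_identity_smooth:
  fixes v :: "real \<times> real \<Rightarrow> real"
  assumes v: "smooth v" and r: "0 < r"
  shows "integral\<^sup>L (lebesgue_on ({a<..<a+r} \<times> {0<..<r})) (\<lambda>p. grad v p \<bullet> square_field a r p)
    = r * integral\<^sup>L (lebesgue_on {a<..<a+r}) (\<lambda>x. v (x, 0) * (2 * a + r - 2 * x))"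
proof -
  define vx where "vx p = frechet_derivative v (at p) (1, 0)" for p
  define vy where "vy p = frechet_derivative v (at p) (0, 1)" for p
  have B: "(1, 0) \<in> (Basis :: (real \<times> real) set)" "(0, 1) \<in> (Basis :: (real \<times> real) set)"
    by (auto simp: Basis_prod_def)
  have cv: "continuous_on A v" for A using smooth_imp_continuous[OF v] continuous_on_subset by blast
  have cvx: "continuous_on A vx" for A
    using smooth_continuous_partial[OF v B(1)] continuous_on_subset unfolding vx_def by blast
  have cvy: "continuous_on A vy" for A
    using smooth_continuous_partial[OF v B(2)] continuous_on_subset unfolding vy_def by blast
  have dx: "((\<lambda>x. v (x, y)) has_real_derivative vx (x, y)) (at x)" for x y
  proof -
    have "((\<lambda>x. (x, y)) has_derivative (\<lambda>h. (h, 0))) (at x)" by (auto intro!: derivative_eq_intros)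
    from has_derivative_compose[OF this smooth_has_derivative_grad[OF v]]
    have "((\<lambda>x. v (x, y)) has_derivative (\<lambda>h. grad v (x, y) \<bullet> (h, 0))) (at x)" .
    moreover have "grad v (x, y) \<bullet> (h, 0) = vx (x, y) * h" for h
    proof -
      have "(h, 0) = h *\<^sub>R (1, 0::real)" by simp
      then show ?thesis using grad_inner_Basis[OF B(1), of v "(x, y)"] by (simp add: vx_def mult.commute del: scaleR_Pair)
    qed
    ultimately show ?thesis by (simp add: has_field_derivative_def)
  qed
  have dy: "((\<lambda>y. v (x, y)) has_real_derivative vy (x, y)) (at y)" for x y
  proof -
    have "((\<lambda>y. (x, y)) has_derivative (\<lambda>h. (0, h))) (at y)" by (auto intro!: derivative_eq_intros)
    from has_derivative_compose[OF this smooth_has_derivative_grad[OF v]]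
    have "((\<lambda>y. v (x, y)) has_derivative (\<lambda>h. grad v (x, y) \<bullet> (0, h))) (at y)" .
    moreover have "grad v (x, y) \<bullet> (0, h) = vy (x, y) * h" for h
    proof -
      have "(0, h) = h *\<^sub>R (0::real, 1)" by simp
      then show ?thesis using grad_inner_Basis[OF B(2), of v "(x, y)"] by (simp add: vy_def mult.commute del: scaleR_Pair)
    qed
    ultimately show ?thesis by (simp add: has_field_derivative_def)
  qed
  define P where "P = (\<lambda>(x, y). vx (x, y) * ((x - a) * (a + r - x)) + v (x, y) * (2 * a + r - 2 * x))"
  define Q where "Q = (\<lambda>(x, y). (vy (x, y) * (r - y) - v (x, y)) * (2 * a + r - 2 * x))"
  have cP: "continuous_on A P" and cQ: "continuous_on A Q" for A
    unfolding P_def Q_def case_prod_beta prod.collapse by (intro continuous_intros cv cvx cvy)+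
  have split: "grad v p \<bullet> square_field a r p = - P p - Q p" for p
  proof -
    obtain x y where p: "p = (x, y)" by (cases p)
    have "grad v p \<bullet> (s, t) = vx p * s + vy p * t" for s t
    proof -
      have "(s, t) = s *\<^sub>R (1, 0) + t *\<^sub>R (0, 1)" by simp
      then have "grad v p \<bullet> (s, t) = s * (grad v p \<bullet> (1, 0)) + t * (grad v p \<bullet> (0, 1))"
        by (simp only: inner_add_right inner_scaleR_right)
      then show ?thesis using grad_inner_Basis[OF B(1), of v p] grad_inner_Basis[OF B(2), of v p]
        by (simp add: vx_def vy_def)
    qed
    then show ?thesis by (simp add: p square_field_def P_def Q_def algebra_simps)
  qed
  have Px: "integral {a..a+r} (\<lambda>x. P (x, y)) = 0" for y
  proof -
    have "((\<lambda>x. P (x, y)) has_integral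
        v (a + r, y) * ((a + r - a) * (a + r - (a + r))) - v (a, y) * ((a - a) * (a + r - a))) {a..a+r}"
    proof (rule fundamental_theorem_of_calculus)
      show "((\<lambda>x. v (x, y) * ((x - a) * (a + r - x))) has_vector_derivative P (x, y)) (at x within {a..a+r})" for x
        unfolding has_real_derivative_iff_has_vector_derivative[symmetric] P_def
        by (rule DERIV_subset[of _ _ _ UNIV])
           (auto intro!: derivative_eq_intros dx simp: algebra_simps)
    qed (use r in auto)
    then show ?thesis by (simp add: integral_unique)
  qed
  have Qy: "integral {0..r} (\<lambda>y. Q (x, y)) = - r * (v (x, 0) * (2 * a + r - 2 * x))" for x
  proof -
    have "((\<lambda>y. Q (x, y)) has_integral
        v (x, r) * (r - r) * (2 * a + r - 2 * x) - v (x, 0) * (r - 0) * (2 * a + r - 2 * x)) {0..r}"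
    proof (rule fundamental_theorem_of_calculus)
      show "((\<lambda>y. v (x, y) * (r - y) * (2 * a + r - 2 * x)) has_vector_derivative Q (x, y)) (at y within {0..r})" for y
        unfolding has_real_derivative_iff_has_vector_derivative[symmetric] Q_def
        by (rule DERIV_subset[of _ _ _ UNIV])
           (auto intro!: derivative_eq_intros dy simp: algebra_simps)
    qed (use r in auto)
    then show ?thesis by (simp add: integral_unique)
  qed
  have R: "{a<..<a+r} \<times> {0<..<r} = box (a, 0) (a + r, r)" by (auto simp: box_def Basis_prod_def)
  have "integral\<^sup>L (lebesgue_on ({a<..<a+r} \<times> {0<..<r})) (\<lambda>p. grad v p \<bullet> square_field a r p)
      = integral (cbox (a, 0) (a + r, r)) (\<lambda>p. - P p - Q p)"
    unfolding R split by (intro integral_box_continuous continuous_intros cP cQ)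
  also have "\<dots> = - integral (cbox (a, 0) (a + r, r)) P - integral (cbox (a, 0) (a + r, r)) Q"
    using integrable_continuous[OF cP] integrable_continuous[OF cQ]
    by (subst integral_diff) (auto simp: integrable_neg_iff)
  also have "integral (cbox (a, 0) (a + r, r)) P = 0"
  proof -
    have "integral (cbox (a, 0) (a + r, r)) P = integral (cbox a (a + r)) (\<lambda>x. integral (cbox 0 r) (\<lambda>y. P (x, y)))"
      by (rule integral_prod_continuous[OF cP])
    also have "\<dots> = integral (cbox 0 r) (\<lambda>y. integral (cbox a (a + r)) (\<lambda>x. P (x, y)))"
      by (rule integral_swap_continuous[of a 0 "a + r" r "\<lambda>x y. P (x, y)"]) (use cP in \<open>simp add: case_prod_beta\<close>)
    finally show ?thesis using Px by simp
  qed
  also have "integral (cbox (a, 0) (a + r, r)) Q = - r * integral {a..a+r} (\<lambda>x. v (x, 0) * (2 * a + r - 2 * x))"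
  proof -
    have "integral (cbox (a, 0) (a + r, r)) Q = integral (cbox a (a + r)) (\<lambda>x. integral (cbox 0 r) (\<lambda>y. Q (x, y)))"
      by (rule integral_prod_continuous[OF cQ])
    then show ?thesis using Qy by simp
  qed
  also have "integral {a..a+r} (\<lambda>x. v (x, 0) * (2 * a + r - 2 * x))
      = integral\<^sup>L (lebesgue_on {a<..<a+r}) (\<lambda>x. v (x, 0) * (2 * a + r - 2 * x))"
    using integral_box_continuous[of "\<lambda>x. v (x, 0) * (2 * a + r - 2 * x)" a "a+r"]
    by (simp add: continuous_intros continuous_on_compose2[OF cv[of UNIV]])
  finally show ?thesis by simp
qed

lemma square_weight_moment:
  fixes a r :: real
  assumes "0 < r"
  shows "integral\<^sup>L (lebesgue_on {a<..<a+r}) (\<lambda>x. x * (2 * a + r - 2 * x)) = - (r ^ 3) / 6"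
proof -
  let ?F = "\<lambda>x::real. (2 * a + r) * x ^ 2 / 2 - 2 * x ^ 3 / 3"
  have "integral\<^sup>L (lebesgue_on {a<..<a+r}) (\<lambda>x. x * (2 * a + r - 2 * x)) = integral {a..a+r} (\<lambda>x. x * (2 * a + r - 2 * x))"
    using integral_box_continuous[of "\<lambda>x. x * (2 * a + r - 2 * x)" a "a+r"] by (simp add: continuous_intros)
  also have "\<dots> = ?F (a + r) - ?F a"
  proof (rule integral_unique, rule fundamental_theorem_of_calculus)
    show "(?F has_vector_derivative x * (2 * a + r - 2 * x)) (at x within {a..a+r})" for x
      unfolding has_real_derivative_iff_has_vector_derivative[symmetric]
      by (rule DERIV_subset[of _ _ _ UNIV])
         (auto intro!: derivative_eq_intros simp: algebra_simps power2_eq_square)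
  qed (use assms in auto)
  also have "\<dots> = - (r ^ 3) / 6" by (simp add: field_simps power2_eq_square power3_eq_cube)
  finally show ?thesis .
qed

lemma tendsto_zero_if_square_le:
  fixes X Y :: "nat \<Rightarrow> real"
  assumes "\<And>n. (X n)\<^sup>2 \<le> Y n * c" "Y \<longlonglongrightarrow> 0"
  shows "X \<longlonglongrightarrow> 0"
proof -
  have Y: "(\<lambda>n. Y n * c) \<longlonglongrightarrow> 0" using tendsto_mult_left_zero[OF assms(2)] by simp
  have "(\<lambda>n. (X n)\<^sup>2) \<longlonglongrightarrow> 0"
    by (rule real_tendsto_sandwich[OF _ _ tendsto_const[of 0] Y]) (use assms(1) in auto)
  then show ?thesis by (simp add: power_tendsto_0_iff)
qed

text \<open>Pass to the limit in the divergence identity along the sequence that defines the trace: the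
  gradients converge in \<open>L\<^sup>2\<close> of the square and the boundary values in \<open>L\<^sup>2\<close> of its base. This gives
  \<open>\<integral> G \<bullet> F = - r\<^sup>4 / 6\<close> for the field \<open>F\<close>, whose squared norm integrates to at most
  \<open>2 r\<^sup>6\<close>, and Cauchy-Schwarz concludes.\<close>

lemma square_energy_lower_bound:
  assumes r: "0 < r" and trace: "has_bottom_trace a (a + r) r u (\<lambda>x. x)"
    and G: "in_L2 ({a<..<a+r} \<times> {0<..<r}) G" "is_weak_gradient ({a<..<a+r} \<times> {0<..<r}) u G"
  shows "r\<^sup>2 / 72 \<le> integral\<^sup>L (lebesgue_on ({a<..<a+r} \<times> {0<..<r})) (\<lambda>p. (norm (G p))\<^sup>2)"
proof -
  define R where "R = {a<..<a+r} \<times> {0<..<r}"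
  define I where "I = {a<..<a+r}"
  let ?F = "square_field a r"
  let ?al = "\<lambda>x. 2 * a + r - 2 * x"
  have Rbox: "R = box (a, 0) (a + r, r)" unfolding R_def by (auto simp: box_def Basis_prod_def)
  have R: "open R" "bounded R" "R \<in> sets lebesgue" unfolding Rbox by (auto simp: open_box)
  have I: "bounded I" "I \<in> sets lebesgue" unfolding I_def by auto
  note G = G[folded R_def]
  obtain v where v: "\<And>n. smooth (v n)" "(\<lambda>n. H1_norm R (\<lambda>p. v n p - u p)) \<longlonglongrightarrow> 0"
      "(\<lambda>n. integral\<^sup>L (lebesgue_on I) (\<lambda>x. (v n (x, 0) - x)\<^sup>2)) \<longlonglongrightarrow> 0"
    and uH1: "in_H1 R u"
    using trace unfolding has_bottom_trace_def R_def I_def by blast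
  have u2: "in_L2 R u" using uH1 by (simp add: in_H1_def)
  have F2: "in_L2 R ?F" by (intro continuous_in_L2 continuous_square_field R)
  have al2: "in_L2 I ?al" by (intro continuous_in_L2 continuous_intros I)
  have gv2: "in_L2 R (grad (v n))" for n by (intro continuous_in_L2 continuous_grad v R)
  have v2: "in_L2 R (v n)" for n by (intro continuous_in_L2 smooth_imp_continuous v R)
  have cs: "(integral\<^sup>L (lebesgue_on R) (\<lambda>p. f p \<bullet> ?F p))\<^sup>2
      \<le> integral\<^sup>L (lebesgue_on R) (\<lambda>p. (norm (f p))\<^sup>2) * integral\<^sup>L (lebesgue_on R) (\<lambda>p. (norm (?F p))\<^sup>2)"
    if "in_L2 R f" for f
    using integral_Cauchy_Schwarz[of f "lebesgue_on R" ?F] that F2 by (simp add: in_L2_def)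
  have inn: "integrable (lebesgue_on R) (\<lambda>p. f p \<bullet> ?F p)" if "in_L2 R f" for f
    using square_integrable_inner[of f "lebesgue_on R" ?F] that F2 by (simp add: in_L2_def)
  have dirichlet_le: "integral\<^sup>L (lebesgue_on R) (\<lambda>p. (norm (grad (v n) p - G p))\<^sup>2) \<le> (H1_norm R (\<lambda>p. v n p - u p))\<^sup>2" for n
  proof -
    have "is_weak_gradient R (\<lambda>p. v n p - u p) (\<lambda>p. grad (v n) p - G p)"
      by (rule is_weak_gradient_diff[OF R(1) v2 u2 gv2 G(1) is_weak_gradient_smooth[OF R(1) v(1)] G(2)])
    then have "dirichlet R (\<lambda>p. v n p - u p) = integral\<^sup>L (lebesgue_on R) (\<lambda>p. (norm (grad (v n) p - G p))\<^sup>2)"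
      unfolding dirichlet_def by (rule integral_weak_gradient_eq[OF R(1) in_L2_diff[OF gv2 G(1)]])
    moreover have "0 \<le> integral\<^sup>L (lebesgue_on R) (\<lambda>p. (v n p - u p)\<^sup>2)" by simp
    moreover have "0 \<le> integral\<^sup>L (lebesgue_on R) (\<lambda>p. (norm (grad (v n) p - G p))\<^sup>2)" by simp
    ultimately show ?thesis unfolding H1_norm_def by simp
  qed
  have H0: "(\<lambda>n. (H1_norm R (\<lambda>p. v n p - u p))\<^sup>2) \<longlonglongrightarrow> 0"
    using tendsto_power[OF v(2), of 2] by simp
  have gap: "(\<lambda>n. integral\<^sup>L (lebesgue_on R) (\<lambda>p. (norm (grad (v n) p - G p))\<^sup>2)) \<longlonglongrightarrow> 0"
    by (rule real_tendsto_sandwich[OF _ _ tendsto_const[of 0] H0]) (use dirichlet_le in auto)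
  have "(\<lambda>n. integral\<^sup>L (lebesgue_on R) (\<lambda>p. (grad (v n) p - G p) \<bullet> ?F p)) \<longlonglongrightarrow> 0"
    by (rule tendsto_zero_if_square_le[OF cs[OF in_L2_diff[OF gv2 G(1)]] gap])
  then have "(\<lambda>n. integral\<^sup>L (lebesgue_on R) (\<lambda>p. grad (v n) p \<bullet> ?F p) - integral\<^sup>L (lebesgue_on R) (\<lambda>p. G p \<bullet> ?F p)) \<longlonglongrightarrow> 0"
    using inn[OF gv2] inn[OF G(1)] by (simp add: inner_diff_left)
  then have lim1: "(\<lambda>n. integral\<^sup>L (lebesgue_on R) (\<lambda>p. grad (v n) p \<bullet> ?F p)) \<longlonglongrightarrow> integral\<^sup>L (lebesgue_on R) (\<lambda>p. G p \<bullet> ?F p)"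
    by (simp add: LIM_zero_iff)
  have cv0: "continuous_on UNIV (\<lambda>x. v n (x, 0))" for n
    by (intro continuous_on_compose2[OF smooth_imp_continuous[OF v(1)]] continuous_intros) auto
  have e2: "in_L2 I (\<lambda>x. v n (x, 0) - x)" for n by (intro continuous_in_L2 continuous_intros cv0 I)
  have "(integral\<^sup>L (lebesgue_on I) (\<lambda>x. (v n (x, 0) - x) * ?al x))\<^sup>2
      \<le> integral\<^sup>L (lebesgue_on I) (\<lambda>x. (v n (x, 0) - x)\<^sup>2) * integral\<^sup>L (lebesgue_on I) (\<lambda>x. (?al x)\<^sup>2)" for n
    using integral_Cauchy_Schwarz[of "\<lambda>x. v n (x, 0) - x" "lebesgue_on I" ?al] e2[of n] al2
    by (simp add: in_L2_def)
  then have "(\<lambda>n. integral\<^sup>L (lebesgue_on I) (\<lambda>x. (v n (x, 0) - x) * ?al x)) \<longlonglongrightarrow> 0"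
    by (rule tendsto_zero_if_square_le[OF _ v(3)])
  moreover have "integral\<^sup>L (lebesgue_on I) (\<lambda>x. (v n (x, 0) - x) * ?al x)
      = integral\<^sup>L (lebesgue_on I) (\<lambda>x. v n (x, 0) * ?al x) - (- (r ^ 3) / 6)" for n
  proof -
    have "integrable (lebesgue_on I) (\<lambda>x. v n (x, 0) * ?al x)" "integrable (lebesgue_on I) (\<lambda>x. x * ?al x)"
      by (intro continuous_integrable_on_bounded continuous_intros cv0 I)+
    then show ?thesis
      unfolding left_diff_distrib[of "v n _"] using square_weight_moment[OF r, of a, folded I_def]
      by (subst Bochner_Integration.integral_diff) auto
  qed
  ultimately have "(\<lambda>n. integral\<^sup>L (lebesgue_on I) (\<lambda>x. v n (x, 0) * ?al x)) \<longlonglongrightarrow> - (r ^ 3) / 6"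
    by (simp only: LIM_zero_iff)
  then have "(\<lambda>n. r * integral\<^sup>L (lebesgue_on I) (\<lambda>x. v n (x, 0) * ?al x)) \<longlonglongrightarrow> r * (- (r ^ 3) / 6)"
    by (rule tendsto_mult_left)
  then have "(\<lambda>n. integral\<^sup>L (lebesgue_on R) (\<lambda>p. grad (v n) p \<bullet> ?F p)) \<longlonglongrightarrow> r * (- (r ^ 3) / 6)"
    unfolding R_def I_def square_identity_smooth[OF v(1) r] .
  then have val: "integral\<^sup>L (lebesgue_on R) (\<lambda>p. G p \<bullet> ?F p) = r * (- (r ^ 3) / 6)"
    using lim1 LIMSEQ_unique by blast
  have Fle: "integral\<^sup>L (lebesgue_on R) (\<lambda>p. (norm (?F p))\<^sup>2) \<le> 2 * r ^ 6"
  proof -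
    have "integral\<^sup>L (lebesgue_on R) (\<lambda>p. (norm (?F p))\<^sup>2) \<le> integral\<^sup>L (lebesgue_on R) (\<lambda>p. 2 * r ^ 4)"
    proof (rule integral_mono)
      show "integrable (lebesgue_on R) (\<lambda>p. (norm (?F p))\<^sup>2)" using F2 by (simp add: in_L2_def)
      show "integrable (lebesgue_on R) (\<lambda>p. 2 * r ^ 4)"
        by (intro continuous_integrable_on_bounded continuous_on_const R)
      show "(norm (?F p))\<^sup>2 \<le> 2 * r ^ 4" if "p \<in> space (lebesgue_on R)" for p
        using that by (intro square_field_bound) (simp add: R_def)
    qed
    also have "\<dots> = 2 * r ^ 4 * (r * r)"
    proof -
      have "integral\<^sup>L (lebesgue_on R) (\<lambda>p. 2 * r ^ 4) = integral (cbox (a, 0) (a + r, r)) (\<lambda>p. 2 * r ^ 4)"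
        unfolding Rbox by (intro integral_box_continuous continuous_on_const)
      also have "\<dots> = measure lborel (cbox (a, 0) (a + r, r)) * (2 * r ^ 4)" by simp
      also have "measure lborel (cbox (a, 0::real) (a + r, r)) = r * r" using r by (simp add: content_Pair)
      finally show ?thesis by simp
    qed
    finally show ?thesis by (simp add: power_numeral_reduce mult.assoc)
  qed
  have "(r * (- (r ^ 3) / 6))\<^sup>2 \<le> integral\<^sup>L (lebesgue_on R) (\<lambda>p. (norm (G p))\<^sup>2) * (2 * r ^ 6)"
    using cs[OF G(1)] unfolding val
    by (rule order_trans) (intro mult_left_mono Fle, simp)
  moreover have "(r * (- (r ^ 3) / 6))\<^sup>2 = (r\<^sup>2 / 72) * (2 * r ^ 6)"
    by (simp add: power2_eq_square power_numeral_reduce)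
  ultimately show ?thesis
    unfolding R_def[symmetric] using r mult_right_le_imp_le[of "r\<^sup>2 / 72" "2 * r ^ 6"] by simp
qed


section \<open>Localizing the volume\<close>

text \<open>If a point lies in three intervals, the one reaching furthest to the left and the one reaching
  furthest to the right already cover all intervals through the point, so another one can be dropped.\<close>

lemma interval_subcover_overlap_two:
  fixes l r :: "'i \<Rightarrow> real"
  assumes "finite I"
  shows "\<exists>J\<subseteq>I. (\<Union>i\<in>J. {l i<..<r i}) = (\<Union>i\<in>I. {l i<..<r i}) \<and> (\<forall>x. card {i\<in>J. x \<in> {l i<..<r i}} \<le> 2)"
  using assms
proof (induction I rule: finite_psubset_induct)
  case (psubset I)
  show ?case
  proof (cases "\<forall>x. card {i\<in>I. x \<in> {l i<..<r i}} \<le> 2")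
    case True
    then show ?thesis by blast
  next
    case False
    then obtain x where x: "card {i\<in>I. x \<in> {l i<..<r i}} > 2" by (auto simp: not_le)
    define A where "A = {i\<in>I. x \<in> {l i<..<r i}}"
    have "finite A" "card A > 2" using x psubset.hyps by (simp_all add: A_def)
    then have A: "finite A" "A \<noteq> {}" "card A > 2" by auto
    define p where "p = arg_min_on l A"
    define q where "q = arg_min_on (\<lambda>i. - r i) A"
    have p: "p \<in> A" "\<And>i. i \<in> A \<Longrightarrow> l p \<le> l i"
      unfolding p_def using arg_min_if_finite[OF A(1,2), of l] by (auto simp: not_less)
    have q: "q \<in> A" "\<And>i. i \<in> A \<Longrightarrow> r i \<le> r q"
      unfolding q_def using arg_min_if_finite[OF A(1,2), of "\<lambda>i. - r i"] by (auto simp: not_less)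
    have "\<not> A \<subseteq> {p, q}"
    proof
      assume "A \<subseteq> {p, q}"
      then have "card A \<le> card {p, q}" by (intro card_mono) auto
      also have "\<dots> \<le> 2" by (simp add: card_insert_if)
      finally show False using A(3) by simp
    qed
    then obtain k where k: "k \<in> A" "k \<noteq> p" "k \<noteq> q" by auto
    have "{l k<..<r k} \<subseteq> {l p<..<r p} \<union> {l q<..<r q}"
    proof
      fix y assume "y \<in> {l k<..<r k}"
      then show "y \<in> {l p<..<r p} \<union> {l q<..<r q}"
        using p(1) p(2)[OF k(1)] q(1) q(2)[OF k(1)] by (auto simp: A_def)
    qed
    moreover have "p \<in> I - {k}" "q \<in> I - {k}" using p q k by (auto simp: A_def)
    ultimately have un: "(\<Union>i\<in>I - {k}. {l i<..<r i}) = (\<Union>i\<in>I. {l i<..<r i})" by blast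
    have "I - {k} \<subset> I" using k by (auto simp: A_def)
    from psubset.IH[OF this] obtain J where J: "J \<subseteq> I - {k}"
      "(\<Union>i\<in>J. {l i<..<r i}) = (\<Union>i\<in>I - {k}. {l i<..<r i})"
      "\<forall>x. card {i\<in>J. x \<in> {l i<..<r i}} \<le> 2" by (elim exE conjE)
    have "J \<subseteq> I" using J(1) by blast
    then show ?thesis using J(2)[unfolded un] J(3) by (intro exI[of _ J] conjI)
  qed
qed

lemma open_subgraph:
  assumes "continuous_on UNIV h" shows "open (Omega h)"
proof -
  have "continuous_on UNIV (\<lambda>p::real \<times> real. h (fst p))"
    by (intro continuous_on_compose2[OF assms] continuous_intros) auto
  then have "open {p. 0 < snd p \<and> snd p < h (fst p)}"
    by (intro open_Collect_conj open_Collect_less continuous_intros)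
  moreover have "Omega h = {p. 0 < snd p \<and> snd p < h (fst p)}" by (auto simp: Omega_def)
  ultimately show ?thesis by simp
qed

text \<open>An admissible pair together with representatives \<open>g\<close> and \<open>G\<close> of the two weak gradients, so that the
  estimates do not refer to the choice operator. The volume is left free.\<close>

locale droplet =
  fixes u :: "real \<times> real \<Rightarrow> real" and h g :: "real \<Rightarrow> real" and G :: "real \<times> real \<Rightarrow> real \<times> real"
  assumes h_cont: "continuous_on UNIV h" and h_nonneg: "\<And>x. 0 \<le> h x"
    and h_int: "integrable lebesgue h"
    and g2: "in_L2 UNIV g" and g_weak: "is_weak_gradient UNIV h g"
    and G2: "in_L2 (Omega h) G" and G_weak: "is_weak_gradient (Omega h) u G"
    and trace: "has_trace_on_supp h u (\<lambda>x. x)"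
begin

definition E where "E = integral\<^sup>L (lebesgue_on (Omega h)) (\<lambda>p. (norm (G p))\<^sup>2)"
definition S where "S = (\<integral>x. (g x)\<^sup>2 \<partial>lebesgue)"

lemma E_nonneg: "0 \<le> E" and S_nonneg: "0 \<le> S"
  by (simp_all add: E_def S_def)

lemma open_Omega: "open (Omega h)"
  using h_cont by (rule open_subgraph)

lemma g_sq_integrable: "integrable lebesgue (\<lambda>x. (g x)\<^sup>2)"
  using g2 by (simp add: in_L2_iff_extension)

lemma G_sq_integrable: "integrable lebesgue (\<lambda>p. indicator (Omega h) p * (norm (G p))\<^sup>2)"
  using G2 open_Omega by (simp add: in_L2_def integrable_lebesgue_on)

lemma E_eq: "E = (\<integral>p. indicator (Omega h) p * (norm (G p))\<^sup>2 \<partial>lebesgue)"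
  unfolding E_def using open_Omega by (simp add: integral_lebesgue_on)

definition S_on where "S_on A = (\<integral>x. indicator A x * (g x)\<^sup>2 \<partial>lebesgue)"

lemma S_on_integrable: "A \<in> sets lebesgue \<Longrightarrow> integrable lebesgue (\<lambda>x. indicator A x * (g x)\<^sup>2)"
  using integrable_mult_indicator[OF _ g_sq_integrable, of A] by simp

lemma S_on_mono: 
  assumes "A \<subseteq> B" "A \<in> sets lebesgue" "B \<in> sets lebesgue" shows "S_on A \<le> S_on B"
  unfolding S_on_def using assms
  by (intro integral_mono S_on_integrable mult_right_mono) (auto simp: indicator_def)

lemma S_on_le: "A \<in> sets lebesgue \<Longrightarrow> S_on A \<le> S"
  unfolding S_on_def S_def
  by (intro integral_mono S_on_integrable g_sq_integrable) (auto simp: indicator_def)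

lemma h_Hoelder:
  assumes "x \<noteq> y"
  shows "(h y - h x)\<^sup>2 \<le> \<bar>y - x\<bar> * S_on {min x y<..<max x y}"
proof (cases "x < y")
  case True
  then show ?thesis
    using weak_derivative_Hoelder[OF h_cont g2 g_weak True] by (simp add: S_on_def)
next
  case False
  then have "y < x" using assms by simp
  then show ?thesis
    using weak_derivative_Hoelder[OF h_cont g2 g_weak \<open>y < x\<close>]
    by (simp add: S_on_def power2_commute min_def max_def)
qed

definition square where "square x r = {x<..<x+r} \<times> {0<..<r::real}"
definition E_on where "E_on x r = integral\<^sup>L (lebesgue_on (square x r)) (\<lambda>p. (norm (G p))\<^sup>2)"

lemma square_sets: "open (square x r)" "square x r \<in> sets lebesgue"
  by (simp_all add: square_def open_Times)

lemma E_on_eq: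
  assumes "square x r \<subseteq> Omega h"
  shows "E_on x r = (\<integral>p. indicator (square x r) p * (indicator (Omega h) p * (norm (G p))\<^sup>2) \<partial>lebesgue)"
proof -
  have "indicator (square x r) p * (norm (G p))\<^sup>2 = indicator (square x r) p * (indicator (Omega h) p * (norm (G p))\<^sup>2)" for p
    using assms by (auto simp: indicator_def)
  then show ?thesis
    unfolding E_on_def integral_lebesgue_on[OF square_sets(2)] real_scaleR_def by (simp only:)
qed

lemma E_on_integrable:
  "integrable lebesgue (\<lambda>p. indicator (square x r) p * (indicator (Omega h) p * (norm (G p))\<^sup>2))"
  using integrable_mult_indicator[OF square_sets(2) G_sq_integrable] by simp

text \<open>Take for \<open>r\<close> the smaller of \<open>h x / 2\<close> and the distance from \<open>x\<close> to the closed set where \<open>h\<close>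
  differs from \<open>h x\<close> by at least \<open>h x / 2\<close>. If the distance is the smaller one, the Hoelder bound
  between \<open>x\<close> and a nearest point of that set yields the last alternative. Since \<open>r \<le> h x / 2 < h\<close> on
  the interval, the square fits under the graph.\<close>

lemma local_scale:
  assumes t: "0 < h x"
  shows "\<exists>r>0. r \<le> h x / 2 \<and> (\<forall>y\<in>{x-r<..<x+r}. h y \<le> 3 * h x / 2) \<and>
    square x r \<subseteq> Omega h \<and> r\<^sup>2 \<le> 72 * E_on x r \<and>
    (2 * r = h x \<or> (h x)\<^sup>2 \<le> 4 * r * S_on {x-r<..<x+r})"
proof -
  define t where "t = h x"
  have t0: "0 < t" using assms by (simp add: t_def)
  define B where "B = {y. t / 2 \<le> \<bar>h y - t\<bar>}"
  have "\<exists>r>0. r \<le> t / 2 \<and> (\<forall>y\<in>{x-r<..<x+r}. \<bar>h y - t\<bar> < t / 2) \<and>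
      (2 * r = t \<or> t\<^sup>2 \<le> 4 * r * S_on {x-r<..<x+r})"
  proof (cases "\<exists>y\<in>B. \<bar>y - x\<bar> < t / 2")
    case False
    then have "\<bar>h y - t\<bar> < t / 2" if "\<bar>y - x\<bar> < t / 2" for y
      using that by (force simp: B_def)
    moreover have "\<bar>y - x\<bar> < t / 2" if "y \<in> {x-t/2<..<x+t/2}" for y
      using that unfolding abs_less_iff greaterThanLessThan_iff by linarith
    ultimately show ?thesis using t0 by (intro exI[of _ "t/2"]) simp
  next
    case True
    then obtain y0 where y0: "y0 \<in> B" "\<bar>y0 - x\<bar> < t / 2" by blast
    have "closed B" unfolding B_def by (intro closed_Collect_le continuous_intros h_cont)
    then obtain y where y: "y \<in> B" "\<And>z. z \<in> B \<Longrightarrow> dist x y \<le> dist x z"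
      using distance_attains_inf[of B x] y0 by blast
    define r where "r = \<bar>y - x\<bar>"
    have yx: "y \<noteq> x" using y(1) t0 by (auto simp: B_def t_def)
    have r: "0 < r" "r \<le> t / 2" using yx y(2)[OF y0(1)] y0(2) by (auto simp: r_def dist_real_def abs_minus_commute)
    have in_r: "\<bar>h z - t\<bar> < t / 2" if "z \<in> {x-r<..<x+r}" for z
    proof (rule ccontr)
      assume "\<not> ?thesis"
      then have "z \<in> B" by (simp add: B_def)
      then have "r \<le> \<bar>z - x\<bar>" using y(2)[of z] by (simp add: r_def dist_real_def abs_minus_commute)
      then show False using that by (auto simp: abs_if split: if_splits)
    qed
    have "(t / 2)\<^sup>2 \<le> (h y - h x)\<^sup>2"
      using y(1) t0 power_mono[of "t/2" "\<bar>h y - t\<bar>" 2] by (simp add: B_def t_def)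
    also have "\<dots> \<le> r * S_on {min x y<..<max x y}"
      using h_Hoelder[of x y] yx by (simp add: r_def)
    also have "\<dots> \<le> r * S_on {x-r<..<x+r}"
      using r(1) by (intro mult_left_mono S_on_mono) (auto simp: r_def min_def max_def abs_if)
    finally have "t\<^sup>2 \<le> 4 * r * S_on {x-r<..<x+r}" by (simp add: power2_eq_square)
    then show ?thesis using r in_r by blast
  qed
  then obtain r where r: "0 < r" "r \<le> t / 2" "\<And>y. y \<in> {x-r<..<x+r} \<Longrightarrow> \<bar>h y - t\<bar> < t / 2"
      "2 * r = t \<or> t\<^sup>2 \<le> 4 * r * S_on {x-r<..<x+r}" by blast
  have up: "h y \<le> 3 * t / 2" if "y \<in> {x-r<..<x+r}" for y
    using r(3)[OF that] by linarith
  have sub: "square x r \<subseteq> Omega h"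
  proof
    fix p assume p: "p \<in> square x r"
    then have "\<bar>h (fst p) - t\<bar> < t / 2" using r(1) by (intro r(3)) (auto simp: square_def)
    then have "t / 2 < h (fst p)" by linarith
    then show "p \<in> Omega h" using p r(2) by (cases p) (auto simp: square_def Omega_def)
  qed
  have "has_bottom_trace x (x + r) r u (\<lambda>x. x)"
    using trace sub r(1) unfolding has_trace_on_supp_def square_def by simp
  moreover have "in_L2 (square x r) G"
    using open_Omega square_sets by (intro in_L2_subset[OF G2 sub]) auto
  moreover have "is_weak_gradient (square x r) u G"
    by (rule is_weak_gradient_subset[OF G_weak sub open_Omega square_sets(1)])
  ultimately have "r\<^sup>2 / 72 \<le> E_on x r"
    unfolding E_on_def square_def by (intro square_energy_lower_bound r(1))
  then show ?thesis using r up sub unfolding t_def by (intro exI[of _ r]) auto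
qed

lemma E_on_le:
  assumes "square x r \<subseteq> Omega h" shows "E_on x r \<le> E"
  unfolding E_on_eq[OF assms] E_eq
  by (intro integral_mono E_on_integrable G_sq_integrable) (auto simp: indicator_def)

text \<open>The two alternatives of \<open>local_scale\<close>: in the second one, \<open>r\<close> is eliminated between
  \<open>r\<^sup>2 \<le> 72 E\<close> and \<open>(h x)\<^sup>2 \<le> 4 r S\<close>.\<close>

lemma height_bound: "(h x)\<^sup>2 \<le> 288 * (E + S) \<or> (h x) ^ 4 \<le> 1152 * (E + S) ^ 3"
proof (cases "h x = 0")
  case True
  then show ?thesis using E_nonneg S_nonneg by simp
next
  case False
  then have "0 < h x" using h_nonneg[of x] by simp
  from local_scale[OF this] obtain r where r: "0 < r" "square x r \<subseteq> Omega h" "r\<^sup>2 \<le> 72 * E_on x r"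
    "2 * r = h x \<or> (h x)\<^sup>2 \<le> 4 * r * S_on {x-r<..<x+r}" by blast
  have rE: "r\<^sup>2 \<le> 72 * E" using r(3) E_on_le[OF r(2)] by simp
  from r(4) show ?thesis
  proof
    assume "2 * r = h x"
    then have "(h x)\<^sup>2 = 4 * r\<^sup>2" by (simp add: power2_eq_square flip: \<open>2 * r = h x\<close>)
    then show ?thesis using rE E_nonneg S_nonneg by simp
  next
    assume *: "(h x)\<^sup>2 \<le> 4 * r * S_on {x-r<..<x+r}"
    also have "\<dots> \<le> 4 * r * S" using r(1) by (intro mult_left_mono S_on_le) auto
    finally have "((h x)\<^sup>2)\<^sup>2 \<le> (4 * r * S)\<^sup>2" by (intro power_mono) auto
    also have "\<dots> = 16 * S\<^sup>2 * r\<^sup>2" by (simp add: power_mult_distrib)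
    also have "\<dots> \<le> 16 * S\<^sup>2 * (72 * E)" using rE by (intro mult_left_mono) auto
    also have "\<dots> = 1152 * (S\<^sup>2 * E)" by simp
    also have "\<dots> \<le> 1152 * ((E + S)\<^sup>2 * (E + S))"
      using E_nonneg S_nonneg by (intro mult_left_mono mult_mono power_mono) auto
    finally show ?thesis by (simp add: power3_eq_cube power2_eq_square power4_eq_xxxx mult.assoc)
  qed
qed

text \<open>The hypothesis on \<open>k\<close> is the form in which the height enters: it says that the local volume,
  of order \<open>r t\<close>, is at most \<open>k\<close> times the local energy, of order \<open>r\<^sup>2 + t\<^sup>2 / r\<close>. The constant
  is \<open>432 = 3 * 144\<close> from a single interval, doubled by the overlap of the intervals.\<close>

lemma volume_on_compact:
  assumes k: "1 \<le> k" "\<And>x. h x \<le> k ^ 3" and K: "compact K" "\<And>x. x \<in> K \<Longrightarrow> 0 < h x"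
  shows "(\<integral>x. indicator K x * h x \<partial>lebesgue) \<le> 864 * k * (E + S)"
proof -
  obtain \<rho> where \<rho>: "\<And>x. x \<in> K \<Longrightarrow> 0 < \<rho> x \<and> \<rho> x \<le> h x / 2 \<and> (\<forall>y\<in>{x-\<rho> x<..<x+\<rho> x}. h y \<le> 3 * h x / 2) \<and>
    square x (\<rho> x) \<subseteq> Omega h \<and> (\<rho> x)\<^sup>2 \<le> 72 * E_on x (\<rho> x) \<and>
    (2 * \<rho> x = h x \<or> (h x)\<^sup>2 \<le> 4 * \<rho> x * S_on {x-\<rho> x<..<x+\<rho> x})"
    using bchoice[of K] local_scale K(2) by metis
  let ?J = "\<lambda>x. {x-\<rho> x<..<x+\<rho> x}"
  obtain F0 where F0: "F0 \<subseteq> K" "finite F0" "K \<subseteq> (\<Union>x\<in>F0. ?J x)"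
  proof (rule compactE_image[OF K(1), of K ?J])
    show "K \<subseteq> (\<Union>x\<in>K. ?J x)" using \<rho> by force
  qed (use that in auto)
  obtain F where FF0: "F \<subseteq> F0" "(\<Union>x\<in>F. ?J x) = (\<Union>x\<in>F0. ?J x)" and overlap: "\<And>y. card {x\<in>F. y \<in> ?J x} \<le> 2"
    using interval_subcover_overlap_two[OF F0(2), of "\<lambda>x. x - \<rho> x" "\<lambda>x. x + \<rho> x"] by blast
  have F: "finite F" "F \<subseteq> K" "K \<subseteq> (\<Union>x\<in>F. ?J x)"
    using finite_subset[OF FF0(1) F0(2)] subset_trans[OF FF0(1) F0(1)] F0(3)[folded FF0(2)] .
  have overlap': "(\<Sum>x\<in>F. indicator (?J x) y) \<le> (2::real)" for y
  proof -
    have "(\<Sum>x\<in>F. indicator (?J x) y) = real (card {x\<in>F. y \<in> ?J x})"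
      using F(1) by (simp add: indicator_def sum.If_cases Int_def)
    then show ?thesis using overlap[of y] by simp
  qed
  have local: "(\<integral>y. indicator (?J x) y * h y \<partial>lebesgue) \<le> 432 * k * (E_on x (\<rho> x) + S_on (?J x))" if "x \<in> F" for x
  proof -
    define r t where "r = \<rho> x" and "t = h x"
    note R = \<rho>[of x, folded r_def t_def]
    have x: "x \<in> K" using that F by blast
    have t: "0 < t" "t \<le> k ^ 3" using K(2)[OF x] k(2) by (auto simp: t_def)
    have r: "0 < r" "r \<le> t / 2" "\<And>y. y \<in> {x-r<..<x+r} \<Longrightarrow> h y \<le> 3 * t / 2" "r\<^sup>2 \<le> 72 * E_on x r"
      "2 * r = t \<or> t\<^sup>2 \<le> 4 * r * S_on {x-r<..<x+r}" using R[OF x] by auto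
    have nn: "0 \<le> S_on {x-r<..<x+r}" "0 \<le> E_on x r" by (simp_all add: S_on_def E_on_def)
    have "(\<integral>y. indicator {x-r<..<x+r} y * h y \<partial>lebesgue) \<le> (\<integral>y. (3 * t / 2) * indicator {x-r<..<x+r} y \<partial>lebesgue)"
    proof (rule integral_mono)
      show "integrable lebesgue (\<lambda>y. indicator {x-r<..<x+r} y * h y)"
        using integrable_mult_indicator[OF _ h_int, of "{x-r<..<x+r}"] by simp
      show "integrable lebesgue (\<lambda>y. (3 * t / 2) * indicator {x-r<..<x+r} y)"
        by (intro integrable_mult_right) (simp add: lmeasurable_iff_integrable[symmetric])
      show "indicator {x-r<..<x+r} y * h y \<le> (3 * t / 2) * indicator {x-r<..<x+r} y" for y
        using r(3)[of y] by (auto simp: indicator_def)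
    qed
    also have "\<dots> = 3 * (r * t)" using r(1) by simp
    also have "\<dots> \<le> 432 * k * (E_on x r + S_on {x-r<..<x+r})"
      using r(5)
    proof
      assume "2 * r = t"
      then have "3 * (r * t) = 6 * r\<^sup>2" by (simp add: power2_eq_square flip: \<open>2 * r = t\<close>)
      also have "\<dots> \<le> 432 * E_on x r" using r(4) by simp
      also have "\<dots> \<le> 432 * (1 * (E_on x r + S_on {x-r<..<x+r}))" using nn by simp
      also have "\<dots> \<le> 432 * (k * (E_on x r + S_on {x-r<..<x+r}))"
        using nn k(1) by (intro mult_left_mono mult_right_mono) auto
      finally show ?thesis by (simp add: mult.assoc)
    next
      assume tS: "t\<^sup>2 \<le> 4 * r * S_on {x-r<..<x+r}"
      have "r * t \<le> k * (r\<^sup>2 + t\<^sup>2 / r)"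
      proof (cases "t \<le> r * k")
        case True
        then have "r * t \<le> r * (r * k)" using r(1) by (intro mult_left_mono) auto
        also have "\<dots> \<le> k * (r\<^sup>2 + t\<^sup>2 / r)" using k(1) r(1) by (simp add: power2_eq_square distrib_left)
        finally show ?thesis .
      next
        case False
        \<comment> \<open>multiplying the bounds r < t / k and r \<le> k * k gives r * r \<le> k * t\<close>
        then have rk: "r * k < t" by simp
        have "r * k < k\<^sup>2 * k" using rk t(2) by (simp add: power2_eq_square power3_eq_cube)
        then have "r \<le> k\<^sup>2" using k(1) by simp
        then have "r * r * k \<le> k\<^sup>2 * t" using rk k(1) r(1) mult_mono[of r "k\<^sup>2" "r * k" t] by (simp add: mult.assoc)
        then have "r * r * k \<le> (k * t) * k" by (simp add: power2_eq_square ac_simps)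
        then have "r * r \<le> k * t" using k(1) by (intro mult_right_le_imp_le[of "r * r" k "k * t"]) auto
        then have "r * r * t \<le> k * t * t" using t(1) by (intro mult_right_mono) auto
        then have "r * t \<le> k * (t\<^sup>2 / r)" using r(1) by (simp add: field_simps power2_eq_square)
        also have "\<dots> \<le> k * (r\<^sup>2 + t\<^sup>2 / r)" using k(1) by (intro mult_left_mono) auto
        finally show ?thesis .
      qed
      also have "\<dots> \<le> k * (72 * E_on x r + 4 * S_on {x-r<..<x+r})"
        using r(1,4) tS k(1) by (intro mult_left_mono add_mono) (auto simp: field_simps)
      also have "\<dots> \<le> k * (144 * (E_on x r + S_on {x-r<..<x+r}))"
        using nn k(1) by (intro mult_left_mono) auto
      finally show ?thesis by (simp add: algebra_simps)
    qed
    finally show ?thesis by (simp add: r_def)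
  qed
  have hJ: "integrable lebesgue (\<lambda>y. indicator (?J x) y * h y)" for x
    using integrable_mult_indicator[OF _ h_int, of "?J x"] by simp
  have Kc: "closed K" using K(1) by (rule compact_imp_closed)
  have "(\<integral>y. indicator K y * h y \<partial>lebesgue) \<le> (\<integral>y. (\<Sum>x\<in>F. indicator (?J x) y * h y) \<partial>lebesgue)"
  proof (rule integral_mono)
    show "integrable lebesgue (\<lambda>y. indicator K y * h y)"
      using integrable_mult_indicator[OF _ h_int, of K] Kc by simp
    show "integrable lebesgue (\<lambda>y. \<Sum>x\<in>F. indicator (?J x) y * h y)"
      by (intro Bochner_Integration.integrable_sum hJ)
    show "indicator K y * h y \<le> (\<Sum>x\<in>F. indicator (?J x) y * h y)" for y
    proof (cases "y \<in> K")
      case True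
      then obtain x where x: "x \<in> F" "y \<in> ?J x" using F(3) by blast
      then have "indicator K y * h y = indicator (?J x) y * h y" using True by simp
      also have "\<dots> \<le> (\<Sum>x\<in>F. indicator (?J x) y * h y)"
        using x(1) F(1) h_nonneg by (intro member_le_sum) auto
      finally show ?thesis .
    next
      case False
      then show ?thesis using h_nonneg by (simp add: sum_nonneg)
    qed
  qed
  also have "\<dots> = (\<Sum>x\<in>F. \<integral>y. indicator (?J x) y * h y \<partial>lebesgue)"
    by (intro Bochner_Integration.integral_sum hJ)
  also have "\<dots> \<le> (\<Sum>x\<in>F. 432 * k * (E_on x (\<rho> x) + S_on (?J x)))"
    by (intro sum_mono local)
  also have "\<dots> = 432 * k * ((\<Sum>x\<in>F. E_on x (\<rho> x)) + (\<Sum>x\<in>F. S_on (?J x)))"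
    by (simp only: sum.distrib sum_distrib_left[symmetric])
  also have "\<dots> \<le> 432 * k * (2 * E + 2 * S)"
  proof (intro mult_left_mono add_mono)
    have "(\<Sum>x\<in>F. S_on (?J x)) = (\<integral>y. (\<Sum>x\<in>F. indicator (?J x) y * (g y)\<^sup>2) \<partial>lebesgue)"
      unfolding S_on_def by (intro Bochner_Integration.integral_sum[symmetric] S_on_integrable) simp
    also have "\<dots> \<le> (\<integral>y. 2 * (g y)\<^sup>2 \<partial>lebesgue)"
    proof (rule integral_mono)
      show "integrable lebesgue (\<lambda>y. \<Sum>x\<in>F. indicator (?J x) y * (g y)\<^sup>2)"
        by (intro Bochner_Integration.integrable_sum S_on_integrable) simp
      show "integrable lebesgue (\<lambda>y. 2 * (g y)\<^sup>2)" using g_sq_integrable by simp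
      show "(\<Sum>x\<in>F. indicator (?J x) y * (g y)\<^sup>2) \<le> 2 * (g y)\<^sup>2" for y
        unfolding sum_distrib_right[symmetric] by (intro mult_right_mono overlap') simp
    qed
    finally show "(\<Sum>x\<in>F. S_on (?J x)) \<le> 2 * S" by (simp add: S_def)
    let ?e = "\<lambda>p. indicator (Omega h) p * (norm (G p))\<^sup>2"
    have "E_on x (\<rho> x) = (\<integral>p. indicator (square x (\<rho> x)) p * ?e p \<partial>lebesgue)" if "x \<in> F" for x
      using that F(2) \<rho> by (intro E_on_eq) blast
    then have "(\<Sum>x\<in>F. E_on x (\<rho> x)) = (\<Sum>x\<in>F. \<integral>p. indicator (square x (\<rho> x)) p * ?e p \<partial>lebesgue)"
      by (intro sum.cong) auto
    also have "\<dots> = (\<integral>p. (\<Sum>x\<in>F. indicator (square x (\<rho> x)) p * ?e p) \<partial>lebesgue)"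
      by (intro Bochner_Integration.integral_sum[symmetric] E_on_integrable)
    also have "\<dots> \<le> (\<integral>p. 2 * ?e p \<partial>lebesgue)"
    proof (rule integral_mono)
      show "integrable lebesgue (\<lambda>p. \<Sum>x\<in>F. indicator (square x (\<rho> x)) p * ?e p)"
        by (intro Bochner_Integration.integrable_sum E_on_integrable)
      show "integrable lebesgue (\<lambda>p. 2 * ?e p)" using G_sq_integrable by simp
      fix p :: "real \<times> real"
      have "(\<Sum>x\<in>F. indicator (square x (\<rho> x)) p) \<le> (\<Sum>x\<in>F. indicator (?J x) (fst p) :: real)"
      proof (rule sum_mono)
        fix x assume "x \<in> F"
        then have "0 < \<rho> x" using \<rho> F(2) by blast
        then show "indicator (square x (\<rho> x)) p \<le> (indicator (?J x) (fst p) :: real)"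
          by (auto simp: indicator_def square_def)
      qed
      also have "\<dots> \<le> 2" by (rule overlap')
      finally show "(\<Sum>x\<in>F. indicator (square x (\<rho> x)) p * ?e p) \<le> 2 * ?e p"
        unfolding sum_distrib_right[symmetric] by (intro mult_right_mono) auto
    qed
    finally show "(\<Sum>x\<in>F. E_on x (\<rho> x)) \<le> 2 * E" by (simp add: E_eq)
  qed (use k(1) in auto)
  finally show ?thesis by (simp add: algebra_simps)
qed

text \<open>The sets \<open>{h \<ge> 1 / (n + 1)}\<close>, cut off to bounded intervals, exhaust \<open>{h > 0}\<close>.\<close>

lemma volume_bound:
  assumes k: "1 \<le> k" "\<And>x. h x \<le> k ^ 3"
  shows "(\<integral>x. h x \<partial>lebesgue) \<le> 864 * k * (E + S)"
proof -
  define K where "K n = {- real n..real n} \<inter> {x. inverse (real (Suc n)) \<le> h x}" for n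
  have clK: "closed (K n)" for n
    unfolding K_def by (intro closed_Int closed_Collect_le continuous_intros h_cont) auto
  have cK: "compact (K n)" for n
    using clK[of n] bounded_subset[of "{- real n..real n}" "K n"] by (auto simp: compact_eq_bounded_closed K_def)
  have le: "(\<integral>x. indicator (K n) x * h x \<partial>lebesgue) \<le> 864 * k * (E + S)" for n
  proof (rule volume_on_compact[OF k cK])
    show "0 < h x" if "x \<in> K n" for x
      using that less_le_trans[of 0 "inverse (real (Suc n))" "h x"] by (simp add: K_def)
  qed
  have "(\<lambda>n. \<integral>x. indicator (K n) x * h x \<partial>lebesgue) \<longlonglongrightarrow> (\<integral>x. h x \<partial>lebesgue)"
  proof (rule integral_dominated_convergence[where w=h])
    show "h \<in> borel_measurable lebesgue" "integrable lebesgue h" using h_int by auto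
    show "(\<lambda>x. indicator (K n) x * h x) \<in> borel_measurable lebesgue" for n
      using integrable_mult_indicator[OF _ h_int, of "K n"] clK by auto
    show "AE x in lebesgue. norm (indicator (K n) x * h x) \<le> h x" for n
      using h_nonneg by (intro AE_I2) (simp add: indicator_def)
    show "AE x in lebesgue. (\<lambda>n. indicator (K n) x * h x) \<longlonglongrightarrow> h x"
    proof (rule AE_I2)
      fix x
      show "(\<lambda>n. indicator (K n) x * h x) \<longlonglongrightarrow> h x"
      proof (cases "h x = 0")
        case False
        then have hx: "0 < h x" using h_nonneg[of x] by simp
        have "eventually (\<lambda>n. inverse (real (Suc n)) < h x) sequentially"
          using LIMSEQ_inverse_real_of_nat hx by (rule order_tendstoD(2))
        moreover have "eventually (\<lambda>n. \<bar>x\<bar> < real n) sequentially"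
          using filterlim_real_sequentially by (simp add: filterlim_at_top_dense)
        ultimately have "eventually (\<lambda>n. indicator (K n) x * h x = h x) sequentially"
          by eventually_elim (auto simp: K_def indicator_def)
        then show ?thesis by (rule tendsto_eventually)
      qed simp
    qed
  qed
  then show ?thesis by (rule LIMSEQ_le_const2) (use le in auto)
qed

text \<open>Near any point where \<open>h \<ge> t\<close> the Hoelder bound keeps \<open>h \<ge> t / 2\<close> on an interval of
  length independent of the point; far out the remaining volume is too small for such an interval.\<close>

lemma max_exists:
  assumes "0 < h x1"
  shows "\<exists>m. \<forall>x. h x \<le> h m"
proof -
  define t where "t = h x1"
  define \<delta> where "\<delta> = t\<^sup>2 / 4 / (S + 1)"
  have t: "0 < t" using assms by (simp add: t_def)
  have \<delta>: "0 < \<delta>" using t S_nonneg by (simp add: \<delta>_def)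
  have near: "t / 2 \<le> h y" if "t \<le> h x" "\<bar>y - x\<bar> < \<delta>" for x y
  proof (rule ccontr)
    assume "\<not> ?thesis"
    then have d: "t / 2 < h x - h y" using that(1) by simp
    then have "x \<noteq> y" using t by auto
    have "(t / 2)\<^sup>2 < (h x - h y)\<^sup>2" using d t by (intro power_strict_mono) auto
    also have "\<dots> \<le> \<bar>y - x\<bar> * S_on {min x y<..<max x y}"
      using h_Hoelder[OF \<open>x \<noteq> y\<close>] by (simp add: power2_commute)
    also have "\<dots> \<le> \<delta> * (S + 1)"
      using that(2) S_on_le[of "{min x y<..<max x y}"] \<delta> by (intro mult_mono) (auto simp: S_on_def)
    also have "\<dots> = t\<^sup>2 / 4"
    proof -
      have "c / q * q = c" if "q \<noteq> 0" for c q :: real using that by simp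
      from this[of "S + 1" "t\<^sup>2 / 4"] show ?thesis unfolding \<delta>_def using S_nonneg by linarith
    qed
    finally show False by (simp add: power2_eq_square)
  qed
  have lim: "(\<lambda>n. \<integral>x. indicator {x. real n \<le> \<bar>x\<bar>} x * h x \<partial>lebesgue) \<longlonglongrightarrow> (\<integral>x. 0 \<partial>(lebesgue :: real measure))"
  proof (rule integral_dominated_convergence[where w=h])
    have [simp]: "closed {x::real. real n \<le> \<bar>x\<bar>}" for n by (intro closed_Collect_le continuous_intros)
    show "(\<lambda>x. indicator {x. real n \<le> \<bar>x\<bar>} x * h x) \<in> borel_measurable lebesgue" for n
      using integrable_mult_indicator[OF _ h_int, of "{x. real n \<le> \<bar>x\<bar>}"] by auto
    show "AE x in lebesgue. norm (indicator {x. real n \<le> \<bar>x\<bar>} x * h x) \<le> h x" for n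
      using h_nonneg by (intro AE_I2) (simp add: indicator_def)
    show "AE x in lebesgue. (\<lambda>n. indicator {x. real n \<le> \<bar>x\<bar>} x * h x) \<longlonglongrightarrow> 0"
    proof (rule AE_I2)
      fix x :: real
      have "eventually (\<lambda>n. \<bar>x\<bar> < real n) sequentially"
        using filterlim_real_sequentially by (simp add: filterlim_at_top_dense)
      then have "eventually (\<lambda>n. indicator {x. real n \<le> \<bar>x\<bar>} x * h x = 0) sequentially"
        by eventually_elim (auto simp: indicator_def)
      then show "(\<lambda>n. indicator {x. real n \<le> \<bar>x\<bar>} x * h x) \<longlonglongrightarrow> 0" by (rule tendsto_eventually)
    qed
  qed (use h_int in auto)
  have "eventually (\<lambda>n. (\<integral>x. indicator {x. real n \<le> \<bar>x\<bar>} x * h x \<partial>lebesgue) < \<delta> * t) sequentially"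
    using lim \<delta> t by (intro order_tendstoD(2)[OF lim]) simp
  then obtain n where n: "(\<integral>x. indicator {x. real n \<le> \<bar>x\<bar>} x * h x \<partial>lebesgue) < \<delta> * t"
    by (auto simp: eventually_sequentially)
  have far: "h x < t" if x: "real n + \<delta> < \<bar>x\<bar>" for x
  proof (rule ccontr)
    assume "\<not> ?thesis"
    then have hx: "t \<le> h x" by simp
    have "(\<integral>y. (t / 2) * indicator {x-\<delta><..<x+\<delta>} y \<partial>lebesgue) \<le> (\<integral>y. indicator {x. real n \<le> \<bar>x\<bar>} y * h y \<partial>lebesgue)"
    proof (rule integral_mono)
      show "integrable lebesgue (\<lambda>y. (t / 2) * indicator {x-\<delta><..<x+\<delta>} y)"
        by (intro integrable_mult_right) (simp add: lmeasurable_iff_integrable[symmetric])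
      have "closed {x::real. real n \<le> \<bar>x\<bar>}" by (intro closed_Collect_le continuous_intros)
      then show "integrable lebesgue (\<lambda>y. indicator {x. real n \<le> \<bar>x\<bar>} y * h y)"
        using integrable_mult_indicator[OF _ h_int, of "{x. real n \<le> \<bar>x\<bar>}"] by simp
      show "(t / 2) * indicator {x-\<delta><..<x+\<delta>} y \<le> indicator {x. real n \<le> \<bar>x\<bar>} y * h y" for y
      proof (cases "y \<in> {x-\<delta><..<x+\<delta>}")
        case True
        then have "\<bar>y - x\<bar> < \<delta>" by auto
        moreover have "real n \<le> \<bar>y\<bar>" using calculation x by linarith
        ultimately show ?thesis using near[OF hx] True by simp
      next
        case False
        then show ?thesis using h_nonneg by simp
      qed
    qed
    moreover have "(\<integral>y. (t / 2) * indicator {x-\<delta><..<x+\<delta>} y \<partial>lebesgue) = \<delta> * t" using \<delta> by simp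
    ultimately show False using n by linarith
  qed
  define L where "L = max (real n + \<delta>) \<bar>x1\<bar>"
  have "\<exists>m\<in>{-L..L}. \<forall>x\<in>{-L..L}. h x \<le> h m"
    by (rule continuous_attains_sup) (auto simp: L_def intro: continuous_on_subset[OF h_cont])
  then obtain m where m: "\<And>x. x \<in> {-L..L} \<Longrightarrow> h x \<le> h m" by blast
  have "h x \<le> h m" for x
  proof (cases "x \<in> {-L..L}")
    case False
    then have "real n + \<delta> < \<bar>x\<bar>" by (auto simp: L_def)
    then have "h x < h x1" using far by (simp add: t_def)
    also have "\<dots> \<le> h m" by (rule m) (auto simp: L_def)
    finally show ?thesis by simp
  qed (rule m)
  then show ?thesis by blast
qed

end


section \<open>The lower bounds\<close>

lemma admissible_droplet:
  assumes "(u, h) \<in> admissible V"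
  obtains g G where "droplet u h g G" "E_energy u h = droplet.E h G" "S_energy h = droplet.S g"
    "(\<integral>x. h x \<partial>lebesgue) = V"
proof -
  have adm: "in_H1 UNIV h" "continuous_on UNIV h" "\<And>x. 0 \<le> h x" "in_H1 (Omega h) u"
    "has_bochner_integral lebesgue h V" "has_trace_on_supp h u (\<lambda>x. x)"
    using assms by (auto simp: admissible_def)
  interpret droplet u h "weak_gradient UNIV h" "weak_gradient (Omega h) u"
    using adm weak_gradient_spec[OF adm(1)] weak_gradient_spec[OF adm(4)]
    by unfold_locales (auto simp: has_bochner_integral_iff)
  show ?thesis
    by (rule that[OF droplet_axioms])
       (use adm(5) in \<open>simp_all add: E_energy_def dirichlet_def E_def S_energy_def S_def has_bochner_integral_iff\<close>)
qed

lemma power_le_cancel: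
  fixes a b :: real
  assumes "a ^ n \<le> b ^ n" "0 \<le> b" "0 < n"
  shows "a \<le> b"
proof (rule ccontr)
  assume "\<not> a \<le> b"
  then have "b ^ n < a ^ n" using assms(2,3) by (intro power_strict_mono) auto
  then show False using assms(1) by simp
qed

context droplet begin

text \<open>The cube root of the maximal height is the value of \<open>k\<close> used in \<open>volume_bound\<close>. Both
  alternatives of \<open>height_bound\<close> imply \<open>H\<^sup>4 \<le> (288 A)\<^sup>3\<close>, the first one because \<open>H \<ge> 1\<close> forces
  \<open>288 A \<ge> 1\<close>.\<close>

lemma scaling_bound:
  assumes "\<And>x. h x \<le> H" "h m = H" "1 \<le> H"
  shows "root 3 H ^ 4 \<le> 288 * (E + S)"
proof -
  let ?A = "E + S"
  have A: "0 \<le> ?A" using E_nonneg S_nonneg by simp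
  have k3: "root 3 H ^ 3 = H" using assms(3) by simp
  have k1: "1 \<le> root 3 H" using assms(3) by simp
  have "H ^ 4 \<le> (288 * ?A) ^ 3"
    using height_bound[of m]
  proof
    assume "(h m)\<^sup>2 \<le> 288 * ?A"
    then have H2: "H\<^sup>2 \<le> 288 * ?A" by (simp add: assms(2))
    then have "1 \<le> 288 * ?A" using assms(3) one_le_power[of H 2] by linarith
    have "H ^ 4 = (H\<^sup>2)\<^sup>2" by simp
    also have "\<dots> \<le> (288 * ?A)\<^sup>2" using H2 by (intro power_mono) auto
    also have "\<dots> \<le> (288 * ?A) ^ 3" using \<open>1 \<le> 288 * ?A\<close> by (intro power_increasing) auto
    finally show ?thesis .
  next
    assume "h m ^ 4 \<le> 1152 * ?A ^ 3"
    then have "H ^ 4 \<le> 1152 * ?A ^ 3" by (simp add: assms(2))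
    also have "\<dots> \<le> 288 ^ 3 * ?A ^ 3" using A by (intro mult_right_mono) auto
    finally show ?thesis by (simp only: power_mult_distrib)
  qed
  also have "H ^ 4 = (root 3 H ^ 4) ^ 3"
    using k3 by (metis power_mult mult.commute)
  finally show ?thesis by (rule power_le_cancel) (use A in simp_all)
qed

end

lemma powr_four_fifths: "0 < V \<Longrightarrow> (V powr (4/5)) ^ 5 = V ^ 4" for V :: real
  by (simp add: powr_power powr_numeral)

lemma energy_lower_bound:
  assumes V: "0 < V" and adm: "(u, h) \<in> admissible V"
  shows "min V (V powr (4/5)) \<le> 864 * (E_energy u h + S_energy h)"
    and "\<exists>m. (\<forall>x. h x \<le> h m) \<and> (V \<le> 864 * (E_energy u h + S_energy h) \<or>
          V \<le> 864 * root 3 (h m) * (E_energy u h + S_energy h))"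
proof -
  from adm obtain g G where d: "droplet u h g G" and e: "E_energy u h = droplet.E h G" "S_energy h = droplet.S g"
    and vol: "(\<integral>x. h x \<partial>lebesgue) = V" by (rule admissible_droplet)
  interpret droplet u h g G by (rule d)
  have "\<exists>x. 0 < h x"
  proof (rule ccontr)
    assume "\<nexists>x. 0 < h x"
    then have "h x = 0" for x using h_nonneg[of x] by (meson not_le order.antisym)
    then show False using vol V by simp
  qed
  then obtain m where m: "\<And>x. h x \<le> h m" using max_exists by blast
  define H A where "H = h m" and "A = E + S"
  have A: "0 \<le> A" using E_nonneg S_nonneg by (simp add: A_def)
  have small: "V \<le> 864 * A" if "H \<le> 1"
  proof -
    have "h x \<le> 1 ^ 3" for x using m[of x] that by (simp add: H_def)
    from volume_bound[OF order_refl this] show ?thesis by (simp add: vol A_def)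
  qed
  have large: "V \<le> 864 * root 3 H * A" if "1 \<le> H"
  proof -
    have "h x \<le> root 3 H ^ 3" for x using m[of x] that by (simp add: H_def)
    moreover have "1 \<le> root 3 H" using that by simp
    ultimately have "(\<integral>x. h x \<partial>lebesgue) \<le> 864 * root 3 H * (E + S)" by (intro volume_bound)
    then show ?thesis by (simp only: vol A_def)
  qed
  show "\<exists>m. (\<forall>x. h x \<le> h m) \<and> (V \<le> 864 * (E_energy u h + S_energy h) \<or>
          V \<le> 864 * root 3 (h m) * (E_energy u h + S_energy h))"
    using m small large unfolding e A_def[symmetric] H_def[symmetric] by (intro exI[of _ m]) (cases "H \<le> 1"; simp add: H_def)
  show "min V (V powr (4/5)) \<le> 864 * (E_energy u h + S_energy h)"
    unfolding e A_def[symmetric]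
  proof (cases "H \<le> 1")
    case True
    then show "min V (V powr (4/5)) \<le> 864 * A" using small by simp
  next
    case False
    then have H1: "1 \<le> H" by simp
    have k4: "root 3 H ^ 4 \<le> 288 * A"
      unfolding A_def by (rule scaling_bound[OF _ _ H1]) (use m in \<open>auto simp: H_def\<close>)
    have "V ^ 4 \<le> (864 * root 3 H * A) ^ 4" using V by (intro power_mono large H1) auto
    also have "\<dots> = 864 ^ 4 * A ^ 4 * root 3 H ^ 4" by (simp only: power_mult_distrib ac_simps)
    also have "\<dots> \<le> 864 ^ 4 * A ^ 4 * (288 * A)" using A by (intro mult_left_mono k4) auto
    also have "\<dots> \<le> 864 ^ 4 * A ^ 4 * (864 * A)" using A by (intro mult_left_mono mult_right_mono) auto
    also have "\<dots> = (864 * A) ^ 5" by (simp add: power_mult_distrib power_numeral_reduce)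
    finally have "(V powr (4/5)) ^ 5 \<le> (864 * A) ^ 5" using powr_four_fifths[OF V] by simp
    then have "V powr (4/5) \<le> 864 * A" by (rule power_le_cancel) (use A in simp_all)
    then show "min V (V powr (4/5)) \<le> 864 * A" by simp
  qed
qed

text \<open>With \<open>q\<close> the fifth root of \<open>V\<close>, the energy is at most a multiple of \<open>q\<^sup>4\<close> while the volume is
  \<open>q\<^sup>5\<close>. The bound \<open>V \<le> 864 A\<close> would force \<open>q \<le> 864 / c\<close>, so for large \<open>V\<close> the bound that involves the height
  must hold.\<close>

lemma height_lower_bound:
  assumes c: "0 < c" and V: "(864 / c) ^ 5 < V" and adm: "(u, h) \<in> admissible V"
    and energy: "E_energy u h + S_energy h \<le> 1 / c * V powr (4/5)"
  shows "\<exists>m. (\<forall>x. h x \<le> h m) \<and> (c / 864) ^ 3 * V powr (3/5) \<le> h m"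
proof -
  have V0: "0 < V" using V c by (meson less_trans zero_less_divide_iff zero_less_power zero_less_numeral)
  define A q where "A = E_energy u h + S_energy h" and "q = V powr (1/5)"
  have q: "0 < q" "V = q ^ 5" "V powr (4/5) = q ^ 4" "V powr (3/5) = q ^ 3"
    using V0 by (simp_all add: q_def powr_power)
  have Ale: "864 * A \<le> 864 / c * q ^ 4" using energy by (simp add: A_def q(3))
  obtain m where m: "\<And>x. h x \<le> h m" "V \<le> 864 * A \<or> V \<le> 864 * root 3 (h m) * A"
    using energy_lower_bound(2)[OF V0 adm] unfolding A_def by blast
  have not_small: "\<not> V \<le> 864 * A"
  proof
    assume "V \<le> 864 * A"
    then have "q * q ^ 4 \<le> 864 / c * q ^ 4" using Ale unfolding q(2) by (simp add: power_numeral_reduce)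
    then have "q \<le> 864 / c" using q(1) by (simp only: mult_le_cancel_right_pos zero_less_power)
    then have "q ^ 5 \<le> (864 / c) ^ 5" using q(1) by (intro power_mono) auto
    then show False using V unfolding q(2) by simp
  qed
  with m(2) have large: "V \<le> root 3 (h m) * (864 * A)" by (simp add: mult.commute mult.left_commute)
  have hm: "0 \<le> h m" using adm by (simp add: admissible_def)
  have "q * q ^ 4 \<le> root 3 (h m) * (864 / c * q ^ 4)"
    using large mult_left_mono[OF Ale, of "root 3 (h m)"] hm unfolding q(2) by (simp add: power_numeral_reduce)
  then have "q * q ^ 4 \<le> (root 3 (h m) * (864 / c)) * q ^ 4" by (simp only: mult.assoc)
  then have "q \<le> root 3 (h m) * (864 / c)" using q(1) by (simp only: mult_le_cancel_right_pos zero_less_power)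
  then have "c / 864 * q \<le> root 3 (h m)" using c by (simp add: field_simps)
  then have "(c / 864 * q) ^ 3 \<le> root 3 (h m) ^ 3" using c q(1) by (intro power_mono) auto
  then have "(c / 864) ^ 3 * q ^ 3 \<le> root 3 (h m) ^ 3" by (simp only: power_mult_distrib)
  then have "(c / 864) ^ 3 * q ^ 3 \<le> h m" using hm by simp
  then show ?thesis using m(1) unfolding q(4) by blast
qed


section \<open>The competitor and the upper bound\<close>

lemma smooth_dirichlet:
  assumes "smooth f" "open S" "bounded S"
  shows "in_H1 S f" "dirichlet S f = integral\<^sup>L (lebesgue_on S) (\<lambda>p. (norm (grad f p))\<^sup>2)"
proof -
  have s: "S \<in> sets lebesgue" using assms(2) by simp
  have f: "in_L2 S f" by (rule continuous_in_L2[OF smooth_imp_continuous[OF assms(1)] assms(3) s])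
  have g: "in_L2 S (grad f)" by (rule continuous_in_L2[OF continuous_grad[OF assms(1)] assms(3) s])
  have w: "is_weak_gradient S f (grad f)" by (rule is_weak_gradient_smooth[OF assms(2,1)])
  show "in_H1 S f" using f g w by (auto simp: in_H1_def)
  show "dirichlet S f = integral\<^sup>L (lebesgue_on S) (\<lambda>p. (norm (grad f p))\<^sup>2)"
    unfolding dirichlet_def by (rule integral_weak_gradient_eq[OF assms(2) g w])
qed

lemma H1_norm_zero:
  assumes "open S" shows "H1_norm S (\<lambda>_. 0) = 0"
proof -
  have "dirichlet S (\<lambda>_. 0) = integral\<^sup>L (lebesgue_on S) (\<lambda>p. (norm (0::'a))\<^sup>2)"
    unfolding dirichlet_def
    by (rule integral_weak_gradient_eq[OF assms, of "\<lambda>_. 0"]) (simp_all add: in_L2_def is_weak_gradient_def)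
  then show ?thesis by (simp add: H1_norm_def)
qed

text \<open>A smooth function is its own approximating sequence.\<close>

lemma smooth_has_bottom_trace:
  assumes "smooth u" "\<And>x. u (x, 0) = g x" "continuous_on UNIV g"
  shows "has_bottom_trace a b d u g"
  unfolding has_bottom_trace_def
proof (intro conjI exI[of _ "\<lambda>_. u"] allI)
  have o: "open ({a<..<b} \<times> {0<..<d})" by (intro open_Times) auto
  show "in_H1 ({a<..<b} \<times> {0<..<d}) u"
    by (rule smooth_dirichlet(1)[OF assms(1) o]) (simp add: bounded_Times)
  show "in_L2 {a<..<b} g" by (rule continuous_in_L2[OF assms(3)]) auto
  show "(\<lambda>n. H1_norm ({a<..<b} \<times> {0<..<d}) (\<lambda>p. u p - u p)) \<longlonglongrightarrow> 0"
    using H1_norm_zero[OF o] by simp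
  show "(\<lambda>n. integral\<^sup>L (lebesgue_on {a<..<b}) (\<lambda>x. (u (x, 0) - g x)\<^sup>2)) \<longlonglongrightarrow> 0"
    using assms(2) by simp
qed (rule assms(1))

lemma grad_eqI:
  assumes "(f has_derivative (\<lambda>h. v \<bullet> h)) (at x)" shows "grad f x = v"
proof -
  have "frechet_derivative f (at x) = (\<lambda>h. v \<bullet> h)" using frechet_derivative_at[OF assms] by simp
  then show ?thesis by (simp add: grad_def euclidean_representation)
qed

text \<open>An extension of the boundary value \<open>x\<close> that decays at the length scale \<open>L\<close> of the base. It is
  smooth on the whole plane, so that its weak gradient and its trace are the classical ones on every
  domain under a tent.\<close>

definition decaying_potential :: "real \<Rightarrow> real \<times> real \<Rightarrow> real" where
  "decaying_potential L p = fst p * exp (- snd p / L)"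

lemma smooth_decaying_potential: "smooth (decaying_potential L)"
  unfolding smooth_def
proof
  fix k
  have id: "C_diff k (\<lambda>t::real. t)" for k
  proof (cases k)
    case (Suc n)
    show ?thesis unfolding Suc by (rule C_diff_SucI[OF has_derivative_ident C_diff_const])
  qed simp
  have exp: "C_diff k (exp :: real \<Rightarrow> real)" for k
  proof (induction k)
    case 0
    show ?case by (simp add: continuous_on_exp)
  next
    case (Suc k)
    show ?case
    proof (rule C_diff_SucI)
      show "((exp :: real \<Rightarrow> real) has_derivative (\<lambda>h. exp t * h)) (at t)" for t
        using DERIV_exp by (simp add: has_field_derivative_def)
      show "C_diff k (\<lambda>t. exp t * b)" for b :: real by (rule C_diff_mult[OF Suc C_diff_const])
    qed
  qed
  have "C_diff k (\<lambda>p::real \<times> real. (p \<bullet> (1, 0) + 0) * exp (p \<bullet> (0, - 1 / L) + 0))"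
    by (rule C_diff_mult[OF C_diff_affine_compose[OF id] C_diff_affine_compose[OF exp]])
  moreover have "(\<lambda>p::real \<times> real. (p \<bullet> (1, 0) + 0) * exp (p \<bullet> (0, - 1 / L) + 0)) = decaying_potential L"
    by (auto simp: fun_eq_iff decaying_potential_def)
  ultimately show "C_diff k (decaying_potential L)" by simp
qed

lemma grad_decaying_potential:
  "grad (decaying_potential L) p = (exp (- snd p / L), - (fst p / L) * exp (- snd p / L))"
proof (rule grad_eqI)
  have e: "((\<lambda>p. exp (- snd p / L)) has_derivative (\<lambda>h. exp (- snd p / L) * (- snd h / L))) (at p)"
    by (auto intro!: derivative_eq_intros simp: divide_inverse)
  have "(decaying_potential L has_derivative
      (\<lambda>h. fst p * (exp (- snd p / L) * (- snd h / L)) + fst h * exp (- snd p / L))) (at p)"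
    unfolding decaying_potential_def[abs_def]
    by (rule has_derivative_mult[OF bounded_linear_imp_has_derivative[OF bounded_linear_fst] e])
  moreover have "(\<lambda>h. fst p * (exp (- snd p / L) * (- snd h / L)) + fst h * exp (- snd p / L))
      = (\<lambda>h. (exp (- snd p / L), - (fst p / L) * exp (- snd p / L)) \<bullet> h)"
    by (auto simp: fun_eq_iff inner_prod_def algebra_simps)
  ultimately show "(decaying_potential L has_derivative
      (\<lambda>h. (exp (- snd p / L), - (fst p / L) * exp (- snd p / L)) \<bullet> h)) (at p)" by simp
qed

text \<open>On the box the squared gradient is at most \<open>2 exp (- 2 y / L)\<close>. Its integral is
  \<open>2 L\<^sup>2 (1 - exp (- 2 a / L))\<close>, and the last factor is at most both \<open>1\<close> and \<open>2 a / L\<close>.\<close>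

lemma decaying_potential_energy:
  assumes L: "0 < L" and a: "0 < a" and sub: "S \<subseteq> box (- L, 0) (L, a)" and S: "open S"
  shows "dirichlet S (decaying_potential L) \<le> 2 * L\<^sup>2"
    and "dirichlet S (decaying_potential L) \<le> 4 * (a * L)"
proof -
  let ?R = "box (- L, 0) (L, a)"
  let ?e = "\<lambda>p::real \<times> real. 2 * exp (- (2 / L) * snd p)"
  have bS: "bounded S" using sub bounded_subset[OF bounded_box] by blast
  have SS: "S \<in> sets lebesgue" using S by simp
  have RS: "?R \<in> sets lebesgue" by simp
  have pt: "(norm (grad (decaying_potential L) p))\<^sup>2 \<le> ?e p" if "p \<in> ?R" for p
  proof -
    have "\<bar>fst p\<bar> \<le> L" using that by (cases p) (auto simp: box_def Basis_prod_def)
    then have "\<bar>fst p / L\<bar> \<le> 1" using L by simp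
    then have "(fst p / L)\<^sup>2 \<le> 1" by (metis abs_square_le_1)
    then have "(1 + (fst p / L)\<^sup>2) * (exp (- snd p / L))\<^sup>2 \<le> 2 * (exp (- snd p / L))\<^sup>2"
      by (intro mult_right_mono) auto
    moreover have "(exp (- snd p / L))\<^sup>2 = exp (- (2 / L) * snd p)"
      by (simp add: power2_eq_square flip: exp_add)
    moreover have "(norm (grad (decaying_potential L) p))\<^sup>2 = (1 + (fst p / L)\<^sup>2) * (exp (- snd p / L))\<^sup>2"
    proof -
      have "(norm (s, t))\<^sup>2 = s\<^sup>2 + t\<^sup>2" for s t :: real by (simp add: norm_Pair)
      then show ?thesis
        unfolding grad_decaying_potential by (simp only: power_mult_distrib power2_minus distrib_right mult_1)
    qed
    ultimately show ?thesis by simp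
  qed
  have ce: "continuous_on A ?e" for A by (intro continuous_intros)
  have cg: "continuous_on UNIV (\<lambda>p. (norm (grad (decaying_potential L) p))\<^sup>2)"
    by (intro continuous_intros continuous_grad smooth_decaying_potential)
  have "dirichlet S (decaying_potential L) = integral\<^sup>L (lebesgue_on S) (\<lambda>p. (norm (grad (decaying_potential L) p))\<^sup>2)"
    by (rule smooth_dirichlet(2)[OF smooth_decaying_potential S bS])
  also have "\<dots> = (\<integral>p. indicator S p *\<^sub>R (norm (grad (decaying_potential L) p))\<^sup>2 \<partial>lebesgue)"
    by (rule integral_lebesgue_on[OF SS])
  also have "\<dots> \<le> (\<integral>p. indicator ?R p *\<^sub>R ?e p \<partial>lebesgue)"
  proof (rule integral_mono)
    show "integrable lebesgue (\<lambda>p. indicator S p *\<^sub>R (norm (grad (decaying_potential L) p))\<^sup>2)"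
      unfolding integrable_lebesgue_on[OF SS, symmetric] by (rule continuous_integrable_on_bounded[OF cg bS SS])
    show "integrable lebesgue (\<lambda>p. indicator ?R p *\<^sub>R ?e p)"
      unfolding integrable_lebesgue_on[OF RS, symmetric] by (rule continuous_integrable_on_bounded[OF ce bounded_box RS])
    show "indicator S p *\<^sub>R (norm (grad (decaying_potential L) p))\<^sup>2 \<le> indicator ?R p *\<^sub>R ?e p" for p
      using pt[of p] sub by (auto simp: indicator_def)
  qed
  also have "\<dots> = integral\<^sup>L (lebesgue_on ?R) ?e"
    by (rule integral_lebesgue_on[symmetric]) simp
  also have "\<dots> = integral (cbox (- L, 0) (L, a)) ?e" by (rule integral_box_continuous[OF ce])
  also have "\<dots> = integral (cbox (- L) L) (\<lambda>x. integral (cbox 0 a) (\<lambda>y. ?e (x, y)))"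
    by (rule integral_prod_continuous[OF ce])
  also have "\<dots> = 2 * L * (L * (1 - exp (- (2 / L) * a)))"
  proof -
    have "((\<lambda>y. 2 * exp (- (2 / L) * y)) has_integral (- L * exp (- (2 / L) * a) - - L * exp (- (2 / L) * 0))) {0..a}"
    proof (rule fundamental_theorem_of_calculus)
      show "((\<lambda>y. - L * exp (- (2 / L) * y)) has_vector_derivative 2 * exp (- (2 / L) * y)) (at y within {0..a})" for y
        unfolding has_real_derivative_iff_has_vector_derivative[symmetric]
        by (rule DERIV_subset[of _ _ _ UNIV]) (use L in \<open>auto intro!: derivative_eq_intros\<close>)
    qed (use a in simp)
    then have "integral {0..a} (\<lambda>y. 2 * exp (- (2 / L) * y)) = - L * exp (- (2 / L) * a) - - L * exp (- (2 / L) * 0)"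
      by (rule integral_unique)
    also have "\<dots> = L * (1 - exp (- (2 / L) * a))" by (simp add: algebra_simps)
    finally have "integral {0..a} (\<lambda>y. 2 * exp (- (2 / L) * y)) = L * (1 - exp (- (2 / L) * a))" .
    then have "integral (cbox 0 a) (\<lambda>y. ?e (x, y)) = L * (1 - exp (- (2 / L) * a))" for x :: real
      by (simp only: snd_conv interval_cbox)
    then have "integral (cbox (- L) L) (\<lambda>x. integral (cbox 0 a) (\<lambda>y. ?e (x, y)))
        = integral (cbox (- L) L) (\<lambda>x. L * (1 - exp (- (2 / L) * a)))" by (simp only:)
    also have "\<dots> = 2 * L * (L * (1 - exp (- (2 / L) * a)))" using L by simp
    finally show ?thesis .
  qed
  finally have main: "dirichlet S (decaying_potential L) \<le> 2 * L * (L * (1 - exp (- (2 / L) * a)))" .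
  have "L * (1 - exp (- (2 / L) * a)) \<le> L * 1" using L by (intro mult_left_mono) auto
  then have "2 * L * (L * (1 - exp (- (2 / L) * a))) \<le> 2 * L * (L * 1)" using L by (intro mult_left_mono) auto
  then show "dirichlet S (decaying_potential L) \<le> 2 * L\<^sup>2" using main by (simp add: power2_eq_square)
  have "1 - exp (- (2 / L) * a) \<le> (2 / L) * a" using exp_ge_add_one_self[of "- (2 / L) * a"] by linarith
  then have "L * (1 - exp (- (2 / L) * a)) \<le> L * ((2 / L) * a)" using L by (intro mult_left_mono) auto
  then have "2 * L * (L * (1 - exp (- (2 / L) * a))) \<le> 2 * L * (L * ((2 / L) * a))"
    by (rule mult_left_mono) (use L in simp)
  also have "2 * L * (L * ((2 / L) * a)) = 4 * (a * L)" using L by simp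
  finally show "dirichlet S (decaying_potential L) \<le> 4 * (a * L)" by (rule order_trans[OF main])
qed

definition tent :: "real \<Rightarrow> real \<Rightarrow> real \<Rightarrow> real" where
  "tent a L x = max 0 (a * (1 - \<bar>x\<bar> / L))"

definition tent_slope :: "real \<Rightarrow> real \<Rightarrow> real \<Rightarrow> real" where
  "tent_slope a L x = a / L * (indicator {-L<..<0} x - indicator {0<..<L} x)"

lemma continuous_tent: "continuous_on A (tent a L)"
  unfolding tent_def[abs_def] divide_inverse by (intro continuous_intros)

lemma tent_nonneg: "0 \<le> tent a L x" by (simp add: tent_def)

lemma tent_eq_0: "0 < L \<Longrightarrow> 0 < a \<Longrightarrow> L \<le> \<bar>x\<bar> \<Longrightarrow> tent a L x = 0"
  by (simp add: tent_def mult_le_0_iff)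

lemma tent_eq: "0 < L \<Longrightarrow> 0 < a \<Longrightarrow> \<bar>x\<bar> \<le> L \<Longrightarrow> tent a L x = a * (1 - \<bar>x\<bar> / L)"
  by (simp add: tent_def)

lemma tent_Lipschitz:
  assumes "0 < L" "0 < a" shows "\<bar>tent a L x - tent a L y\<bar> \<le> a / L * norm (x - y)"
proof -
  have "\<bar>tent a L x - tent a L y\<bar> \<le> \<bar>a * (1 - \<bar>x\<bar> / L) - a * (1 - \<bar>y\<bar> / L)\<bar>"
    unfolding tent_def by linarith
  also have "\<dots> = a / L * \<bar>\<bar>y\<bar> - \<bar>x\<bar>\<bar>"
  proof -
    have "a * (1 - \<bar>x\<bar> / L) - a * (1 - \<bar>y\<bar> / L) = a / L * (\<bar>y\<bar> - \<bar>x\<bar>)" by (simp add: algebra_simps diff_divide_distrib)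
    then show ?thesis using assms by (simp only: abs_mult abs_of_pos[OF divide_pos_pos[OF assms(2,1)]])
  qed
  also have "\<dots> \<le> a / L * norm (x - y)"
    using assms by (intro mult_left_mono) auto
  finally show ?thesis .
qed

lemma tent_has_derivative:
  assumes "0 < L" "0 < a" "x \<notin> {-L, 0, L}"
  shows "(tent a L has_derivative (\<lambda>t. tent_slope a L x \<bullet> t)) (at x)"
proof -
  have "\<exists>T c. open T \<and> x \<in> T \<and> (\<forall>y\<in>T. c + tent_slope a L x * y = tent a L y)"
  proof -
    consider "\<bar>x\<bar> > L" | "-L < x" "x < 0" | "0 < x" "x < L" using assms by fastforce
    then show ?thesis
    proof cases
      case 1
      then show ?thesis using assms tent_eq_0[OF assms(1,2)]
        by (intro exI[of _ "{y. L < \<bar>y\<bar>}"] exI[of _ 0])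
           (auto simp: tent_slope_def indicator_def intro!: open_Collect_less continuous_intros)
    next
      case 2
      then show ?thesis using assms
        by (intro exI[of _ "{-L<..<0}"] exI[of _ a]) (auto simp: tent_slope_def tent_eq algebra_simps)
    next
      case 3
      then show ?thesis using assms
        by (intro exI[of _ "{0<..<L}"] exI[of _ a]) (auto simp: tent_slope_def tent_eq algebra_simps)
    qed
  qed
  then obtain T c where T: "open T" "x \<in> T" "\<And>y. y \<in> T \<Longrightarrow> c + tent_slope a L x * y = tent a L y" by blast
  have "((\<lambda>y. c + tent_slope a L x * y) has_derivative (\<lambda>t. tent_slope a L x \<bullet> t)) (at x)"
    by (auto intro!: derivative_eq_intros)
  then show ?thesis by (rule has_derivative_transform_within_open[OF _ T])
qed

lemma tent_slope_measurable: "tent_slope a L \<in> borel_measurable lebesgue"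
  unfolding tent_slope_def[abs_def]
  by (intro borel_measurable_times borel_measurable_diff borel_measurable_indicator borel_measurable_const) auto

lemma tent_weak_gradient:
  assumes "0 < L" "0 < a"
  shows "is_weak_gradient UNIV (tent a L) (tent_slope a L)"
proof (rule is_weak_gradient_if_locally_Lipschitz)
  show "\<exists>M. \<forall>x\<in>cball 0 R. \<forall>y\<in>cball 0 R. \<bar>tent a L x - tent a L y\<bar> \<le> M * norm (x - y)" for R
    using tent_Lipschitz[OF assms] by blast
  have "AE x in lebesgue. x \<notin> {-L, 0, L}"
    by (intro AE_not_in) (simp add: negligible_iff_null_sets[symmetric])
  then show "AE x in lebesgue. (tent a L has_derivative (\<lambda>t. tent_slope a L x \<bullet> t)) (at x)"
    by eventually_elim (rule tent_has_derivative[OF assms])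
qed (simp_all add: continuous_tent tent_slope_measurable)

lemma tent_slope_square:
  assumes "0 < L" "0 < a"
  shows "in_L2 UNIV (tent_slope a L)" "(\<integral>x. (norm (tent_slope a L x))\<^sup>2 \<partial>lebesgue) \<le> 2 * a\<^sup>2 / L"
proof -
  let ?b = "\<lambda>x. (a / L)\<^sup>2 * indicator {-L<..<L} x :: real"
  have b: "integrable lebesgue ?b"
    by (intro integrable_mult_right) (simp add: lmeasurable_iff_integrable[symmetric])
  have le: "(norm (tent_slope a L x))\<^sup>2 \<le> ?b x" for x
    using assms by (auto simp: tent_slope_def indicator_def power_divide)
  have i: "integrable lebesgue (\<lambda>x. (norm (tent_slope a L x))\<^sup>2)"
    by (rule Bochner_Integration.integrable_bound[OF b])
       (use le tent_slope_measurable in \<open>auto intro!: borel_measurable_power AE_I2 order_trans[OF le]\<close>)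
  then show "in_L2 UNIV (tent_slope a L)"
    by (simp add: in_L2_iff_extension tent_slope_measurable)
  have "(\<integral>x. (norm (tent_slope a L x))\<^sup>2 \<partial>lebesgue) \<le> (\<integral>x. ?b x \<partial>lebesgue)"
    by (rule integral_mono[OF i b le])
  also have "\<dots> = (a / L)\<^sup>2 * (2 * L)" using assms by simp
  also have "\<dots> = 2 * a\<^sup>2 / L" using assms by (simp add: power2_eq_square)
  finally show "(\<integral>x. (norm (tent_slope a L x))\<^sup>2 \<partial>lebesgue) \<le> 2 * a\<^sup>2 / L" .
qed

lemma tent_volume:
  assumes "0 < L" "0 < a"
  shows "has_bochner_integral lebesgue (tent a L) (a * L)"
proof -
  have i: "integrable lebesgue (tent a L)"
    by (rule integrable_continuous_bounded_support[where R=L]) (use tent_eq_0[OF assms] continuous_tent in auto)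
  have "(\<integral>x. tent a L x \<partial>lebesgue) = (\<integral>x. indicator (box (-L) L) x *\<^sub>R tent a L x \<partial>lebesgue)"
  proof (rule Bochner_Integration.integral_cong)
    show "tent a L x = indicator (box (-L) L) x *\<^sub>R tent a L x" for x
    proof (cases "L \<le> \<bar>x\<bar>")
      case True
      then show ?thesis by (simp add: tent_eq_0[OF assms])
    next
      case False
      then have "x \<in> box (-L) L" by (auto simp: not_le abs_less_iff)
      then show ?thesis by simp
    qed
  qed simp
  also have "\<dots> = integral\<^sup>L (lebesgue_on (box (-L) L)) (tent a L)" by (simp add: integral_lebesgue_on)
  also have "\<dots> = integral {-L..L} (tent a L)" using integral_box_continuous[OF continuous_tent, of "-L" L a L] by simp
  also have "\<dots> = a * L"
  proof (rule integral_unique)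
    let ?F = "\<lambda>s x::real. a * x + s * a * x\<^sup>2 / (2 * L)"
    have d: "(?F s has_vector_derivative a * (1 + s * x / L)) (at x within T)" for s x T
      unfolding has_real_derivative_iff_has_vector_derivative[symmetric]
      by (rule DERIV_subset[of _ _ _ UNIV]) (use assms in \<open>auto intro!: derivative_eq_intros simp: field_simps\<close>)
    have 1: "(tent a L has_integral (?F 1 0 - ?F 1 (-L))) {-L..0}"
    proof (rule fundamental_theorem_of_calculus)
      show "(?F 1 has_vector_derivative tent a L x) (at x within {-L..0})" if "x \<in> {-L..0}" for x
        using d[of 1 x] that assms by (simp add: tent_eq)
    qed (use assms in simp)
    have 2: "(tent a L has_integral (?F (-1) L - ?F (-1) 0)) {0..L}"
    proof (rule fundamental_theorem_of_calculus)
      show "(?F (-1) has_vector_derivative tent a L x) (at x within {0..L})" if "x \<in> {0..L}" for x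
        using d[of "-1" x] that assms by (simp add: tent_eq)
    qed (use assms in simp)
    have "(tent a L has_integral ((?F 1 0 - ?F 1 (-L)) + (?F (-1) L - ?F (-1) 0))) {-L..L}"
      by (rule has_integral_combine[OF _ _ 1 2]) (use assms in auto)
    moreover have "(?F 1 0 - ?F 1 (-L)) + (?F (-1) L - ?F (-1) 0) = a * L"
      using assms by (simp add: field_simps power2_eq_square)
    ultimately show "(tent a L has_integral a * L) {-L..L}" by (simp only:)
  qed
  finally show ?thesis using i by (simp add: has_bochner_integral_iff)
qed

text \<open>Of the two bounds, the first is used for large volume, where the height of the tent
  exceeds its half-width, the decay length of the potential; the second for small volume, where the tent is flat.\<close>

lemma tent_competitor:
  assumes L: "0 < L" and a: "0 < a"
  shows "F_s (a * L) \<le> ereal (2 * L\<^sup>2 + 2 * a\<^sup>2 / L)" "F_s (a * L) \<le> ereal (4 * (a * L) + 2 * a\<^sup>2 / L)"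
proof -
  let ?h = "tent a L" and ?u = "decaying_potential L"
  have op: "open (Omega ?h)" by (rule open_subgraph[OF continuous_tent])
  have sub: "Omega ?h \<subseteq> box (- L, 0) (L, a)"
  proof
    fix p assume "p \<in> Omega ?h"
    then obtain x y where p: "p = (x, y)" "0 < y" "y < tent a L x" by (auto simp: Omega_def)
    then have x: "\<bar>x\<bar> < L" using tent_eq_0[OF L a, of x] by (cases "L \<le> \<bar>x\<bar>") auto
    have "a * (1 - \<bar>x\<bar> / L) \<le> a * 1" using L a by (intro mult_left_mono) auto
    then have "tent a L x \<le> a" using tent_eq[OF L a, of x] x by simp
    then show "p \<in> box (- L, 0) (L, a)" using p x by (auto simp: box_def Basis_prod_def)
  qed
  have bd: "bounded (Omega ?h)" using bounded_subset[OF bounded_box sub] .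
  have h2: "in_L2 UNIV ?h"
  proof -
    have "integrable lebesgue (\<lambda>x. (norm (?h x))\<^sup>2)"
      by (rule integrable_continuous_bounded_support[where R=L])
         (use tent_eq_0[OF L a] in \<open>auto intro!: continuous_intros continuous_tent\<close>)
    then show ?thesis by (simp add: in_L2_iff_extension continuous_measurable_lebesgue continuous_tent)
  qed
  have adm: "(?u, ?h) \<in> admissible (a * L)"
    unfolding admissible_def has_trace_on_supp_def
  proof (clarsimp, intro conjI allI impI)
    show "in_H1 UNIV ?h"
      unfolding in_H1_def using h2 tent_slope_square(1)[OF L a] tent_weak_gradient[OF L a] by blast
    show "in_H1 (Omega ?h) ?u" by (rule smooth_dirichlet(1)[OF smooth_decaying_potential op bd])
    show "has_bottom_trace c b d ?u (\<lambda>x. x)" for c b d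
      by (rule smooth_has_bottom_trace[OF smooth_decaying_potential]) (auto simp: decaying_potential_def)
  qed (use continuous_tent tent_nonneg tent_volume[OF L a] in auto)
  have "S_energy ?h = (\<integral>x. (norm (tent_slope a L x))\<^sup>2 \<partial>lebesgue)"
    using integral_weak_gradient_eq[OF open_UNIV tent_slope_square(1)[OF L a] tent_weak_gradient[OF L a]]
    by (simp add: S_energy_def integral_lebesgue_on)
  then have S: "S_energy ?h \<le> 2 * a\<^sup>2 / L" using tent_slope_square(2)[OF L a] by simp
  have F: "F_s (a * L) \<le> ereal (E_energy ?u ?h + S_energy ?h)"
    unfolding F_s_def using INF_lower[OF adm, of "\<lambda>(u, h). ereal (E_energy u h + S_energy h)"] by simp
  note E = decaying_potential_energy[OF L a sub op, folded E_energy_def]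
  show "F_s (a * L) \<le> ereal (2 * L\<^sup>2 + 2 * a\<^sup>2 / L)"
    by (rule order_trans[OF F]) (use E(1) S in simp)
  show "F_s (a * L) \<le> ereal (4 * (a * L) + 2 * a\<^sup>2 / L)"
    by (rule order_trans[OF F]) (use E(2) S in simp)
qed

text \<open>The half-width \<open>L\<close> balances \<open>2 V\<^sup>2 / L\<^sup>3\<close> against \<open>4 V\<close> when \<open>V \<le> 1\<close> and against
  \<open>2 L\<^sup>2\<close> when \<open>V > 1\<close>. The resulting factors \<open>6\<close> and \<open>4\<close> are weakened to \<open>864\<close>, the
  constant of the lower bound, because one \<open>c\<^sub>0\<close> serves both sides.\<close>

lemma F_s_upper_bound:
  assumes V: "0 < V"
  shows "F_s V \<le> ereal (864 * min V (V powr (4/5)))"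
proof -
  define q where "q = V powr (1/5)"
  have q: "0 < q" "V = q ^ 5" "V powr (4/5) = q ^ 4"
    using V by (simp_all add: q_def powr_power)
  show ?thesis
  proof (cases "V \<le> 1")
    case True
    define L where "L = root 3 V"
    have L: "0 < L" "L ^ 3 = V" using V by (simp_all add: L_def)
    have VL: "V = (V / L) * L" using L by simp
    have "2 * (V / L)\<^sup>2 / L = 2 * V\<^sup>2 / L ^ 3" by (simp add: power_divide power2_eq_square power3_eq_cube)
    also have "\<dots> = 2 * V" unfolding L(2) using V by (simp add: power2_eq_square)
    finally have S: "2 * (V / L)\<^sup>2 / L = 2 * V" .
    have "F_s V \<le> ereal (4 * V + 2 * V)"
      using tent_competitor(2)[OF L(1), of "V / L"] V L(1) unfolding S VL[symmetric] by simp
    also have "\<dots> \<le> ereal (864 * min V (V powr (4/5)))"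
    proof -
      have "q \<le> 1" using True q by (simp add: power_le_one_iff)
      then have "V \<le> V powr (4/5)" unfolding q(3) unfolding q(2) using q(1) by (intro power_decreasing) auto
      then show ?thesis using V by simp
    qed
    finally show ?thesis .
  next
    case False
    define L where "L = q\<^sup>2"
    have L: "0 < L" using q(1) by (simp add: L_def)
    have VL: "V = (V / L) * L" using L by simp
    have E: "2 * L\<^sup>2 = 2 * q ^ 4" by (simp add: L_def)
    have S: "2 * (V / L)\<^sup>2 / L = 2 * q ^ 4"
      using q(1) unfolding q(2) L_def by (simp add: field_simps power_numeral_reduce)
    have "F_s V \<le> ereal (2 * q ^ 4 + 2 * q ^ 4)"
      using tent_competitor(1)[OF L, of "V / L"] V L unfolding S E VL[symmetric] by simp
    also have "\<dots> \<le> ereal (864 * min V (V powr (4/5)))"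
    proof -
      have "1 \<le> q"
      proof (rule ccontr)
        assume "\<not> 1 \<le> q"
        then have "q ^ 5 \<le> 1" using q(1) by (intro power_le_one) auto
        then show False using False q(2) by simp
      qed
      then have "q ^ 4 \<le> q ^ 5" by (intro power_increasing) auto
      then have "V powr (4/5) \<le> V" unfolding q(3) unfolding q(2) .
      then show ?thesis using q by simp
    qed
    finally show ?thesis .
  qed
qed

theorem proposition3p9:
  shows "\<exists>c\<^sub>0::real. c\<^sub>0 > 0 \<and>
    (\<forall>V::real. V > 0 \<longrightarrow>
       ereal (c\<^sub>0 * min V (V powr (4/5))) \<le> F_s V \<and>
       F_s V \<le> ereal (inverse c\<^sub>0 * min V (V powr (4/5)))) \<and>
    (\<exists>C::real. C > 0 \<and>
       (\<exists>V\<^sub>0::real. \<forall>V>0. V \<ge> V\<^sub>0 \<longrightarrow>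
          (\<forall>(u, h)\<in>admissible V.
             E_energy u h + S_energy h \<le> (1 / c\<^sub>0) * V powr (4/5) \<longrightarrow>
             (\<exists>m. (\<forall>x. h x \<le> h m) \<and> h m \<ge> C * V powr (3/5)))))"
proof (rule exI[of _ "1 / 864"], intro conjI allI impI)
  fix V :: real assume V: "0 < V"
  have "ereal (1 / 864 * min V (V powr (4/5))) \<le> ereal (E_energy u h + S_energy h)" if "(u, h) \<in> admissible V" for u h
    using energy_lower_bound(1)[OF V that] by simp
  then show "ereal (1 / 864 * min V (V powr (4/5))) \<le> F_s V"
    unfolding F_s_def by (intro INF_greatest) auto
  show "F_s V \<le> ereal (inverse (1 / 864) * min V (V powr (4/5)))"
    using F_s_upper_bound[OF V] by simp
next
  let ?c = "1 / 864 :: real"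
  have "\<forall>V>0. V \<ge> (864 / ?c) ^ 5 + 1 \<longrightarrow>
          (\<forall>(u, h)\<in>admissible V. E_energy u h + S_energy h \<le> (1 / ?c) * V powr (4/5) \<longrightarrow>
             (\<exists>m. (\<forall>x. h x \<le> h m) \<and> h m \<ge> (?c / 864) ^ 3 * V powr (3/5)))"
  proof (intro allI impI ballI)
    fix V p assume V: "(864 / ?c) ^ 5 + 1 \<le> V" and adm: "p \<in> admissible V"
    obtain u h where p: "p = (u, h)" by (cases p)
    have V': "(864 / ?c) ^ 5 < V" using V by linarith
    show "case p of (u, h) \<Rightarrow> E_energy u h + S_energy h \<le> (1 / ?c) * V powr (4/5) \<longrightarrow>
             (\<exists>m. (\<forall>x. h x \<le> h m) \<and> h m \<ge> (?c / 864) ^ 3 * V powr (3/5))"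
      unfolding p prod.case by (intro impI height_lower_bound[OF _ V' adm[unfolded p]]) simp_all
  qed
  moreover have "0 < (?c / 864) ^ 3" by simp
  ultimately show "\<exists>C::real. C > 0 \<and> (\<exists>V\<^sub>0::real. \<forall>V>0. V \<ge> V\<^sub>0 \<longrightarrow>
          (\<forall>(u, h)\<in>admissible V. E_energy u h + S_energy h \<le> (1 / ?c) * V powr (4/5) \<longrightarrow>
             (\<exists>m. (\<forall>x. h x \<le> h m) \<and> h m \<ge> C * V powr (3/5))))"
    by blast
qed simp

end
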